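(* Let $R>0$, let $f(z)$ be an analytic function on the domain $|z|<R$, and let $X_1,X_2$ be operators with spectral decompositions $$X_j=\int_{\lambda_j\in\sigma(X_j)}\lambda_j\,dE_{X_j}(\lambda_j)+\int_{\lambda_j\in\sigma(X_j)}(X_j-\lambda_j I)\,dE_{X_j}(\lambda_j)=:X_{j,P}+X_{j,N},\qquad j=1,2,$$ where $|\lambda_1|<R$ for all $\lambda_1\in\sigma(X_1)$ and $|\lambda_2|<R$ for all $\lambda_2\in\sigma(X_2)$. Assume moreover that $\lambda_1\neq\lambda_2$ for all $\lambda_1\in\sigma(X_1)$, $\lambda_2\in\sigma(X_2)$. Put $\beta(x_1,x_2)=\frac{f(x_1)-f(x_2)}{x_1-x_2}$. Then $$T_{\beta}^{X_1,X_2}(X_1-X_2)=T_{\beta}^{X_{1,P},X_{2,P}}(X_{1,P}-X_{2,P})+\Big[T_{f(x_1)}^{X_{1,N},X_{2,P}}(I)-T_{f(x_2)}^{X_{1,P},X_{2,N}}(I)\Big],$$ where $f(x_1)$ and $f(x_2)$ as subscripts denote the bivariate functions $(x_1,x_2)\mapsto f(x_1)$ and $(x_1,x_2)\mapsto f(x_2)$.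
   Context: All operators act on a complex Hilbert space, with identity $I$; they need not be self-adjoint. Each parameter operator $X$ is assumed to admit a spectral decomposition $X=\int_{\sigma(X)}\lambda\,dE_X(\lambda)+\int_{\sigma(X)}(X-\lambda I)\,dE_X(\lambda)$, where $\sigma(X)$ is the spectrum and $E_X$ is a spectral measure on $\sigma(X)$ (projection-valued, projections not necessarily orthogonal) with $\int_{\sigma(X)}dE_X(\lambda)=I$ and, formally, with $\delta(\lambda,\lambda')$ the delta symbol, $dE_X(\lambda)\,dE_X(\lambda')=\delta(\lambda,\lambda')\,dE_X(\lambda)$, $dE_X(\lambda')(X-\lambda I)dE_X(\lambda)=(X-\lambda I)dE_X(\lambda)dE_X(\lambda')=\delta(\lambda,\lambda')(X-\lambda I)dE_X(\lambda)$, and $(X-\lambda I)dE_X(\lambda)\,(X-\lambda' I)dE_X(\lambda')=\delta(\lambda,\lambda')(X-\lambda I)^2dE_X(\lambda)$. For each $\lambda\in\sigma(X)$, $(X-\lambda I)dE_X(\lambda)$ is nilpotent, of order $m_\lambda\ge 1$: $[(X-\lambda I)dE_X(\lambda)]^\ell=0$ for $\ell\ge m_\lambda$. An integral $\int g(\lambda)(X-\lambda I)^q dE_X(\lambda)$ is read by expanding $(X-\lambda I)^q$ in powers of $X$ and $\lambda$. All integrals are assumed to be well defined. Generalized double operator integral (GDOI): for operators $X_1,X_2,Y$ and a bivariate analytic function $\beta$, $$T_\beta^{X_1,X_2}(Y)=\int_{\sigma(X_1)}\int_{\sigma(X_2)}\sum_{q_1=0}^{m_{\lambda_1}-1}\sum_{q_2=0}^{m_{\lambda_2}-1}\frac{\beta^{(q_1,q_2)}(\lambda_1,\lambda_2)}{q_1!\,q_2!}(X_1-\lambda_1I)^{q_1}dE_{X_1}(\lambda_1)\,Y\,(X_2-\lambda_2I)^{q_2}dE_{X_2}(\lambda_2),$$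 where $\beta^{(q_1,q_2)}$ is the partial derivative of order $q_1$ in the first and $q_2$ in the second variable, $\beta^{(0,0)}=\beta$, and $(X-\lambda I)^0=I$. The subscripts $P$ (projection part) and $N$ (nilpotent part) on the parameter operators select the corresponding terms of this sum: $$T_\beta^{X_{1,P},X_{2,P}}(Y)=\int_{\sigma(X_1)}\int_{\sigma(X_2)}\beta(\lambda_1,\lambda_2)\,dE_{X_1}(\lambda_1)\,Y\,dE_{X_2}(\lambda_2),$$ $$T_\beta^{X_{1,P},X_{2,N}}(Y)=\int_{\sigma(X_1)}\int_{\sigma(X_2)}\sum_{q_2=1}^{m_{\lambda_2}-1}\frac{\beta^{(0,q_2)}(\lambda_1,\lambda_2)}{q_2!}dE_{X_1}(\lambda_1)\,Y\,(X_2-\lambda_2I)^{q_2}dE_{X_2}(\lambda_2),$$ $$T_\beta^{X_{1,N},X_{2,P}}(Y)=\int_{\sigma(X_1)}\int_{\sigma(X_2)}\sum_{q_1=1}^{m_{\lambda_1}-1}\frac{\beta^{(q_1,0)}(\lambda_1,\lambda_2)}{q_1!}(X_1-\lambda_1I)^{q_1}dE_{X_1}(\lambda_1)\,Y\,dE_{X_2}(\lambda_2).$$ *)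

theory Defs
  imports "HOL-Complex_Analysis.Complex_Analysis" "HOL-Library.Function_Algebras"
begin

text \<open>
  Operators are functions \<open>'a \<Rightarrow> 'a\<close> with pointwise \<open>+\<close> and \<open>-\<close>; operator products are
  compositions, so operator powers are \<open>^^\<close>. The pointwise \<open>*\<close>, \<open>1\<close> and \<open>^\<close> that
  \<open>Function_Algebras\<close> also puts on functions are never used.
\<close>

section \<open>Complex Hilbert spaces and their bounded operators\<close>

class complex_hilbert_space = real_inner + complete_space +
  fixes scaleC :: "complex \<Rightarrow> 'a \<Rightarrow> 'a"  (infixr "*\<^sub>C" 75)
    and cinner :: "'a \<Rightarrow> 'a \<Rightarrow> complex"
  assumes scaleC_add_right: "c *\<^sub>C (x + y) = c *\<^sub>C x + c *\<^sub>C y"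
    and scaleC_add_left: "(c + d) *\<^sub>C x = c *\<^sub>C x + d *\<^sub>C x"
    and scaleC_scaleC: "c *\<^sub>C d *\<^sub>C x = (c * d) *\<^sub>C x"
    and scaleC_of_real: "complex_of_real r *\<^sub>C x = r *\<^sub>R x"
    and cinner_commute: "cinner x y = cnj (cinner y x)"
    and cinner_add_left: "cinner (x + y) z = cinner x z + cinner y z"
    and cinner_scaleC_left: "cinner (c *\<^sub>C x) y = c * cinner x y"
    and Re_cinner: "Re (cinner x y) = inner x y"
begin

subclass banach ..

end

instantiation complex :: complex_hilbert_space
begin

definition scaleC_complex :: "complex \<Rightarrow> complex \<Rightarrow> complex"
  where "scaleC_complex c x = c * x"

definition cinner_complex :: "complex \<Rightarrow> complex \<Rightarrow> complex"
  where "cinner_complex x y = x * cnj y"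

instance
  by standard
    (simp_all add: scaleC_complex_def cinner_complex_def inner_complex_def algebra_simps
      scaleR_conv_of_real)

end

definition bounded_clinear :: "('a::complex_hilbert_space \<Rightarrow> 'a) \<Rightarrow> bool"
  where "bounded_clinear T \<longleftrightarrow> bounded_linear T \<and> (\<forall>c x. T (c *\<^sub>C x) = c *\<^sub>C T x)"

definition shift :: "('a::complex_hilbert_space \<Rightarrow> 'a) \<Rightarrow> complex \<Rightarrow> 'a \<Rightarrow> 'a"
  where "shift X l = (\<lambda>x. X x - l *\<^sub>C x)"

definition spectrum :: "('a::complex_hilbert_space \<Rightarrow> 'a) \<Rightarrow> complex set"
  where "spectrum X =
    {l. \<not> (\<exists>Y. bounded_clinear Y \<and> Y \<circ> shift X l = id \<and> shift X l \<circ> Y = id)}"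


section \<open>Spectral measures and integrals against them\<close>

abbreviation borel_subsets :: "complex set \<Rightarrow> complex set set"
  where "borel_subsets S \<equiv> sets (restrict_space borel S)"

text \<open>
  The projections are idempotent (take \<open>A = B\<close>) but need not be self-adjoint. Countable
  additivity is in the strong operator topology.
\<close>

definition spectral_measure :: "complex set \<Rightarrow> (complex set \<Rightarrow> 'a::complex_hilbert_space \<Rightarrow> 'a) \<Rightarrow> bool"
  where "spectral_measure S E \<longleftrightarrow>
    (\<forall>A\<in>borel_subsets S. bounded_clinear (E A)) \<and>
    E S = id \<and>
    (\<forall>A\<in>borel_subsets S. \<forall>B\<in>borel_subsets S. E A \<circ> E B = E (A \<inter> B)) \<and>
    (\<forall>A x. range A \<subseteq> borel_subsets S \<longrightarrow> disjoint_family A \<longrightarrow>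
       (\<lambda>n::nat. E (A n) x) sums E (\<Union>n. A n) x)"

text \<open>
  Integrals are limits, in the strong operator topology, of Riemann sums over finite Borel
  partitions with one tag in each cell, along refinement of the partition and uniformly in the
  tags. For a bounded Borel function \<open>g\<close> this yields the usual spectral integral of \<open>g\<close>.
\<close>

definition borel_partition :: "complex set \<Rightarrow> complex set set \<Rightarrow> bool"
  where "borel_partition S P \<longleftrightarrow> finite P \<and> partition_on S P \<and> P \<subseteq> borel_subsets S"

definition tagged_partitions :: "complex set \<Rightarrow> (complex set set \<times> (complex set \<Rightarrow> complex)) filter"
  where "tagged_partitions S = (INF P\<in>{P. borel_partition S P}.
    principal {(Q, t). borel_partition S Q \<and> refines S Q P \<and> (\<forall>A\<in>Q. t A \<in> A)})"

text \<open>
  The integrand \<open>K\<close> is given as a function of the point and of the increment \<open>dE\<close> of the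
  measure, e.g. \<open>\<lambda>l dE x. g l *\<^sub>C (shift X l ^^ q) (dE x)\<close>. The Riemann sums are linear in
  \<open>K\<close>, so this agrees with first expanding the power of \<open>shift X l\<close> in powers of \<open>X\<close> and \<open>l\<close>
  and then integrating the scalar factors.
\<close>

definition has_spectral_integral ::
  "complex set \<Rightarrow> (complex set \<Rightarrow> 'a::complex_hilbert_space \<Rightarrow> 'a) \<Rightarrow>
   (complex \<Rightarrow> ('a \<Rightarrow> 'a) \<Rightarrow> 'a \<Rightarrow> 'a) \<Rightarrow> ('a \<Rightarrow> 'a) \<Rightarrow> bool"
  where "has_spectral_integral S E K T \<longleftrightarrow> bounded_clinear T \<and>
    (\<forall>x. ((\<lambda>(P, s). \<Sum>A\<in>P. K (s A) (E A) x) \<longlongrightarrow> T x) (tagged_partitions S))"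

definition spectral_integral ::
  "complex set \<Rightarrow> (complex set \<Rightarrow> 'a::complex_hilbert_space \<Rightarrow> 'a) \<Rightarrow>
   (complex \<Rightarrow> ('a \<Rightarrow> 'a) \<Rightarrow> 'a \<Rightarrow> 'a) \<Rightarrow> 'a \<Rightarrow> 'a"
  where "spectral_integral S E K = (THE T. has_spectral_integral S E K T)"

definition has_double_spectral_integral ::
  "complex set \<Rightarrow> (complex set \<Rightarrow> 'a::complex_hilbert_space \<Rightarrow> 'a) \<Rightarrow>
   complex set \<Rightarrow> (complex set \<Rightarrow> 'a \<Rightarrow> 'a) \<Rightarrow>
   (complex \<Rightarrow> complex \<Rightarrow> ('a \<Rightarrow> 'a) \<Rightarrow> ('a \<Rightarrow> 'a) \<Rightarrow> 'a \<Rightarrow> 'a) \<Rightarrow> ('a \<Rightarrow> 'a) \<Rightarrow> bool"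
  where "has_double_spectral_integral S1 E1 S2 E2 K T \<longleftrightarrow> bounded_clinear T \<and>
    (\<forall>x. ((\<lambda>((P, s), (Q, t)). \<Sum>A\<in>P. \<Sum>B\<in>Q. K (s A) (t B) (E1 A) (E2 B) x) \<longlongrightarrow> T x)
       (tagged_partitions S1 \<times>\<^sub>F tagged_partitions S2))"

definition double_spectral_integral ::
  "complex set \<Rightarrow> (complex set \<Rightarrow> 'a::complex_hilbert_space \<Rightarrow> 'a) \<Rightarrow>
   complex set \<Rightarrow> (complex set \<Rightarrow> 'a \<Rightarrow> 'a) \<Rightarrow>
   (complex \<Rightarrow> complex \<Rightarrow> ('a \<Rightarrow> 'a) \<Rightarrow> ('a \<Rightarrow> 'a) \<Rightarrow> 'a \<Rightarrow> 'a) \<Rightarrow> 'a \<Rightarrow> 'a"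
  where "double_spectral_integral S1 E1 S2 E2 K =
    (THE T. has_double_spectral_integral S1 E1 S2 E2 K T)"

lemma borel_partition_common_refinement:
  assumes "borel_partition S P" "borel_partition S Q"
  shows "\<exists>R. borel_partition S R \<and> refines S R P \<and> refines S R Q"
proof -
  define R where "R = {C. C \<noteq> {} \<and> (\<exists>A\<in>P. \<exists>B\<in>Q. C = A \<inter> B)}"
  have P: "finite P" "partition_on S P" "P \<subseteq> borel_subsets S"
    and Q: "finite Q" "partition_on S Q" "Q \<subseteq> borel_subsets S"
    using assms unfolding borel_partition_def by blast+
  have R: "partition_on S R"
  proof (rule partition_onI)
    show "\<Union>R = S"
    proof
      show "\<Union>R \<subseteq> S"
        using partition_onD1[OF P(2)] unfolding R_def by blast
      show "S \<subseteq> \<Union>R"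
      proof
        fix x assume "x \<in> S"
        then have "x \<in> \<Union>P" "x \<in> \<Union>Q"
          using partition_onD1[OF P(2)] partition_onD1[OF Q(2)] by simp_all
        then obtain A B where AB: "A \<in> P" "x \<in> A" "B \<in> Q" "x \<in> B"
          by (elim UnionE)
        show "x \<in> \<Union>R"
        proof (rule UnionI)
          show "A \<inter> B \<in> R" unfolding R_def using AB by blast
          show "x \<in> A \<inter> B" using AB by simp
        qed
      qed
    qed
  next
    fix C D assume "C \<in> R" "D \<in> R" "C \<noteq> D"
    then obtain A B A' B' where C: "A \<in> P" "B \<in> Q" "C = A \<inter> B"
      and D: "A' \<in> P" "B' \<in> Q" "D = A' \<inter> B'"
      unfolding R_def by blast
    with \<open>C \<noteq> D\<close> have "A \<noteq> A' \<or> B \<noteq> B'" by blast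
    then have "A \<inter> A' = {} \<or> B \<inter> B' = {}"
      using disjointD[OF partition_onD2[OF P(2)] C(1) D(1)]
        disjointD[OF partition_onD2[OF Q(2)] C(2) D(2)] by blast
    then show "disjnt C D" unfolding C D disjnt_def by blast
  next
    show "{} \<notin> R" unfolding R_def by blast
  qed
  have "R \<subseteq> (\<lambda>(A, B). A \<inter> B) ` (P \<times> Q)"
    unfolding R_def by blast
  then have "finite R"
    using P(1) Q(1) by (meson finite_SigmaI finite_imageI finite_subset)
  moreover have "R \<subseteq> borel_subsets S"
  proof
    fix C assume "C \<in> R"
    then obtain A B where "A \<in> P" "B \<in> Q" and C: "C = A \<inter> B"
      unfolding R_def by blast
    then have "A \<in> borel_subsets S" "B \<in> borel_subsets S"
      using P(3) Q(3) by blast+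
    then show "C \<in> borel_subsets S" unfolding C by (rule sets.Int)
  qed
  ultimately have "borel_partition S R"
    unfolding borel_partition_def using R by blast
  moreover have "\<forall>C\<in>R. \<exists>A\<in>P. C \<subseteq> A" "\<forall>C\<in>R. \<exists>B\<in>Q. C \<subseteq> B"
    unfolding R_def by blast+
  then have "refines S R P" "refines S R Q"
    using R P(2) Q(2) unfolding refines_def by simp_all
  ultimately show ?thesis by blast
qed

lemma borel_partition_exists: "\<exists>P. borel_partition S P"
proof (cases "S = {}")
  case True
  then have "borel_partition S {}"
    by (simp add: borel_partition_def partition_on_def)
  then show ?thesis ..
next
  case False
  then have "partition_on S {S}"
    by (rule partition_on_space)
  moreover have "S \<in> borel_subsets S"
    using sets.top[of "restrict_space borel S"] by (simp add: space_restrict_space)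
  ultimately have "borel_partition S {S}"
    unfolding borel_partition_def by simp
  then show ?thesis ..
qed

lemma tagged_partitions_not_bot: "tagged_partitions S \<noteq> bot"
proof -
  define D where
    "D P = {(Q, t). borel_partition S Q \<and> refines S Q P \<and> (\<forall>A\<in>Q. t A \<in> (A :: complex set))}" for P
  have D_ne: "D P \<noteq> {}" if P: "borel_partition S P" for P
  proof -
    have "partition_on S P"
      using P unfolding borel_partition_def by simp
    then have "refines S P P" "{} \<notin> P"
      by (rule refines_refl, rule partition_onD3)
    moreover have "(SOME a. a \<in> A) \<in> A" if "A \<in> P" for A
      using that \<open>{} \<notin> P\<close> by (metis some_in_eq)
    ultimately have "(P, \<lambda>A. SOME a. a \<in> A) \<in> D P"
      using P unfolding D_def by simp
    then show ?thesis by blast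
  qed
  have "(INF P\<in>{P. borel_partition S P}. principal (D P)) \<noteq> bot"
  proof (rule ccontr)
    assume "\<not> ?thesis"
    then have "eventually (\<lambda>_. False) (INF P\<in>{P. borel_partition S P}. principal (D P))"
      by (simp only: trivial_limit_def not_not)
    moreover have "eventually (\<lambda>_. False) (INF P\<in>{P. borel_partition S P}. principal (D P)) \<longleftrightarrow>
      (\<exists>P\<in>{P. borel_partition S P}. eventually (\<lambda>_. False) (principal (D P)))"
    proof (rule eventually_INF_base)
      show "{P. borel_partition S P} \<noteq> {}"
        using borel_partition_exists by blast
    next
      fix P Q
      assume "P \<in> {P. borel_partition S P}" "Q \<in> {P. borel_partition S P}"
      then have "borel_partition S P" "borel_partition S Q"
        by simp_all
      from borel_partition_common_refinement[OF this]
      obtain R where R: "borel_partition S R" "refines S R P" "refines S R Q"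
        by (elim exE conjE)
      have "D R \<subseteq> D P" "D R \<subseteq> D Q"
        unfolding D_def by (auto intro: refines_trans[OF _ R(2)] refines_trans[OF _ R(3)])
      then have "principal (D R) \<le> inf (principal (D P)) (principal (D Q))"
        by simp
      with R(1) show "\<exists>R\<in>{P. borel_partition S P}.
          principal (D R) \<le> inf (principal (D P)) (principal (D Q))"
        by blast
    qed
    ultimately show False
      using D_ne unfolding eventually_principal by blast
  qed
  then show ?thesis
    unfolding tagged_partitions_def D_def .
qed

lemma spectral_integral_unique:
  assumes "has_spectral_integral S E K T"
  shows "spectral_integral S E K = T"
  unfolding spectral_integral_def
proof (rule the_equality)
  show "has_spectral_integral S E K T" by (fact assms)
next
  fix U assume "has_spectral_integral S E K U"
  then show "U = T"
    using assms tendsto_unique[OF tagged_partitions_not_bot[of S]]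
    unfolding has_spectral_integral_def by (intro ext) blast
qed

lemma double_spectral_integral_unique:
  assumes "has_double_spectral_integral S1 E1 S2 E2 K T"
  shows "double_spectral_integral S1 E1 S2 E2 K = T"
  unfolding double_spectral_integral_def
proof (rule the_equality)
  show "has_double_spectral_integral S1 E1 S2 E2 K T" by (fact assms)
next
  have *: "tagged_partitions S1 \<times>\<^sub>F tagged_partitions S2 \<noteq> bot"
    by (simp add: prod_filter_eq_bot tagged_partitions_not_bot)
  fix U assume "has_double_spectral_integral S1 E1 S2 E2 K U"
  then show "U = T"
    using assms tendsto_unique[OF *]
    unfolding has_double_spectral_integral_def by (intro ext) blast
qed


section \<open>Spectral decompositions\<close>

definition proj_part :: "('a::complex_hilbert_space \<Rightarrow> 'a) \<Rightarrow> (complex set \<Rightarrow> 'a \<Rightarrow> 'a) \<Rightarrow> 'a \<Rightarrow> 'a"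
  where "proj_part X E = spectral_integral (spectrum X) E (\<lambda>l dE x. l *\<^sub>C dE x)"

definition nil_part :: "('a::complex_hilbert_space \<Rightarrow> 'a) \<Rightarrow> (complex set \<Rightarrow> 'a \<Rightarrow> 'a) \<Rightarrow> 'a \<Rightarrow> 'a"
  where "nil_part X E = spectral_integral (spectrum X) E (\<lambda>l dE x. shift X l (dE x))"

text \<open>
  The formal relations between increments are read in integrated form. Those relating
  \<open>dE\<close> and \<open>(X - l) dE\<close> say that \<open>E\<close> is multiplicative and commutes with \<open>X\<close>. Nilpotency,
  \<open>(X - l)^k dE(l) = 0\<close> whenever \<open>k \<ge> m l\<close>, says that the integral of \<open>(X - l)^k dE(l)\<close> over every
  Borel set of such \<open>l\<close> vanishes; a condition on single points would be void on the continuous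
  part of the spectrum, where \<open>E {l} = 0\<close>. Borel measurability of the order \<open>m\<close> provides enough
  such sets.
\<close>

definition spectral_decomposition ::
  "('a::complex_hilbert_space \<Rightarrow> 'a) \<Rightarrow> (complex set \<Rightarrow> 'a \<Rightarrow> 'a) \<Rightarrow> (complex \<Rightarrow> nat) \<Rightarrow> bool"
  where "spectral_decomposition X E m \<longleftrightarrow>
    bounded_clinear X \<and>
    spectral_measure (spectrum X) E \<and>
    (\<forall>A\<in>borel_subsets (spectrum X). E A \<circ> X = X \<circ> E A) \<and>
    m \<in> measurable (restrict_space borel (spectrum X)) (count_space UNIV) \<and>
    (\<forall>l\<in>spectrum X. 1 \<le> m l) \<and>
    (\<forall>k. \<forall>A\<in>borel_subsets (spectrum X). (\<forall>l\<in>A. m l \<le> k) \<longrightarrow>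
       has_spectral_integral A E (\<lambda>l dE x. (shift X l ^^ k) (dE x)) (\<lambda>x. 0)) \<and>
    (\<exists>S. has_spectral_integral (spectrum X) E (\<lambda>l dE x. l *\<^sub>C dE x) S) \<and>
    (\<exists>N. has_spectral_integral (spectrum X) E (\<lambda>l dE x. shift X l (dE x)) N) \<and>
    X = proj_part X E + nil_part X E"


section \<open>Generalized double operator integrals\<close>

definition mixed_deriv :: "nat \<Rightarrow> nat \<Rightarrow> (complex \<Rightarrow> complex \<Rightarrow> complex) \<Rightarrow> complex \<Rightarrow> complex \<Rightarrow> complex"
  where "mixed_deriv q1 q2 \<beta> l1 l2 = (deriv ^^ q1) (\<lambda>x1. (deriv ^^ q2) (\<lambda>x2. \<beta> x1 x2) l2) l1"

text \<open>
  The selector attached to a parameter operator: \<open>Whole\<close> for \<open>X\<close>, \<open>ProjPart\<close> and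
  \<open>NilPart\<close> for the subscripts \<open>P\<close> and \<open>N\<close>.
\<close>

datatype part = Whole | ProjPart | NilPart

fun orders :: "part \<Rightarrow> nat \<Rightarrow> nat set"
  where
    "orders Whole m = {0..<m}"
  | "orders ProjPart m = {0}"
  | "orders NilPart m = {1..<m}"

definition gdoi_integrand ::
  "(complex \<Rightarrow> complex \<Rightarrow> complex) \<Rightarrow>
   ('a::complex_hilbert_space \<Rightarrow> 'a) \<Rightarrow> (complex \<Rightarrow> nat) \<Rightarrow> part \<Rightarrow>
   ('a \<Rightarrow> 'a) \<Rightarrow> (complex \<Rightarrow> nat) \<Rightarrow> part \<Rightarrow> ('a \<Rightarrow> 'a) \<Rightarrow>
   complex \<Rightarrow> complex \<Rightarrow> ('a \<Rightarrow> 'a) \<Rightarrow> ('a \<Rightarrow> 'a) \<Rightarrow> 'a \<Rightarrow> 'a"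
  where "gdoi_integrand \<beta> X1 m1 p1 X2 m2 p2 Y l1 l2 dE1 dE2 x =
    (\<Sum>q1\<in>orders p1 (m1 l1). \<Sum>q2\<in>orders p2 (m2 l2).
       (mixed_deriv q1 q2 \<beta> l1 l2 / (fact q1 * fact q2)) *\<^sub>C
         (shift X1 l1 ^^ q1) (dE1 (Y ((shift X2 l2 ^^ q2) (dE2 x)))))"

definition gdoi_exists ::
  "(complex \<Rightarrow> complex \<Rightarrow> complex) \<Rightarrow>
   ('a::complex_hilbert_space \<Rightarrow> 'a) \<Rightarrow> (complex set \<Rightarrow> 'a \<Rightarrow> 'a) \<Rightarrow> (complex \<Rightarrow> nat) \<Rightarrow> part \<Rightarrow>
   ('a \<Rightarrow> 'a) \<Rightarrow> (complex set \<Rightarrow> 'a \<Rightarrow> 'a) \<Rightarrow> (complex \<Rightarrow> nat) \<Rightarrow> part \<Rightarrow>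
   ('a \<Rightarrow> 'a) \<Rightarrow> bool"
  where "gdoi_exists \<beta> X1 E1 m1 p1 X2 E2 m2 p2 Y \<longleftrightarrow>
    (\<exists>T. has_double_spectral_integral (spectrum X1) E1 (spectrum X2) E2
      (gdoi_integrand \<beta> X1 m1 p1 X2 m2 p2 Y) T)"

definition gdoi ::
  "(complex \<Rightarrow> complex \<Rightarrow> complex) \<Rightarrow>
   ('a::complex_hilbert_space \<Rightarrow> 'a) \<Rightarrow> (complex set \<Rightarrow> 'a \<Rightarrow> 'a) \<Rightarrow> (complex \<Rightarrow> nat) \<Rightarrow> part \<Rightarrow>
   ('a \<Rightarrow> 'a) \<Rightarrow> (complex set \<Rightarrow> 'a \<Rightarrow> 'a) \<Rightarrow> (complex \<Rightarrow> nat) \<Rightarrow> part \<Rightarrow>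
   ('a \<Rightarrow> 'a) \<Rightarrow> 'a \<Rightarrow> 'a"
  where "gdoi \<beta> X1 E1 m1 p1 X2 E2 m2 p2 Y =
    double_spectral_integral (spectrum X1) E1 (spectrum X2) E2
      (gdoi_integrand \<beta> X1 m1 p1 X2 m2 p2 Y)"

end

theory Submission
  imports Defs
begin

text \<open>
  For tags \<open>l1\<close>, \<open>l2\<close> write \<open>X1 - X2 = (X1 - l1) - (X2 - l2) + (l1 - l2)\<close>. By Leibniz' rule for
  \<open>(x1 - x2) \<beta>(x1, x2) = f(x1) - f(x2)\<close> the Taylor coefficients of \<open>\<beta>\<close> satisfy a recursion which makes the
  Riemann sum of the left-hand side telescope to that of the right-hand side, up to terms
  \<open>g(l1, l2) U E1(A) V E2(B)\<close> in which one of \<open>U\<close>, \<open>V\<close> is small: it is \<open>P - l\<close> for the projection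
  part \<open>P\<close>, or \<open>(X - l)^m\<close> for the order \<open>m\<close> of nilpotency.

  Such double sums are not controlled by the supremum of \<open>g\<close>, since the spectral measures need not
  commute. They are controlled if \<open>g\<close> is a Schur multiplier, and \<open>1 / (l1 - l2)\<close> is one on small
  balls by expanding it in a geometric series. As the limit \<open>T\<close> of the error exists by assumption,
  it is enough to show \<open>E1(A) T E2(B) = 0\<close> for \<open>A\<close>, \<open>B\<close> in small balls on which the orders of
  nilpotency are constant; countable additivity of the spectral measures then gives \<open>T = 0\<close>.
\<close>

section \<open>Bounded complex-linear operators\<close>

text \<open>The double sums cannot be estimated over the whole spectra at once: the orders
  \<open>m1\<close>, \<open>m2\<close> may be unbounded, and the geometric series converges only on
  pairs of balls that are small compared with their distance. Placing \<open>T\<close> between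
  \<open>E1 A\<close> and \<open>E2 B\<close> restricts the Riemann sums to cells inside
  \<open>A\<close> and \<open>B\<close>, because the operators on either side commute with the
  projections of their own spectral measure.

  What makes the local estimates uniform in the partition is semivariation: sums of projections with
  coefficients of modulus at most 1 stay bounded, although the sum of the norms of the projections
  need not.

  Nilpotency is transferred from increments to one operator. With N = X - P one has X - l = N + (P -
  l), so (X - l)^m dE differs from N^m dE by a small term, and the assumption becomes N^m E(A) = 0.
  Here "small" means linear in the mesh, with constants independent of cells and tags.\<close>

interpretation scaleC_right: additive "scaleC c" for c
  by standard (rule scaleC_add_right)

interpretation scaleC_left: additive "\<lambda>c. scaleC c x" for x
  by standard (rule scaleC_add_left)

lemma scaleC_one [simp]: "(1::complex) *\<^sub>C x = x"
  using scaleC_of_real[of 1 x] by simp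

lemmas scaleC_simps [simp] = scaleC_right.zero scaleC_left.zero scaleC_right.minus scaleC_left.minus

text \<open>The class ties the norm to \<open>cinner\<close> only through real parts, so complex
  homogeneity has to come from pulling the modulus squared of \<open>c\<close> out of both slots of
  \<open>cinner\<close>.\<close>

lemma norm_scaleC: "norm (c *\<^sub>C (x::'a::complex_hilbert_space)) = norm c * norm x"
proof -
  have "cinner (c *\<^sub>C x) (c *\<^sub>C x) = c * cnj (c * cinner x x)"
    by (metis cinner_commute cinner_scaleC_left)
  also have "\<dots> = (c * cnj c) * cinner x x"
    by (metis cinner_commute complex_cnj_mult mult.assoc)
  also have "\<dots> = of_real ((norm c)\<^sup>2) * cinner x x"
    by (simp only: complex_norm_square)
  finally have "Re (cinner (c *\<^sub>C x) (c *\<^sub>C x)) = (norm c)\<^sup>2 * Re (cinner x x)"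
    by simp
  then have "(norm (c *\<^sub>C x))\<^sup>2 = (norm c * norm x)\<^sup>2"
    by (simp add: Re_cinner power2_norm_eq_inner power_mult_distrib)
  then show ?thesis
    by (simp add: power2_eq_iff_nonneg)
qed

lemma bounded_linear_scaleC: "bounded_linear (\<lambda>x::'a::complex_hilbert_space. c *\<^sub>C x)"
  by (rule bounded_linear_intro[where K = "norm c"])
    (simp_all add: scaleC_add_right norm_scaleC scaleC_scaleC mult.commute flip: scaleC_of_real)

lemma bounded_clinear_bounded_linear: "bounded_clinear T \<Longrightarrow> bounded_linear T"
  by (simp add: bounded_clinear_def)

lemma bounded_clinear_scaleC: "bounded_clinear T \<Longrightarrow> T (c *\<^sub>C x) = c *\<^sub>C T x"
  by (simp add: bounded_clinear_def)

lemma bounded_clinear_add: "bounded_clinear T \<Longrightarrow> T (x + y) = T x + T y"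
  by (simp add: bounded_clinear_def linear_simps)

lemma bounded_clinear_diff: "bounded_clinear T \<Longrightarrow> T (x - y) = T x - T y"
  by (simp add: bounded_clinear_def linear_simps)

lemma bounded_clinear_zero: "bounded_clinear T \<Longrightarrow> T 0 = 0"
  by (simp add: bounded_clinear_def linear_simps)

lemma bounded_clinear_sum: "bounded_clinear T \<Longrightarrow> T (\<Sum>i\<in>I. v i) = (\<Sum>i\<in>I. T (v i))"
  by (simp add: bounded_clinear_def bounded_linear.linear linear_sum)

lemma bounded_clinear_bound:
  assumes "bounded_clinear T"
  obtains C where "C \<ge> 0" "\<And>x. norm (T x) \<le> C * norm x"
  using bounded_linear.nonneg_bounded[OF bounded_clinear_bounded_linear[OF assms]]
  by (auto simp: mult.commute)

lemma bounded_clinear_tendsto: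
  "bounded_clinear T \<Longrightarrow> (f \<longlongrightarrow> x) F \<Longrightarrow> ((\<lambda>i. T (f i)) \<longlongrightarrow> T x) F"
  by (rule bounded_linear.tendsto[OF bounded_clinear_bounded_linear])

lemma scaleC_tendsto:
  "(f \<longlongrightarrow> x) F \<Longrightarrow> ((\<lambda>i. c *\<^sub>C f i) \<longlongrightarrow> c *\<^sub>C (x::'a::complex_hilbert_space)) F"
  by (rule bounded_linear.tendsto[OF bounded_linear_scaleC])

lemma bounded_clinear_id: "bounded_clinear (\<lambda>x. x)"
  by (simp add: bounded_clinear_def bounded_linear_ident)

lemma bounded_clinear_compose:
  "bounded_clinear S \<Longrightarrow> bounded_clinear T \<Longrightarrow> bounded_clinear (\<lambda>x. S (T x))"
  by (simp add: bounded_clinear_def bounded_linear_compose)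

lemma bounded_clinear_add_op:
  "bounded_clinear S \<Longrightarrow> bounded_clinear T \<Longrightarrow> bounded_clinear (\<lambda>x. S x + T x)"
  by (simp add: bounded_clinear_def bounded_linear_add scaleC_add_right)

lemma bounded_clinear_diff_op:
  "bounded_clinear S \<Longrightarrow> bounded_clinear T \<Longrightarrow> bounded_clinear (\<lambda>x. S x - T x)"
  by (simp add: bounded_clinear_def bounded_linear_sub scaleC_right.diff)

lemma bounded_clinear_scaleC_op: "bounded_clinear (\<lambda>x. c *\<^sub>C x)"
  by (simp add: bounded_clinear_def bounded_linear_scaleC scaleC_scaleC mult.commute)

lemma bounded_clinear_shift: "bounded_clinear X \<Longrightarrow> bounded_clinear (shift X l)"
  unfolding shift_def by (intro bounded_clinear_diff_op bounded_clinear_scaleC_op)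

lemma bounded_clinear_funpow: "bounded_clinear X \<Longrightarrow> bounded_clinear (X ^^ n)"
proof (induction n)
  case 0
  then show ?case
    by (simp add: id_def bounded_clinear_id)
next
  case (Suc n)
  then show ?case
    by (simp add: o_def bounded_clinear_compose)
qed

lemma funpow_commute_apply:
  assumes "\<And>x. f (g x) = g (f x)"
  shows "(f ^^ n) (g x) = g ((f ^^ n) x)"
  by (induction n) (simp_all add: assms)

text \<open>Banach-Steinhaus by Baire category: the closed sets \<open>V n\<close> of vectors on
  which the family is bounded by \<open>n\<close> cover a complete space, so one of them contains a
  ball. The family of interest consists of the projections of a spectral measure.\<close>

lemma uniform_boundedness:
  fixes \<T> :: "('a::complex_hilbert_space \<Rightarrow> 'a) set"
  assumes lin: "\<And>T. T \<in> \<T> \<Longrightarrow> bounded_clinear T"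
    and bdd: "\<And>x. \<exists>M. \<forall>T\<in>\<T>. norm (T x) \<le> M"
  obtains K where "K \<ge> 0" "\<And>T x. T \<in> \<T> \<Longrightarrow> norm (T x) \<le> K * norm x"
proof -
  define V where "V n = {x. \<forall>T\<in>\<T>. norm (T x) \<le> real n}" for n
  have V_closed: "closed (V n)" for n
  proof -
    have "V n = (\<Inter>T\<in>\<T>. {x. norm (T x) \<le> real n})"
      by (auto simp: V_def)
    moreover have "closed {x. norm (T x) \<le> real n}" if "T \<in> \<T>" for T
      by (intro closed_Collect_le continuous_intros linear_continuous_on
          bounded_clinear_bounded_linear lin that)
    ultimately show ?thesis
      by auto
  qed
  have V_cover: "(\<Union>n. V n) = UNIV"
  proof (intro equalityI subsetI UNIV_I)
    fix x
    obtain M where M: "\<forall>T\<in>\<T>. norm (T x) \<le> M"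
      using bdd by blast
    obtain n where "M \<le> real n"
      using real_arch_simple by blast
    then have "x \<in> V n"
      using M by (force simp: V_def)
    then show "x \<in> (\<Union>n. V n)" by blast
  qed
  have "\<exists>n. interior (V n) \<noteq> {}"
  proof (rule ccontr)
    assume "\<not> ?thesis"
    then have empty: "closedin Met_TC.mtopology T \<and> Met_TC.mtopology interior_of T = {}"
      if "T \<in> range V" for T
      using that V_closed by auto
    have "Met_TC.mtopology interior_of (\<Union>(range V)) = {}"
      by (rule Met_TC.metric_Baire_category_alt)
        (use empty in \<open>auto simp: complete_UNIV\<close>)
    then show False
      using V_cover by simp
  qed
  then obtain n x0 where "x0 \<in> interior (V n)"
    by blast
  then obtain r where r: "r > 0" "cball x0 r \<subseteq> V n"
    by (auto simp: mem_interior_cball)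
  \<comment> \<open>Both \<open>x0\<close> and \<open>x0 + u\<close> with \<open>norm u = r\<close>
    lie in \<open>V n\<close>, so \<open>norm (T u)\<close> is at most \<open>2 * n\<close>;
    homogeneity divides this by \<open>r\<close>.\<close>
  define K where "K = 2 * real n / r"
  have "norm (T x) \<le> K * norm x" if T: "T \<in> \<T>" for T x
  proof (cases "x = 0")
    case True
    then show ?thesis
      using lin[OF T] by (simp add: bounded_clinear_zero)
  next
    case False
    define u where "u = (r / norm x) *\<^sub>R x"
    have "norm u = r"
      using False r(1) by (simp add: u_def)
    then have "x0 + u \<in> V n" "x0 \<in> V n"
      using r by (auto simp: subset_iff dist_norm)
    then have "norm (T (x0 + u)) \<le> n" "norm (T x0) \<le> n"
      using T by (auto simp: V_def)
    moreover have "T u = T (x0 + u) - T x0"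
      using lin[OF T] by (simp add: bounded_clinear_add)
    ultimately have "norm (T u) \<le> 2 * real n"
      by (smt (verit) norm_triangle_ineq4)
    moreover have "T u = (r / norm x) *\<^sub>R T x"
      unfolding u_def by (simp add: bounded_linear.linear bounded_clinear_bounded_linear lin[OF T] linear_scale)
    ultimately show ?thesis
      using False r(1) by (simp add: K_def field_simps)
  qed
  moreover have "K \<ge> 0"
    using r(1) by (simp add: K_def)
  ultimately show ?thesis
    using that by blast
qed

text \<open>Banach's fixed point theorem replaces the Neumann series here.\<close>

lemma invertible_near_identity:
  fixes T :: "'a::complex_hilbert_space \<Rightarrow> 'a"
  assumes T: "bounded_clinear T" and q: "0 \<le> q" "q < 1" and bound: "\<And>x. norm (T x) \<le> q * norm x"
  obtains S where "bounded_clinear S" "\<And>x. S (x - T x) = x" "\<And>x. S x - T (S x) = x"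
proof -
  have ex: "\<exists>!x. z + T x = x" for z
  proof (rule banach_fix_type[OF q])
    show "\<forall>x y. dist (z + T x) (z + T y) \<le> q * dist x y"
      using bound by (simp add: dist_norm flip: bounded_clinear_diff[OF T])
  qed
  \<comment> \<open>\<open>S z\<close> solves \<open>x - T x = z\<close>, so \<open>S\<close> is the
    inverse of the identity minus \<open>T\<close>.\<close>
  define S where "S z = (THE x. z + T x = x)" for z
  have S: "z + T (S z) = S z" for z
    unfolding S_def by (rule theI'[OF ex])
  have S_eqI: "S z = x" if "z + T x = x" for z x
    using ex[of z] S[of z] that by blast
  have S_bound: "norm (S z) \<le> norm z * (1 / (1 - q))" for z
  proof -
    have "norm (S z) \<le> norm z + q * norm (S z)"
      by (metis S add_left_mono bound norm_triangle_le)
    then show ?thesis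
      using q by (simp add: field_simps)
  qed
  have S_add: "S (x + y) = S x + S y" for x y
    using S[of x] S[of y] by (intro S_eqI) (simp add: bounded_clinear_add[OF T], metis add.assoc add.left_commute)
  have S_scaleC: "S (c *\<^sub>C x) = c *\<^sub>C S x" for c x
    using S[of x] by (intro S_eqI) (simp add: bounded_clinear_scaleC[OF T] flip: scaleC_add_right)
  have "bounded_linear S"
    by (rule bounded_linear_intro[OF S_add _ S_bound]) (metis S_scaleC scaleC_of_real)
  then have "bounded_clinear S"
    by (simp add: bounded_clinear_def S_scaleC)
  moreover have "S (x - T x) = x" for x
    by (rule S_eqI) simp
  moreover have "S x - T (S x) = x" for x
    by (metis S add_diff_cancel_right')
  ultimately show ?thesis
    using that by blast
qed

text \<open>Openness of the resolvent set: \<open>shift X l'\<close> is the product of the identity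
  minus a small operator with the invertible \<open>shift X l\<close>. It gives each point of one
  spectrum a positive distance from the other spectrum, as the geometric series for 1 / (l1 - l2)
  requires.\<close>

lemma not_in_spectrum_nhd:
  fixes X :: "'a::complex_hilbert_space \<Rightarrow> 'a"
  assumes X: "bounded_clinear X" and l: "l \<notin> spectrum X"
  obtains r where "r > 0" "\<And>l'. l' \<in> spectrum X \<Longrightarrow> dist l l' \<ge> r"
proof -
  obtain Y where Y: "bounded_clinear Y" "Y \<circ> shift X l = id" "shift X l \<circ> Y = id"
    using l by (auto simp: spectrum_def)
  then have YX: "Y (shift X l x) = x" "shift X l (Y x) = x" for x
    by (metis comp_apply id_apply)+
  obtain C where C: "C \<ge> 0" "\<And>x. norm (Y x) \<le> C * norm x"
    using bounded_clinear_bound[OF Y(1)] by metis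
  \<comment> \<open>With this radius the operator \<open>T\<close> below has norm at most 1/2; the
    summand 1 covers \<open>C = 0\<close>.\<close>
  define r where "r = 1 / (2 * (C + 1))"
  have r: "r > 0"
    using C by (simp add: r_def)
  have "l' \<notin> spectrum X" if "dist l l' < r" for l'
  proof -
    define T where "T x = (l' - l) *\<^sub>C Y x" for x
    have T: "bounded_clinear T"
      unfolding T_def by (intro bounded_clinear_compose[OF bounded_clinear_scaleC_op Y(1)])
    have "norm (T x) \<le> (1/2) * norm x" for x
    proof -
      have "norm (T x) \<le> r * (C * norm x)"
        unfolding T_def norm_scaleC using that C r
        by (intro mult_mono) (auto simp: dist_norm norm_minus_commute)
      also have "r * (C * norm x) \<le> (1/2) * norm x"
        using C(1) mult_nonneg_nonneg[OF C(1) norm_ge_zero[of x]] by (simp add: r_def field_simps)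
      finally show ?thesis .
    qed
    then obtain S where S: "bounded_clinear S" "\<And>x. S (x - T x) = x" "\<And>x. S x - T (S x) = x"
      using invertible_near_identity[OF T, of "1/2"] by auto
    have shift: "shift X l' x = shift X l x - (l' - l) *\<^sub>C x" for x
      by (simp add: shift_def scaleC_left.diff)
    have TX: "T (shift X l x) = (l' - l) *\<^sub>C x" for x
      by (simp add: T_def YX)
    have "shift X l' (Y (S x)) = x" for x
      using S(3)[of x] by (simp add: shift YX T_def)
    moreover have "Y (S (shift X l' x)) = x" for x
      using S(2)[of "shift X l x"] by (simp add: shift TX YX)
    ultimately show ?thesis
      using bounded_clinear_compose[OF Y(1) S(1)]
      by (auto simp: spectrum_def fun_eq_iff intro!: exI[of _ "\<lambda>x. Y (S x)"])
  qed
  then show ?thesis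
    using that[OF r] by (meson not_less)
qed

section \<open>Vector measures\<close>

lemma borel_subsets_subset: "A \<in> borel_subsets S \<Longrightarrow> A \<subseteq> S"
  using sets.sets_into_space[of A "restrict_space borel S"] by (simp add: space_restrict_space)

lemma borel_subsets_whole: "S \<in> borel_subsets S"
  using sets.top[of "restrict_space borel S"] by (simp add: space_restrict_space)

lemma borel_subsets_compl: "A \<in> borel_subsets S \<Longrightarrow> S - A \<in> borel_subsets S"
  by (rule sets.Diff[OF borel_subsets_whole])

lemma borel_subsets_Int_open: "open U \<Longrightarrow> S \<inter> U \<in> borel_subsets S"
  by (auto simp: sets_restrict_space)

lemma borel_subsets_trans:
  assumes "A \<in> borel_subsets S" "B \<in> borel_subsets A"
  shows "B \<in> borel_subsets S"
proof -
  obtain C D where "C \<in> sets borel" "A = S \<inter> C" "D \<in> sets borel" "B = A \<inter> D"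
    using assms unfolding sets_restrict_space by blast
  then have "C \<inter> D \<in> sets borel" "B = S \<inter> (C \<inter> D)"
    by auto
  then show ?thesis
    unfolding sets_restrict_space by (rule rev_image_eqI)
qed

lemma borel_subsets_vimage:
  "m \<in> measurable (restrict_space borel S) (count_space UNIV) \<Longrightarrow> {l \<in> S. m l = n} \<in> borel_subsets S"
  using measurable_sets[of m "restrict_space borel S" "count_space UNIV" "{n}"]
  by (auto simp: space_restrict_space vimage_def Int_def conj_commute)

text \<open>Convergence is in norm; finite total variation is not implied. Two instances matter: the
  orbits \<open>\<lambda>A. E A x\<close>, and for fixed \<open>A\<close> the set function
  \<open>\<lambda>B. E1 A (T (E2 B x))\<close>.\<close>

definition vector_measure :: "complex set \<Rightarrow> (complex set \<Rightarrow> 'a::real_normed_vector) \<Rightarrow> bool"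
  where "vector_measure S F \<longleftrightarrow>
    (\<forall>A. range A \<subseteq> borel_subsets S \<longrightarrow> disjoint_family A \<longrightarrow>
       (\<lambda>n::nat. F (A n)) sums F (\<Union>n. A n))"

lemma vector_measure_sums:
  "vector_measure S F \<Longrightarrow> (\<And>n. A n \<in> borel_subsets S) \<Longrightarrow> disjoint_family A \<Longrightarrow>
    (\<lambda>n::nat. F (A n)) sums F (\<Union>n. A n)"
  by (auto simp: vector_measure_def image_subset_iff)

lemma vector_measure_bounded_linear:
  assumes F: "vector_measure S F" and L: "bounded_linear L"
  shows "vector_measure S (\<lambda>A. L (F A))"
  unfolding vector_measure_def
  by (intro allI impI bounded_linear.sums[OF L] F[unfolded vector_measure_def, rule_format])

lemma vector_measure_empty:
  assumes "vector_measure S F"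
  shows "F {} = 0"
proof -
  have "(\<lambda>n::nat. F {}) sums F (\<Union>n::nat. {})"
    by (rule vector_measure_sums[OF assms]) (auto simp: disjoint_family_on_def)
  then show ?thesis
    by (auto dest: sums_summable simp: summable_const_iff)
qed

lemma vector_measure_Un:
  assumes F: "vector_measure S F" and AB: "A \<in> borel_subsets S" "B \<in> borel_subsets S" "A \<inter> B = {}"
  shows "F (A \<union> B) = F A + F B"
proof -
  define D where "D n = (if n = 0 then A else if n = 1 then B else {})" for n :: nat
  have "(\<lambda>n. F (D n)) sums F (\<Union>n. D n)"
    using AB by (intro vector_measure_sums[OF F]) (auto simp: D_def disjoint_family_on_def)
  moreover have "(\<lambda>n. F (D n)) sums (\<Sum>n\<in>{0, 1}. F (D n))"
    by (rule sums_finite) (auto simp: D_def vector_measure_empty[OF F])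
  moreover have "(\<Union>n. D n) = A \<union> B"
    by (auto simp: D_def split: if_splits)
  ultimately have "F (A \<union> B) = (\<Sum>n\<in>{0, 1}. F (D n))"
    by (metis sums_unique2)
  then show ?thesis
    by (simp add: D_def)
qed

lemma vector_measure_finite_UN:
  assumes F: "vector_measure S F" and "finite I" "\<And>i. i \<in> I \<Longrightarrow> D i \<in> borel_subsets S"
    and "disjoint_family_on D I"
  shows "F (\<Union>i\<in>I. D i) = (\<Sum>i\<in>I. F (D i))"
  using assms(2-)
proof (induction I rule: finite_induct)
  case empty
  then show ?case
    by (simp add: vector_measure_empty[OF F])
next
  case (insert i I)
  have "D i \<inter> (\<Union>j\<in>I. D j) = {}"
    using insert.prems(2) insert.hyps(2) by (force simp: disjoint_family_on_def)
  moreover have "(\<Union>j\<in>I. D j) \<in> borel_subsets S"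
    using insert by (intro sets.finite_UN) auto
  ultimately have "F (D i \<union> (\<Union>j\<in>I. D j)) = F (D i) + F (\<Union>j\<in>I. D j)"
    using insert.prems(1) by (intro vector_measure_Un[OF F]) auto
  moreover have "disjoint_family_on D I"
    using insert.prems(2) by (auto simp: disjoint_family_on_def)
  ultimately show ?case
    using insert by simp
qed

lemma vector_measure_split:
  assumes F: "vector_measure S F" and "A \<in> borel_subsets S" "B \<in> borel_subsets S"
  shows "F A = F (A \<inter> B) + F (A - B)"
proof -
  have "F ((A \<inter> B) \<union> (A - B)) = F (A \<inter> B) + F (A - B)"
    using assms by (intro vector_measure_Un[OF F]) auto
  then show ?thesis
    by (simp add: Int_Diff_Un)
qed

text \<open>
  If the range were unbounded, repeatedly splitting off a piece of norm at least 1 while keeping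
  a remainder on which the range is still unbounded would give disjoint sets whose values do not
  tend to 0.
\<close>

lemma vector_measure_bounded:
  assumes F: "vector_measure S F"
  obtains M where "\<And>A. A \<in> borel_subsets S \<Longrightarrow> norm (F A) \<le> M"
proof -
  define unb where
    "unb A \<longleftrightarrow> A \<in> borel_subsets S \<and> (\<forall>M. \<exists>B\<in>borel_subsets S. B \<subseteq> A \<and> norm (F B) > M)" for A
  have step: "\<exists>B. unb B \<and> (B \<subseteq> A \<and> norm (F (A - B)) \<ge> 1)" if A: "unb A" for A
  proof -
    have A_sets: "A \<in> borel_subsets S"
      using A by (simp add: unb_def)
    \<comment> \<open>The excess over \<open>norm (F A) + 1\<close> forces the values on both
      \<open>C\<close> and \<open>A - C\<close> to have norm at least 1. Whichever piece keeps the
      unbounded range, the discarded one is therefore not small.\<close>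
    obtain C where C: "C \<in> borel_subsets S" "C \<subseteq> A" "norm (F C) > norm (F A) + 1"
      using A unfolding unb_def by meson
    have "F A = F C + F (A - C)"
      using vector_measure_split[OF F A_sets C(1)] C(2) by (simp add: Int_absorb1)
    then have "norm (F C) \<le> norm (F A) + norm (F (A - C))"
      by (metis add_diff_cancel_right' norm_triangle_ineq4)
    then have 1: "norm (F C) \<ge> 1" "norm (F (A - C)) \<ge> 1"
      using C(3) norm_ge_zero[of "F A"] by linarith+
    have "unb C \<or> unb (A - C)"
    proof (rule ccontr)
      assume "\<not> ?thesis"
      then obtain M1 M2
        where M1: "\<And>B. B \<in> borel_subsets S \<Longrightarrow> B \<subseteq> C \<Longrightarrow> norm (F B) \<le> M1"
          and M2: "\<And>B. B \<in> borel_subsets S \<Longrightarrow> B \<subseteq> A - C \<Longrightarrow> norm (F B) \<le> M2"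
        using A_sets C(1) unfolding unb_def by (meson not_less sets.Diff)
      have "norm (F B) \<le> M1 + M2" if B: "B \<in> borel_subsets S" "B \<subseteq> A" for B
      proof -
        have "norm (F (B \<inter> C)) \<le> M1" "norm (F (B - C)) \<le> M2"
          using B C(1) by (auto intro!: M1 M2)
        then show ?thesis
          using vector_measure_split[OF F B(1) C(1)] by (simp add: norm_triangle_mono)
      qed
      then show False
        using A unfolding unb_def by (meson not_less)
    qed
    then show ?thesis
    proof
      assume "unb C"
      then show ?thesis
        using C(2) 1(2) by blast
    next
      assume "unb (A - C)"
      moreover have "A - (A - C) = C"
        using C(2) by blast
      ultimately show ?thesis
        using 1(1) by (intro exI[of _ "A - C"]) auto
    qed
  qed
  have "\<not> unb S"
  proof
    assume "unb S"
    then have "\<exists>A. \<forall>n. unb (A n) \<and> (A (Suc n) \<subseteq> A n \<and> norm (F (A n - A (Suc n))) \<ge> 1)"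
      using step by (intro dependent_nat_choice[where P = "\<lambda>_. unb"]) auto
    then obtain A
      where "\<forall>n. unb (A n) \<and> (A (Suc n) \<subseteq> A n \<and> norm (F (A n - A (Suc n))) \<ge> 1)"
      by (rule exE)
    then have A: "\<And>n. unb (A n)" "\<And>n. A (Suc n) \<subseteq> A n"
        "\<And>n. norm (F (A n - A (Suc n))) \<ge> 1"
      by blast+
    have "antimono A"
      by (rule antimonoI, rule lift_Suc_antimono_le[of A, OF A(2)])
    then have "(A i - A (Suc i)) \<inter> (A j - A (Suc j)) = {}" if "i < j" for i j
      using antimonoD[of A "Suc i" j] that by auto
    then have "disjoint_family (\<lambda>n. A n - A (Suc n))"
      unfolding disjoint_family_on_def by (metis Int_commute linorder_neqE_nat)
    then have "(\<lambda>n. F (A n - A (Suc n))) sums F (\<Union>n. A n - A (Suc n))"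
      using A(1) by (intro vector_measure_sums[OF F]) (auto simp: unb_def)
    then have "(\<lambda>n. F (A n - A (Suc n))) \<longlonglongrightarrow> 0"
      by (intro summable_LIMSEQ_zero sums_summable)
    then have "eventually (\<lambda>n. norm (F (A n - A (Suc n))) < 1) sequentially"
      using order_tendstoD(2)[OF tendsto_norm_zero, of _ sequentially 1] by simp
    then show False
      using A(3) by (meson eventually_happens not_less sequentially_bot)
  qed
  then show ?thesis
    using that borel_subsets_subset borel_subsets_whole unfolding unb_def by (meson not_less)
qed

text \<open>Making the cover disjoint replaces its members by Borel subsets of them, hence the
  hypothesis on subsets; countable additivity then adds up zeros.\<close>

lemma vector_measure_cover_zero:
  assumes F: "vector_measure S F" and C: "countable \<C>" "\<C> \<subseteq> borel_subsets S" "\<Union>\<C> = S"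
    and null: "\<And>C A. C \<in> \<C> \<Longrightarrow> A \<in> borel_subsets S \<Longrightarrow> A \<subseteq> C \<Longrightarrow> F A = 0"
  shows "F S = 0"
proof (cases "\<C> = {}")
  case True
  then show ?thesis
    using C(3) vector_measure_empty[OF F] by simp
next
  case False
  define D where "D = from_nat_into \<C>"
  have D: "range D = \<C>"
    unfolding D_def using False C(1) by (rule range_from_nat_into)
  have sets: "disjointed D n \<in> borel_subsets S" for n
    using sets.range_disjointed_sets[of D "restrict_space borel S"] D C(2) by auto
  have "(\<lambda>n. F (disjointed D n)) sums F (\<Union>n. disjointed D n)"
    by (rule vector_measure_sums[OF F sets disjoint_family_disjointed])
  moreover have "F (disjointed D n) = 0" for n
    using D disjointed_subset[of D n] by (intro null[OF _ sets]) auto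
  ultimately show ?thesis
    using D C(3) sums_unique2[OF _ sums_zero, of "F S"] by (simp add: UN_disjointed_eq)
qed

text \<open>\<open>m\<close> need not be constant near any point, so the local hypothesis speaks of
  subsets of level sets. Lindelof leaves countably many balls, and together with the countably many
  values of \<open>m\<close> they yield a countable cover.\<close>

lemma vector_measure_local_zero:
  assumes F: "vector_measure S F"
    and m: "m \<in> measurable (restrict_space borel S) (count_space UNIV)"
    and local: "\<And>a. a \<in> S \<Longrightarrow> \<exists>r>0. \<forall>n::nat. \<forall>A\<in>borel_subsets S.
      A \<subseteq> ball a r \<longrightarrow> (\<forall>l\<in>A. m l = n) \<longrightarrow> F A = 0"
  shows "F S = 0"
proof -
  obtain r where r: "\<And>a. a \<in> S \<Longrightarrow> r a > 0"
    and null: "\<And>a n A. a \<in> S \<Longrightarrow> A \<in> borel_subsets S \<Longrightarrow> A \<subseteq> ball a (r a) \<Longrightarrow>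
      (\<And>l. l \<in> A \<Longrightarrow> m l = n) \<Longrightarrow> F A = 0"
    using local by metis
  obtain \<U> where \<U>: "\<U> \<subseteq> (\<lambda>a. ball a (r a)) ` S" "countable \<U>"
      "\<Union>\<U> = (\<Union>a\<in>S. ball a (r a))"
    using Lindelof[of "(\<lambda>a. ball a (r a)) ` S"] by blast
  define \<C> where "\<C> = (\<lambda>(U, n). (S \<inter> U) \<inter> {l \<in> S. m l = n}) ` (\<U> \<times> UNIV)"
  show ?thesis
  proof (rule vector_measure_cover_zero[OF F])
    show "countable \<C>"
      unfolding \<C>_def using \<U>(2) by auto
    have "open U" if "U \<in> \<U>" for U
      using that \<U>(1) by auto
    then show "\<C> \<subseteq> borel_subsets S"
      unfolding \<C>_def
      by (auto intro!: sets.Int[OF borel_subsets_Int_open borel_subsets_vimage[OF m]])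
    have "S \<subseteq> \<Union>\<U>"
      unfolding \<U>(3) using r by force
    then show "\<Union>\<C> = S"
      unfolding \<C>_def by fastforce
  next
    fix C A assume *: "C \<in> \<C>" "A \<in> borel_subsets S" "A \<subseteq> C"
    then obtain U n where "U \<in> \<U>" "C = (S \<inter> U) \<inter> {l \<in> S. m l = n}"
      unfolding \<C>_def by auto
    moreover then obtain a where "a \<in> S" "U = ball a (r a)"
      using \<U>(1) by auto
    ultimately show "F A = 0"
      using * by (intro null[of a A n]) auto
  qed
qed

section \<open>Semivariation and Schur multipliers\<close>

text \<open>Bounds the semivariation rather than the variation: over the cells of a partition, the
  sum of the norms of the operators may grow with the number of cells, while for a spectral measure
  one \<open>C\<close> serves all partitions.\<close>

definition semivar_bound ::
  "'i set \<Rightarrow> ('i \<Rightarrow> 'a::complex_hilbert_space \<Rightarrow> 'a) \<Rightarrow> real \<Rightarrow> bool"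
  where "semivar_bound I u C \<longleftrightarrow> C \<ge> 0 \<and>
    (\<forall>\<phi> y. (\<forall>i\<in>I. norm (\<phi> i) \<le> 1) \<longrightarrow> norm (\<Sum>i\<in>I. \<phi> i *\<^sub>C u i y) \<le> C * norm y)"

lemma semivar_boundD:
  assumes u: "semivar_bound I u C" and \<phi>: "\<And>i. i \<in> I \<Longrightarrow> norm (\<phi> i) \<le> k" and k: "k \<ge> 0"
  shows "norm (\<Sum>i\<in>I. \<phi> i *\<^sub>C u i y) \<le> k * C * norm y"
proof (cases "k = 0")
  case True
  then have "(\<Sum>i\<in>I. \<phi> i *\<^sub>C u i y) = 0"
    using \<phi> by (intro sum.neutral) auto
  then show ?thesis
    by (simp add: True)
next
  case False
  have "norm (\<Sum>i\<in>I. (\<phi> i / of_real k) *\<^sub>C u i y) \<le> C * norm y"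
    using u \<phi> k False by (auto simp: semivar_bound_def norm_divide)
  then have "k * norm (\<Sum>i\<in>I. (\<phi> i / of_real k) *\<^sub>C u i y) \<le> k * (C * norm y)"
    using k by (rule mult_left_mono)
  moreover have "of_real k *\<^sub>C (\<Sum>i\<in>I. (\<phi> i / of_real k) *\<^sub>C u i y) = (\<Sum>i\<in>I. \<phi> i *\<^sub>C u i y)"
    using False by (simp add: scaleC_right.sum scaleC_scaleC)
  then have "norm (\<Sum>i\<in>I. \<phi> i *\<^sub>C u i y) = k * norm (\<Sum>i\<in>I. (\<phi> i / of_real k) *\<^sub>C u i y)"
    using k by (metis norm_of_real abs_of_nonneg norm_scaleC)
  ultimately show ?thesis
    by simp
qed

lemma semivar_bound_nonneg: "semivar_bound I u C \<Longrightarrow> C \<ge> 0"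
  by (simp add: semivar_bound_def)

lemma semivar_bound_cong:
  "(\<And>i y. i \<in> I \<Longrightarrow> u i y = v i y) \<Longrightarrow> semivar_bound I u C \<longleftrightarrow> semivar_bound I v C"
  by (simp add: semivar_bound_def)

lemma semivar_bound_scaleC:
  assumes "semivar_bound I u C" "\<And>i. i \<in> I \<Longrightarrow> norm (c i) \<le> k" "k \<ge> 0"
  shows "semivar_bound I (\<lambda>i y. c i *\<^sub>C u i y) (k * C)"
proof -
  have "norm (\<Sum>i\<in>I. \<phi> i *\<^sub>C c i *\<^sub>C u i y) \<le> k * C * norm y"
    if "\<forall>i\<in>I. norm (\<phi> i) \<le> 1" for \<phi> y
    unfolding scaleC_scaleC
    using that assms(2,3) mult_mono[of "norm (\<phi> _)" 1 "norm (c _)" k]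
    by (intro semivar_boundD[OF assms(1)]) (auto simp: norm_mult)
  then show ?thesis
    using assms by (simp add: semivar_bound_def)
qed

lemma semivar_bound_comp:
  assumes u: "semivar_bound I u C" and Y: "bounded_clinear Y" "\<And>x. norm (Y x) \<le> M * norm x" "M \<ge> 0"
  shows "semivar_bound I (\<lambda>i y. Y (u i y)) (M * C)"
proof -
  have "norm (\<Sum>i\<in>I. \<phi> i *\<^sub>C Y (u i y)) \<le> M * C * norm y"
    if "\<forall>i\<in>I. norm (\<phi> i) \<le> 1" for \<phi> y
  proof -
    have "(\<Sum>i\<in>I. \<phi> i *\<^sub>C Y (u i y)) = Y (\<Sum>i\<in>I. \<phi> i *\<^sub>C u i y)"
      by (simp add: bounded_clinear_sum[OF Y(1)] bounded_clinear_scaleC[OF Y(1)])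
    also have "norm \<dots> \<le> M * norm (\<Sum>i\<in>I. \<phi> i *\<^sub>C u i y)"
      by (rule Y(2))
    also have "\<dots> \<le> M * (C * norm y)"
      using u that Y(3) by (intro mult_left_mono) (auto simp: semivar_bound_def)
    finally show ?thesis
      by (simp add: mult.assoc)
  qed
  then show ?thesis
    using u Y(3) by (simp add: semivar_bound_def)
qed

lemma semivar_bound_precomp:
  assumes u: "semivar_bound I u C" and Y: "\<And>x. norm (Y x) \<le> M * norm x" "M \<ge> 0"
  shows "semivar_bound I (\<lambda>i y. u i (Y y)) (M * C)"
proof -
  have "norm (\<Sum>i\<in>I. \<phi> i *\<^sub>C u i (Y y)) \<le> M * C * norm y"
    if "\<forall>i\<in>I. norm (\<phi> i) \<le> 1" for \<phi> y
  proof -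
    have "norm (\<Sum>i\<in>I. \<phi> i *\<^sub>C u i (Y y)) \<le> C * norm (Y y)"
      using u that by (simp add: semivar_bound_def)
    also have "\<dots> \<le> C * (M * norm y)"
      using u Y(1) by (intro mult_left_mono) (auto simp: semivar_bound_def)
    finally show ?thesis
      by (simp add: mult_ac)
  qed
  then show ?thesis
    using u Y(2) by (simp add: semivar_bound_def)
qed

lemma semivar_bound_add:
  assumes "semivar_bound I u C" "semivar_bound I v D"
  shows "semivar_bound I (\<lambda>i y. u i y + v i y) (C + D)"
  using assms unfolding semivar_bound_def
  by (simp add: scaleC_add_right sum.distrib ring_distribs norm_triangle_mono)

lemma semivar_bound_shift:
  assumes u: "semivar_bound I u C" and X: "bounded_clinear X" "\<And>x. norm (X x) \<le> M * norm x" "M \<ge> 0"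
    and s: "\<And>i. i \<in> I \<Longrightarrow> norm (s i) \<le> k" "k \<ge> 0"
  shows "semivar_bound I (\<lambda>i y. shift X (s i) (u i y)) ((M + k) * C)"
  using semivar_bound_add[OF semivar_bound_comp[OF u X]
      semivar_bound_scaleC[OF u, where c = "\<lambda>i. - s i", OF _ s(2)]] s(1)
  by (simp add: shift_def ring_distribs)

lemma semivar_bound_shift_power:
  assumes u: "semivar_bound I u C" and X: "bounded_clinear X" "\<And>x. norm (X x) \<le> M * norm x" "M \<ge> 0"
    and s: "\<And>i. i \<in> I \<Longrightarrow> norm (s i) \<le> k" "k \<ge> 0"
  shows "semivar_bound I (\<lambda>i y. (shift X (s i) ^^ n) (u i y)) ((M + k) ^ n * C)"
proof (induction n)
  case 0
  then show ?case
    using u by simp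
next
  case (Suc n)
  from semivar_bound_shift[OF this X s] show ?case
    by (simp add: mult.assoc)
qed

text \<open>The type argument of a multiplier only records the Hilbert space.\<close>

definition multiplier ::
  "'a::complex_hilbert_space itself \<Rightarrow> complex set \<Rightarrow> complex set \<Rightarrow>
    (complex \<Rightarrow> complex \<Rightarrow> complex) \<Rightarrow> real \<Rightarrow> bool"
  where "multiplier _ A B g G \<longleftrightarrow> G \<ge> 0 \<and>
    (\<forall>(I :: complex set set) (J :: complex set set) s t (u :: _ \<Rightarrow> 'a \<Rightarrow> 'a) v C D x.
      s ` I \<subseteq> A \<longrightarrow> t ` J \<subseteq> B \<longrightarrow> (\<forall>i\<in>I. bounded_clinear (u i)) \<longrightarrow>
      semivar_bound I u C \<longrightarrow> semivar_bound J v D \<longrightarrow>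
      norm (\<Sum>i\<in>I. \<Sum>j\<in>J. g (s i) (t j) *\<^sub>C u i (v j x)) \<le> G * C * D * norm x)"

lemma multiplierI:
  assumes "G \<ge> 0"
    and "\<And>(I :: complex set set) (J :: complex set set) s t
      (u :: _ \<Rightarrow> 'a::complex_hilbert_space \<Rightarrow> 'a) v C D x.
      s ` I \<subseteq> A \<Longrightarrow> t ` J \<subseteq> B \<Longrightarrow> (\<And>i. i \<in> I \<Longrightarrow> bounded_clinear (u i)) \<Longrightarrow>
      semivar_bound I u C \<Longrightarrow> semivar_bound J v D \<Longrightarrow>
      norm (\<Sum>i\<in>I. \<Sum>j\<in>J. g (s i) (t j) *\<^sub>C u i (v j x)) \<le> G * C * D * norm x"
  shows "multiplier TYPE('a) A B g G"
  unfolding multiplier_def by (intro conjI allI impI assms) auto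

lemma multiplierD:
  fixes u v :: "complex set \<Rightarrow> 'a::complex_hilbert_space \<Rightarrow> 'a"
  assumes "multiplier TYPE('a) A B g G" "s ` I \<subseteq> A" "t ` J \<subseteq> B" "\<And>i. i \<in> I \<Longrightarrow> bounded_clinear (u i)"
    "semivar_bound I u C" "semivar_bound J v D"
  shows "norm (\<Sum>i\<in>I. \<Sum>j\<in>J. g (s i) (t j) *\<^sub>C u i (v j x)) \<le> G * C * D * norm x"
  by (rule assms(1)[unfolded multiplier_def, THEN conjunct2, rule_format]) (use assms(2-) in auto)

lemma multiplier_nonneg: "multiplier T A B g G \<Longrightarrow> G \<ge> 0"
  by (simp add: multiplier_def)

lemma multiplier_cong:
  assumes "\<And>a b. a \<in> A \<Longrightarrow> b \<in> B \<Longrightarrow> g a b = h a b"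
  shows "multiplier T A B g G \<longleftrightarrow> multiplier T A B h G"
proof -
  have "(\<Sum>i\<in>I. \<Sum>j\<in>J. g (s i) (t j) *\<^sub>C u i (v j x)) = (\<Sum>i\<in>I. \<Sum>j\<in>J. h (s i) (t j) *\<^sub>C u i (v j x))"
    if "s ` I \<subseteq> A" "t ` J \<subseteq> B" for I J s t and u v :: "complex set \<Rightarrow> 'a \<Rightarrow> 'a" and x
    using that assms by (intro sum.cong refl) (simp add: image_subset_iff)
  then show ?thesis
    by (simp add: multiplier_def cong: imp_cong)
qed

text \<open>For the constant kernel the double sum factors into the composition of two single
  sums.\<close>

lemma multiplier_one: "multiplier TYPE('a::complex_hilbert_space) A B (\<lambda>_ _. 1) 1"
proof (rule multiplierI)
  fix I J :: "complex set set" and u v :: "complex set \<Rightarrow> 'a \<Rightarrow> 'a" and C D x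
  assume u: "\<And>i. i \<in> I \<Longrightarrow> bounded_clinear (u i)" "semivar_bound I u C" and v: "semivar_bound J v D"
  have "(\<Sum>i\<in>I. \<Sum>j\<in>J. 1 *\<^sub>C u i (v j x)) = (\<Sum>i\<in>I. 1 *\<^sub>C u i (\<Sum>j\<in>J. 1 *\<^sub>C v j x))"
    using u(1) by (simp add: bounded_clinear_sum)
  also have "norm \<dots> \<le> 1 * C * norm (\<Sum>j\<in>J. 1 *\<^sub>C v j x)"
    by (rule semivar_boundD[OF u(2)]) auto
  also have "\<dots> \<le> 1 * C * (1 * D * norm x)"
    using semivar_bound_nonneg[OF u(2)]
    by (intro mult_left_mono semivar_boundD[OF v]) auto
  finally show "norm (\<Sum>i\<in>I. \<Sum>j\<in>J. 1 *\<^sub>C u i (v j x)) \<le> 1 * C * D * norm x"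
    by simp
qed simp

text \<open>The factor depends on the left tag alone and is absorbed into \<open>u i\<close>; this
  works because a multiplier bound ranges over all families of given semivariation.\<close>

lemma multiplier_mult_left:
  assumes g: "multiplier TYPE('a::complex_hilbert_space) A B g G"
    and \<phi>: "\<And>a. a \<in> A \<Longrightarrow> norm (\<phi> a) \<le> k" "k \<ge> 0"
  shows "multiplier TYPE('a) A B (\<lambda>a b. \<phi> a * g a b) (k * G)"
proof (rule multiplierI)
  fix I J :: "complex set set" and s t and u v :: "complex set \<Rightarrow> 'a \<Rightarrow> 'a" and C D x
  assume *: "s ` I \<subseteq> A" "t ` J \<subseteq> B" "\<And>i. i \<in> I \<Longrightarrow> bounded_clinear (u i)"
    "semivar_bound I u C" "semivar_bound J v D"
  have "norm (\<Sum>i\<in>I. \<Sum>j\<in>J. g (s i) (t j) *\<^sub>C \<phi> (s i) *\<^sub>C u i (v j x)) \<le> G * (k * C) * D * norm x"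
    using * \<phi>
    by (intro multiplierD[OF g, where u = "\<lambda>i y. \<phi> (s i) *\<^sub>C u i y"] semivar_bound_scaleC
        bounded_clinear_compose[OF bounded_clinear_scaleC_op]) auto
  then show "norm (\<Sum>i\<in>I. \<Sum>j\<in>J. (\<phi> (s i) * g (s i) (t j)) *\<^sub>C u i (v j x)) \<le> k * G * C * D * norm x"
    by (simp add: scaleC_scaleC mult_ac)
qed (use g \<phi> in \<open>simp add: multiplier_def\<close>)

text \<open>Here the factor is absorbed into \<open>v j\<close>; complex linearity of
  \<open>u i\<close> carries the scalar past it.\<close>

lemma multiplier_mult_right:
  assumes g: "multiplier TYPE('a::complex_hilbert_space) A B g G"
    and \<psi>: "\<And>b. b \<in> B \<Longrightarrow> norm (\<psi> b) \<le> k" "k \<ge> 0"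
  shows "multiplier TYPE('a) A B (\<lambda>a b. \<psi> b * g a b) (k * G)"
proof (rule multiplierI)
  fix I J :: "complex set set" and s t and u v :: "complex set \<Rightarrow> 'a \<Rightarrow> 'a" and C D x
  assume *: "s ` I \<subseteq> A" "t ` J \<subseteq> B" "\<And>i. i \<in> I \<Longrightarrow> bounded_clinear (u i)"
    "semivar_bound I u C" "semivar_bound J v D"
  have "norm (\<Sum>i\<in>I. \<Sum>j\<in>J. g (s i) (t j) *\<^sub>C u i (\<psi> (t j) *\<^sub>C v j x)) \<le> G * C * (k * D) * norm x"
    using * \<psi>
    by (intro multiplierD[OF g, where v = "\<lambda>j y. \<psi> (t j) *\<^sub>C v j y"] semivar_bound_scaleC) auto
  then show "norm (\<Sum>i\<in>I. \<Sum>j\<in>J. (\<psi> (t j) * g (s i) (t j)) *\<^sub>C u i (v j x)) \<le> k * G * C * D * norm x"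
    using *(3) by (simp add: bounded_clinear_scaleC scaleC_scaleC mult_ac)
qed (use g \<psi> in \<open>simp add: multiplier_def\<close>)

lemma multiplier_add:
  assumes "multiplier TYPE('a::complex_hilbert_space) A B g G" "multiplier TYPE('a) A B h H"
  shows "multiplier TYPE('a) A B (\<lambda>a b. g a b + h a b) (G + H)"
  using assms unfolding multiplier_def
  by (simp add: scaleC_add_left sum.distrib ring_distribs norm_triangle_mono)

lemma multiplier_minus:
  assumes "multiplier TYPE('a::complex_hilbert_space) A B g G"
  shows "multiplier TYPE('a) A B (\<lambda>a b. - g a b) G"
  using multiplier_mult_left[OF assms, of "\<lambda>_. -1" 1] by simp

lemma multiplier_diff:
  assumes "multiplier TYPE('a::complex_hilbert_space) A B g G" "multiplier TYPE('a) A B h H"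
  shows "multiplier TYPE('a) A B (\<lambda>a b. g a b - h a b) (G + H)"
  using multiplier_add[OF assms(1) multiplier_minus[OF assms(2)]] by simp

text \<open>Expand 1 / (1 - w) and add the multiplier bounds of the terms. The two smallness
  conditions do different work: \<open>q\<close> makes the bounds summable, the pointwise condition
  on \<open>w\<close> identifies the sum of the scalar series.\<close>

lemma multiplier_geometric:
  assumes g: "\<And>n. multiplier TYPE('a::complex_hilbert_space) A B (\<lambda>a b. w a b ^ n * g a b) (G * q ^ n)"
    and q: "0 \<le> q" "q < 1" and w: "\<And>a b. a \<in> A \<Longrightarrow> b \<in> B \<Longrightarrow> norm (w a b) < 1"
  shows "multiplier TYPE('a) A B (\<lambda>a b. g a b / (1 - w a b)) (G / (1 - q))"
proof (rule multiplierI)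
  fix I J :: "complex set set" and s t and u v :: "complex set \<Rightarrow> 'a \<Rightarrow> 'a" and C D x
  assume *: "s ` I \<subseteq> A" "t ` J \<subseteq> B" "\<And>i. i \<in> I \<Longrightarrow> bounded_clinear (u i)"
    "semivar_bound I u C" "semivar_bound J v D"
  define c where "c n = (\<Sum>i\<in>I. \<Sum>j\<in>J. (w (s i) (t j) ^ n * g (s i) (t j)) *\<^sub>C u i (v j x))" for n
  have "(\<lambda>n. (w (s i) (t j) ^ n * g (s i) (t j)) *\<^sub>C u i (v j x)) sums
      ((g (s i) (t j) / (1 - w (s i) (t j))) *\<^sub>C u i (v j x))" if "i \<in> I" "j \<in> J" for i j
  proof -
    have "norm (w (s i) (t j)) < 1"
      using that *(1,2) by (intro w) auto
    then have "(\<lambda>n. w (s i) (t j) ^ n * g (s i) (t j)) sums (1 / (1 - w (s i) (t j)) * g (s i) (t j))"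
      by (intro sums_mult2 geometric_sums)
    moreover have "bounded_linear (\<lambda>z. z *\<^sub>C u i (v j x))"
      by (rule bounded_linear_intro[where K = "norm (u i (v j x))"])
        (simp_all add: scaleC_add_left norm_scaleC scaleR_conv_of_real flip: scaleC_of_real scaleC_scaleC)
    ultimately show ?thesis
      using bounded_linear.sums by fastforce
  qed
  then have c_sums: "c sums (\<Sum>i\<in>I. \<Sum>j\<in>J. (g (s i) (t j) / (1 - w (s i) (t j))) *\<^sub>C u i (v j x))"
    (is "_ sums ?L") unfolding c_def by (intro sums_sum)
  have c: "norm (c n) \<le> (G * C * D * norm x) * q ^ n" for n
    using multiplierD[OF g *, of n x] by (simp add: c_def mult_ac)
  have geo: "(\<lambda>n. (G * C * D * norm x) * q ^ n) sums ((G * C * D * norm x) * (1 / (1 - q)))"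
    using q by (intro sums_mult geometric_sums) auto
  have "norm ?L \<le> (G * C * D * norm x) * (1 / (1 - q))"
    using norm_suminf_le[OF c sums_summable[OF geo]]
    by (simp only: sums_unique[OF c_sums, symmetric] sums_unique[OF geo, symmetric])
  then show "norm ?L \<le> G / (1 - q) * C * D * norm x"
    by (simp add: mult_ac)
qed (use g[of 0] q in \<open>simp add: multiplier_def\<close>)

text \<open>With d = a0 - b0 one has a - b = d (1 - w), where w is a function of b minus a function
  of a. Since 4 r is at most the modulus of d, each of the two is bounded by 1/4, so a factor
  \<open>w\<close> costs at most 1/2.\<close>

lemma multiplier_divide_diff:
  assumes g: "multiplier TYPE('a::complex_hilbert_space) A B g G"
    and A: "A \<subseteq> ball a0 r" and B: "B \<subseteq> ball b0 r" and r: "r > 0" "4 * r \<le> dist a0 b0"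
  obtains H where "multiplier TYPE('a) A B (\<lambda>a b. g a b / (a - b)) H"
proof -
  define d where "d = a0 - b0"
  define w where "w a b = (b - b0) / d - (a - a0) / d" for a b
  have d: "norm d \<ge> 4 * r"
    using r by (simp add: d_def dist_norm)
  then have "d \<noteq> 0"
    using r by auto
  have a: "norm ((a - a0) / d) \<le> 1 / 4" if "a \<in> A" for a
    using that A d r by (auto simp: norm_divide dist_norm norm_minus_commute divide_simps dest!: subsetD)
  have b: "norm ((b - b0) / d) \<le> 1 / 4" if "b \<in> B" for b
    using that B d r by (auto simp: norm_divide dist_norm norm_minus_commute divide_simps dest!: subsetD)
  have w: "norm (w a' b') < 1" if "a' \<in> A" "b' \<in> B" for a' b'
  proof -
    have "norm (w a' b') \<le> 1 / 4 + 1 / 4"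
      unfolding w_def using a[OF that(1)] b[OF that(2)] norm_triangle_ineq4 by (smt (verit))
    then show ?thesis by simp
  qed
  have pow: "multiplier TYPE('a) A B (\<lambda>a b. w a b ^ n * g a b) (G * (1 / 2) ^ n)" for n
  proof (induction n)
    case 0
    then show ?case using g by simp
  next
    case (Suc n)
    have "multiplier TYPE('a) A B
        (\<lambda>a b. (b - b0) / d * (w a b ^ n * g a b) - (a - a0) / d * (w a b ^ n * g a b))
        (1 / 4 * (G * (1 / 2) ^ n) + 1 / 4 * (G * (1 / 2) ^ n))"
      using a b by (intro multiplier_diff multiplier_mult_right multiplier_mult_left Suc) auto
    then show ?case
      by (simp add: w_def algebra_simps)
  qed
  have "multiplier TYPE('a) A B (\<lambda>a b. g a b / (1 - w a b)) (G / (1 - 1 / 2))"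
    by (rule multiplier_geometric[OF pow _ _ w]) auto
  from multiplier_mult_left[OF this, of "\<lambda>_. 1 / d" "norm (1 / d)"]
  have "multiplier TYPE('a) A B (\<lambda>a b. 1 / d * (g a b / (1 - w a b))) (norm (1 / d) * (G / (1 - 1 / 2)))"
    by simp
  moreover have "1 / d * (g a b / (1 - w a b)) = g a b / (a - b)" for a b
  proof -
    have "d * (1 - w a b) = a - b"
    proof -
      have "d * w a b = (b - b0) - (a - a0)"
        unfolding w_def diff_divide_distrib[symmetric] using \<open>d \<noteq> 0\<close> by simp
      then have "d * (1 - w a b) = d - ((b - b0) - (a - a0))"
        by (simp only: right_diff_distrib mult_1_right)
      then show ?thesis
        by (simp add: d_def)
    qed
    then show ?thesis by (metis divide_divide_eq_left mult.left_neutral times_divide_times_eq)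
  qed
  ultimately have "multiplier TYPE('a) A B (\<lambda>a b. g a b / (a - b)) (norm (1 / d) * (G / (1 - 1 / 2)))"
    by (simp only:)
  then show ?thesis
    by (rule that)
qed

section \<open>Tagged partitions\<close>

lemma eventually_tagged_partitionsI:
  assumes "borel_partition S P0"
    and "\<And>Q t. borel_partition S Q \<Longrightarrow> refines S Q P0 \<Longrightarrow> (\<And>A. A \<in> Q \<Longrightarrow> t A \<in> A) \<Longrightarrow> \<Phi> Q t"
  shows "\<forall>\<^sub>F (Q, t) in tagged_partitions S. \<Phi> Q t"
  unfolding tagged_partitions_def
  by (rule eventually_INF1[of P0]) (use assms in \<open>auto simp: eventually_principal\<close>)

lemma eventually_borel_partition:
  "\<forall>\<^sub>F (Q, t) in tagged_partitions S. borel_partition S Q \<and> (\<forall>A\<in>Q. t A \<in> A)"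
proof -
  obtain P where "borel_partition S P"
    using borel_partition_exists by blast
  then show ?thesis
    by (rule eventually_tagged_partitionsI) auto
qed

lemma eventually_cells_split:
  assumes A0: "A0 \<in> borel_subsets S"
  shows "\<forall>\<^sub>F (Q, t) in tagged_partitions S. \<forall>B\<in>Q. B \<subseteq> A0 \<or> B \<inter> A0 = {}"
proof -
  \<comment> \<open>Cells of a partition are nonempty, so the empty set is removed in case
    \<open>A0\<close> is empty or all of \<open>S\<close>.\<close>
  define P where "P = {A0, S - A0} - {{}}"
  have "partition_on S P"
    using borel_subsets_subset[OF A0] by (auto simp: P_def partition_on_def disjoint_def)
  then have "borel_partition S P"
    using A0 borel_subsets_compl[OF A0] by (auto simp: borel_partition_def P_def)
  then show ?thesis
  proof (rule eventually_tagged_partitionsI)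
    fix Q assume "refines S Q P"
    then have "\<forall>B\<in>Q. \<exists>A\<in>P. B \<subseteq> A"
      by (simp add: refines_def)
    then show "\<forall>B\<in>Q. B \<subseteq> A0 \<or> B \<inter> A0 = {}"
      by (fastforce simp: P_def)
  qed
qed

lemma eventually_cells_split_family:
  assumes "finite \<A>" "\<A> \<subseteq> borel_subsets S"
  shows "\<forall>\<^sub>F (Q, t) in tagged_partitions S. \<forall>A\<in>\<A>. \<forall>B\<in>Q. B \<subseteq> A \<or> B \<inter> A = {}"
proof -
  have "\<forall>\<^sub>F p in tagged_partitions S. \<forall>A\<in>\<A>. \<forall>B\<in>fst p. B \<subseteq> A \<or> B \<inter> A = {}"
    using assms eventually_cells_split[of _ S]
    by (intro eventually_ball_finite) (auto simp: case_prod_unfold)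
  then show ?thesis
    by (simp add: case_prod_unfold)
qed

text \<open>Finitely many balls of radius \<epsilon>/2 cover \<open>S\<close>. Once every cell is
  inside or disjoint from each of them, a cell lies in any ball that it meets.\<close>

lemma eventually_mesh_le:
  assumes S: "bounded S" and \<epsilon>: "\<epsilon> > 0"
  shows "\<forall>\<^sub>F (Q, t) in tagged_partitions S. \<forall>A\<in>Q. \<forall>y\<in>A. \<forall>z\<in>A. dist y z \<le> \<epsilon>"
proof -
  have "compact (closure S)"
    using S by (simp add: compact_closure)
  then have "\<exists>C. finite C \<and> closure S \<subseteq> (\<Union>c\<in>C. ball c (\<epsilon> / 2))"
    using half_gt_zero[OF \<epsilon>] unfolding compact_eq_totally_bounded by blast
  then obtain C where C: "finite C" "closure S \<subseteq> (\<Union>c\<in>C. ball c (\<epsilon> / 2))"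
    by (elim exE conjE)
  define \<A> where "\<A> = (\<lambda>c. S \<inter> ball c (\<epsilon> / 2)) ` C"
  have "\<forall>\<^sub>F (Q, t) in tagged_partitions S. \<forall>A\<in>\<A>. \<forall>B\<in>Q. B \<subseteq> A \<or> B \<inter> A = {}"
    using C(1) by (intro eventually_cells_split_family) (auto simp: \<A>_def intro: borel_subsets_Int_open)
  then show ?thesis
    using eventually_borel_partition[of S]
  proof eventually_elim
    case (elim p)
    obtain Q t where p: "p = (Q, t)"
      by (cases p)
    have "dist y z \<le> \<epsilon>" if "A \<in> Q" "y \<in> A" "z \<in> A" for A y z
    proof -
      have "Q \<subseteq> borel_subsets S"
        using elim(2) by (simp add: p borel_partition_def)
      then have "A \<subseteq> S"
        using that(1) by (intro borel_subsets_subset) blast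
      then have "y \<in> closure S"
        using that(2) closure_subset by blast
      then obtain c where c: "c \<in> C" "y \<in> ball c (\<epsilon> / 2)"
        using C(2) by blast
      then have "A \<inter> (S \<inter> ball c (\<epsilon> / 2)) \<noteq> {}"
        using that(2) \<open>A \<subseteq> S\<close> by blast
      moreover have "S \<inter> ball c (\<epsilon> / 2) \<in> \<A>"
        using c(1) by (simp add: \<A>_def)
      moreover have "\<forall>B\<in>\<A>. \<forall>A\<in>Q. A \<subseteq> B \<or> A \<inter> B = {}"
        using elim(1) by (simp only: p prod.case)
      ultimately have "A \<subseteq> S \<inter> ball c (\<epsilon> / 2)"
        using that(1) by meson
      then have "dist c y < \<epsilon> / 2" "dist c z < \<epsilon> / 2"
        using that by auto
      then show ?thesis
        using dist_triangle3[of y z c] by linarith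
    qed
    then show ?case
      by (simp add: p)
  qed
qed

text \<open>The cells need not cover \<open>S\<close>, so the property passes to the cells inside a
  given set, and fine partitions of a Borel subset qualify as well.\<close>

definition fine_family ::
  "complex set \<Rightarrow> complex set set \<Rightarrow> (complex set \<Rightarrow> complex) \<Rightarrow> real \<Rightarrow> bool"
  where "fine_family S \<A> s \<epsilon> \<longleftrightarrow> finite \<A> \<and> \<A> \<subseteq> borel_subsets S \<and> disjoint \<A> \<and>
    (\<forall>A\<in>\<A>. s A \<in> A \<and> (\<forall>z\<in>A. dist z (s A) \<le> \<epsilon>))"

lemma fine_family_sets: "fine_family S \<A> s \<epsilon> \<Longrightarrow> A \<in> \<A> \<Longrightarrow> A \<in> borel_subsets S"
  unfolding fine_family_def by blast

lemma fine_family_tag: "fine_family S \<A> s \<epsilon> \<Longrightarrow> A \<in> \<A> \<Longrightarrow> \<Union>\<A> \<subseteq> A0 \<Longrightarrow> s A \<in> A0"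
  unfolding fine_family_def by (meson UnionI subsetD)

lemma fine_family_subset: "fine_family S \<A> s \<epsilon> \<Longrightarrow> \<B> \<subseteq> \<A> \<Longrightarrow> fine_family S \<B> s \<epsilon>"
  unfolding fine_family_def by (meson finite_subset pairwise_subset subset_trans subsetD)

lemma eventually_fine_family:
  assumes "bounded S" "\<epsilon> > 0"
  shows "\<forall>\<^sub>F (Q, t) in tagged_partitions S. fine_family S Q t \<epsilon>"
  using eventually_borel_partition[of S] eventually_mesh_le[OF assms]
  by eventually_elim (auto simp: fine_family_def borel_partition_def dest: partition_onD2)


section \<open>Spectral measures\<close>

locale spectral =
  fixes S :: "complex set" and E :: "complex set \<Rightarrow> 'a::complex_hilbert_space \<Rightarrow> 'a"
  assumes spectral_measure: "spectral_measure S E"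
begin

lemma bounded_clinear_E: "A \<in> borel_subsets S \<Longrightarrow> bounded_clinear (E A)"
  using spectral_measure by (simp add: spectral_measure_def)

lemma E_whole: "E S x = x"
  using spectral_measure by (simp add: spectral_measure_def)

lemma E_E: "A \<in> borel_subsets S \<Longrightarrow> B \<in> borel_subsets S \<Longrightarrow> E A (E B x) = E (A \<inter> B) x"
  using spectral_measure unfolding spectral_measure_def by (metis comp_apply)

lemma vector_measure_E: "vector_measure S (\<lambda>A. E A x)"
  using spectral_measure by (simp add: spectral_measure_def vector_measure_def)

lemma E_empty: "E {} x = 0"
  by (rule vector_measure_empty[OF vector_measure_E])

text \<open>Oblique projections can have large norm, so a common bound has to be proved: each orbit
  is a vector measure and has bounded range, and uniform boundedness does the rest.\<close>

lemma E_bounded: "\<exists>K\<ge>0. \<forall>A\<in>borel_subsets S. \<forall>x. norm (E A x) \<le> K * norm x"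
proof -
  have "\<exists>M. \<forall>T\<in>E ` borel_subsets S. norm (T x) \<le> M" for x
    using vector_measure_bounded[OF vector_measure_E[of x]] by (metis image_iff)
  then obtain K where "K \<ge> 0" "\<And>T x. T \<in> E ` borel_subsets S \<Longrightarrow> norm (T x) \<le> K * norm x"
    using uniform_boundedness[of "E ` borel_subsets S"] bounded_clinear_E by blast
  then show ?thesis
    by blast
qed

definition K :: real
  where "K = (SOME K. K \<ge> 0 \<and> (\<forall>A\<in>borel_subsets S. \<forall>x. norm (E A x) \<le> K * norm x))"

lemma K_nonneg: "K \<ge> 0" and norm_E_le: "A \<in> borel_subsets S \<Longrightarrow> norm (E A x) \<le> K * norm x"
  using someI_ex[OF E_bounded[unfolded Bex_def]] unfolding K_def by blast+

text \<open>Pair the sum \<open>v\<close> with itself. The absolute values of the \<open>e i\<close>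
  add up to the sum over nonnegative ones minus the sum over negative ones, and each of these is the
  inner product of \<open>v\<close> with a single \<open>E\<close> of a union. This gives the factor
  2 and does without orthogonality of the projections.\<close>

lemma real_semivariation:
  assumes I: "finite I" "\<And>i. i \<in> I \<Longrightarrow> D i \<in> borel_subsets S" "disjoint_family_on D I"
    and c: "\<And>i. i \<in> I \<Longrightarrow> \<bar>c i\<bar> \<le> 1"
  shows "norm (\<Sum>i\<in>I. c i *\<^sub>R E (D i) y) \<le> 2 * K * norm y"
proof -
  define v where "v = (\<Sum>i\<in>I. c i *\<^sub>R E (D i) y)"
  define e where "e i = inner (E (D i) y) v" for i
  have le: "\<bar>\<Sum>i\<in>J. e i\<bar> \<le> K * norm y * norm v" if "J \<subseteq> I" for J
  proof -
    have "finite J" "disjoint_family_on D J"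
      using that I by (auto intro: finite_subset disjoint_family_on_mono)
    then have "(\<Sum>i\<in>J. E (D i) y) = E (\<Union>i\<in>J. D i) y"
      using that I(2) by (subst vector_measure_finite_UN[OF vector_measure_E]) auto
    moreover have "(\<Union>i\<in>J. D i) \<in> borel_subsets S"
      using that I(2) \<open>finite J\<close> by (intro sets.finite_UN) auto
    ultimately have "norm (\<Sum>i\<in>J. E (D i) y) \<le> K * norm y"
      using norm_E_le by simp
    then have "norm (\<Sum>i\<in>J. E (D i) y) * norm v \<le> K * norm y * norm v"
      by (rule mult_right_mono) simp
    then show ?thesis
      using Cauchy_Schwarz_ineq2[of "\<Sum>i\<in>J. E (D i) y" v] by (simp add: e_def inner_sum_left)
  qed
  have "norm v * norm v = inner v v"
    by (simp add: dot_square_norm power2_eq_square)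
  also have "\<dots> = inner (\<Sum>i\<in>I. c i *\<^sub>R E (D i) y) v"
    by (simp flip: v_def)
  also have "\<dots> = (\<Sum>i\<in>I. c i * e i)"
    by (simp add: inner_sum_left e_def)
  also have "\<dots> \<le> (\<Sum>i\<in>I. \<bar>e i\<bar>)"
  proof (rule sum_mono)
    fix i assume "i \<in> I"
    then have "\<bar>c i\<bar> * \<bar>e i\<bar> \<le> 1 * \<bar>e i\<bar>"
      by (intro mult_right_mono c) auto
    then show "c i * e i \<le> \<bar>e i\<bar>"
      by (metis abs_le_D1 abs_mult mult_1)
  qed
  also have "\<dots> = (\<Sum>i\<in>{i\<in>I. e i \<ge> 0}. e i) - (\<Sum>i\<in>{i\<in>I. \<not> e i \<ge> 0}. e i)"
    using sum.If_cases[OF I(1), of "\<lambda>i. e i \<ge> 0" e "\<lambda>i. - e i"]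
    by (simp add: abs_if not_less sum_negf Int_def Compl_eq) (smt (verit) sum.cong)
  also have "\<dots> \<le> 2 * (K * norm y * norm v)"
    using le[of "{i\<in>I. e i \<ge> 0}"] le[of "{i\<in>I. \<not> e i \<ge> 0}"] by fastforce
  finally have "norm v * norm v \<le> (2 * K * norm y) * norm v"
    by (simp add: mult_ac)
  then have "norm v \<le> 2 * K * norm y"
    using K_nonneg by (cases "v = 0") auto
  then show ?thesis
    by (simp add: v_def)
qed

text \<open>Real and imaginary parts of the coefficients contribute \<open>2 * K\<close>
  each.\<close>

lemma semivar_bound_E:
  assumes I: "finite I" "\<And>i. i \<in> I \<Longrightarrow> D i \<in> borel_subsets S" "disjoint_family_on D I"
  shows "semivar_bound I (\<lambda>i. E (D i)) (4 * K)"
proof -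
  have "norm (\<Sum>i\<in>I. \<phi> i *\<^sub>C E (D i) y) \<le> 4 * K * norm y" if \<phi>: "\<forall>i\<in>I. norm (\<phi> i) \<le> 1" for \<phi> y
  proof -
    have "\<phi> i *\<^sub>C E (D i) y = Re (\<phi> i) *\<^sub>R E (D i) y + \<i> *\<^sub>C (Im (\<phi> i) *\<^sub>R E (D i) y)" for i
      unfolding scaleC_of_real[symmetric] scaleC_scaleC scaleC_add_left[symmetric]
      by (simp flip: complex_eq)
    then have "(\<Sum>i\<in>I. \<phi> i *\<^sub>C E (D i) y) =
        (\<Sum>i\<in>I. Re (\<phi> i) *\<^sub>R E (D i) y) + \<i> *\<^sub>C (\<Sum>i\<in>I. Im (\<phi> i) *\<^sub>R E (D i) y)"
      by (simp add: sum.distrib scaleC_right.sum)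
    also have "norm \<dots> \<le> 2 * K * norm y + 2 * K * norm y"
      using \<phi> by (intro norm_triangle_mono)
        (auto simp: norm_scaleC intro!: real_semivariation I intro: order_trans[OF abs_Re_le_cmod]
          order_trans[OF abs_Im_le_cmod])
    finally show ?thesis
      by (simp add: mult_ac)
  qed
  then show ?thesis
    using K_nonneg by (simp add: semivar_bound_def)
qed

lemma semivar_bound_E_family:
  assumes "fine_family S \<A> s \<epsilon>"
  shows "semivar_bound \<A> E (4 * K)"
  using assms semivar_bound_E[of \<A> "\<lambda>A. A"]
  by (auto simp: fine_family_def disjoint_def disjoint_family_on_def)

lemma sum_E_partition:
  assumes A: "A \<in> borel_subsets S" and Q: "borel_partition A Q"
  shows "(\<Sum>B\<in>Q. E B x) = E A x"
proof -
  have "partition_on A Q" "Q \<subseteq> borel_subsets A" "finite Q"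
    using Q by (auto simp: borel_partition_def)
  then have "\<Union>Q = A" "disjoint_family_on (\<lambda>B. B) Q" "\<And>B. B \<in> Q \<Longrightarrow> B \<in> borel_subsets S"
    using A by (auto simp: partition_on_def disjoint_def disjoint_family_on_def intro: borel_subsets_trans)
  then show ?thesis
    using vector_measure_finite_UN[OF vector_measure_E, of Q "\<lambda>B. B" x] \<open>finite Q\<close> by simp
qed

end

section \<open>Spectral decompositions\<close>

lemma nonpos_if_le_all_multiples:
  fixes a b :: real
  assumes "b \<ge> 0" "\<And>e. e > 0 \<Longrightarrow> a \<le> e * b"
  shows "a \<le> 0"
proof (rule field_le_epsilon)
  fix e :: real assume "e > 0"
  \<comment> \<open>Dividing by \<open>b + 1\<close> instead of \<open>b\<close> covers
    \<open>b = 0\<close>.\<close>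
  then have "a \<le> e / (b + 1) * b"
    using assms(1) by (intro assms(2)) simp
  also have "\<dots> \<le> e"
    using assms(1) \<open>e > 0\<close> by (simp add: field_simps)
  finally show "a \<le> 0 + e"
    by simp
qed

locale decomposition =
  fixes X :: "'a::complex_hilbert_space \<Rightarrow> 'a" and E m and R :: real
  assumes decomposition: "spectral_decomposition X E m"
    and norm_spectrum_le: "\<And>l. l \<in> spectrum X \<Longrightarrow> norm l \<le> R"
    and R_nonneg: "R \<ge> 0"

sublocale decomposition \<subseteq> spectral "spectrum X" E
  using decomposition by unfold_locales (simp add: spectral_decomposition_def)

context decomposition
begin

section \<open>The projection part, its complement in \<open>X\<close>, and their commutation with
  \<open>E\<close>\<close>

definition P :: "'a \<Rightarrow> 'a" where "P = proj_part X E"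

text \<open>By the spectral decomposition this is \<open>nil_part X E\<close>. The difference form
  gives commutation with \<open>E\<close> and the identity X - l = N + (P - l), which drives all
  estimates of powers of \<open>shift X l\<close>.\<close>

definition N :: "'a \<Rightarrow> 'a" where "N x = X x - P x"

lemma bounded_clinear_X: "bounded_clinear X"
  using decomposition by (simp add: spectral_decomposition_def)

lemma E_X: "A \<in> borel_subsets (spectrum X) \<Longrightarrow> E A (X x) = X (E A x)"
  using decomposition unfolding spectral_decomposition_def by (metis comp_apply)

lemma measurable_m: "m \<in> measurable (restrict_space borel (spectrum X)) (count_space UNIV)"
  using decomposition by (simp add: spectral_decomposition_def)

lemma m_ge_1: "l \<in> spectrum X \<Longrightarrow> m l \<ge> 1"
  using decomposition by (simp add: spectral_decomposition_def)

lemma nilpotent_integral: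
  assumes "A \<in> borel_subsets (spectrum X)" "\<And>l. l \<in> A \<Longrightarrow> m l \<le> k"
  shows "has_spectral_integral A E (\<lambda>l dE x. (shift X l ^^ k) (dE x)) (\<lambda>x. 0)"
  using decomposition assms by (simp add: spectral_decomposition_def)

lemma P_integral: "has_spectral_integral (spectrum X) E (\<lambda>l dE x. l *\<^sub>C dE x) P"
proof -
  obtain T where "has_spectral_integral (spectrum X) E (\<lambda>l dE x. l *\<^sub>C dE x) T"
    using decomposition by (auto simp: spectral_decomposition_def)
  then show ?thesis
    unfolding P_def proj_part_def by (simp add: spectral_integral_unique)
qed

lemma bounded_clinear_P: "bounded_clinear P"
  using P_integral by (simp add: has_spectral_integral_def)

lemma P_tendsto:
  "((\<lambda>(Q, t). \<Sum>B\<in>Q. t B *\<^sub>C E B x) \<longlongrightarrow> P x) (tagged_partitions (spectrum X))"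
  using P_integral by (simp add: has_spectral_integral_def)

text \<open>Projections of one spectral measure commute, so \<open>E A\<close> commutes with every
  Riemann sum of \<open>P\<close>, and by continuity with the limit.\<close>

lemma E_P:
  assumes A: "A \<in> borel_subsets (spectrum X)"
  shows "E A (P x) = P (E A x)"
proof -
  have "((\<lambda>p. E A (case p of (Q, t) \<Rightarrow> \<Sum>B\<in>Q. t B *\<^sub>C E B x)) \<longlongrightarrow> E A (P x))
      (tagged_partitions (spectrum X))"
    by (rule bounded_clinear_tendsto[OF bounded_clinear_E[OF A] P_tendsto])
  moreover have "\<forall>\<^sub>F p in tagged_partitions (spectrum X).
      E A (case p of (Q, t) \<Rightarrow> \<Sum>B\<in>Q. t B *\<^sub>C E B x) = (case p of (Q, t) \<Rightarrow> \<Sum>B\<in>Q. t B *\<^sub>C E B (E A x))"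
    using eventually_borel_partition[of "spectrum X"]
  proof eventually_elim
    case (elim p)
    obtain Q t where p: "p = (Q, t)"
      by (cases p)
    have "E A (E B x) = E B (E A x)" if "B \<in> Q" for B
    proof -
      have "B \<in> borel_subsets (spectrum X)"
        using elim that by (auto simp: p borel_partition_def)
      then show ?thesis
        using A by (simp add: E_E Int_commute)
    qed
    then show ?case
      by (simp add: p bounded_clinear_sum[OF bounded_clinear_E[OF A]]
          bounded_clinear_scaleC[OF bounded_clinear_E[OF A]])
  qed
  ultimately have "((\<lambda>(Q, t). \<Sum>B\<in>Q. t B *\<^sub>C E B (E A x)) \<longlongrightarrow> E A (P x)) (tagged_partitions (spectrum X))"
    using tendsto_cong by fastforce
  then show ?thesis
    by (rule tendsto_unique[OF tagged_partitions_not_bot _ P_tendsto])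
qed

lemma bounded_clinear_N: "bounded_clinear N"
  unfolding N_def by (rule bounded_clinear_diff_op[OF bounded_clinear_X bounded_clinear_P])

lemma E_N: "A \<in> borel_subsets (spectrum X) \<Longrightarrow> E A (N x) = N (E A x)"
  by (simp add: N_def bounded_clinear_diff[OF bounded_clinear_E] E_X E_P)

lemma E_shift: "A \<in> borel_subsets (spectrum X) \<Longrightarrow> E A (shift X l x) = shift X l (E A x)"
  by (simp add: shift_def bounded_clinear_diff[OF bounded_clinear_E]
      bounded_clinear_scaleC[OF bounded_clinear_E] E_X)

lemma E_shift_power: "A \<in> borel_subsets (spectrum X) \<Longrightarrow> E A ((shift X l ^^ n) x) = (shift X l ^^ n) (E A x)"
  by (rule funpow_commute_apply[symmetric]) (simp add: E_shift)

lemma E_N_power: "A \<in> borel_subsets (spectrum X) \<Longrightarrow> E A ((N ^^ n) x) = (N ^^ n) (E A x)"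
  by (rule funpow_commute_apply[symmetric]) (simp add: E_N)

lemma bounded_spectrum: "bounded (spectrum X)"
  by (rule boundedI[of _ R]) (rule norm_spectrum_le)

lemma norm_tag_le:
  assumes "fine_family (spectrum X) \<A> s \<epsilon>" "A \<in> \<A>"
  shows "norm (s A) \<le> R"
proof -
  have "A \<in> borel_subsets (spectrum X)" "s A \<in> A"
    using assms by (auto simp: fine_family_def)
  then show ?thesis
    using borel_subsets_subset by (intro norm_spectrum_le) blast
qed

text \<open>
  On each cell \<open>A\<close>, \<open>P E(A)\<close> is the limit of Riemann sums over subcells of \<open>A\<close>, whose
  tags differ from \<open>s A\<close> by at most \<open>\<epsilon>\<close>.
\<close>

lemma semivar_bound_P_minus_tag:
  assumes \<A>: "fine_family (spectrum X) \<A> s \<epsilon>" and \<epsilon>: "\<epsilon> \<ge> 0"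
  shows "semivar_bound \<A> (\<lambda>A y. P (E A y) - s A *\<^sub>C E A y) (\<epsilon> * (4 * K))"
proof -
  have \<A>_fin: "finite \<A>" and \<A>_sets: "\<A> \<subseteq> borel_subsets (spectrum X)" and \<A>_disj: "disjoint \<A>"
    and \<A>_fine: "\<And>A z. A \<in> \<A> \<Longrightarrow> z \<in> A \<Longrightarrow> dist z (s A) \<le> \<epsilon>"
    using \<A> by (auto simp: fine_family_def)
  have "norm (\<Sum>A\<in>\<A>. \<phi> A *\<^sub>C (P (E A y) - s A *\<^sub>C E A y)) \<le> \<epsilon> * (4 * K) * norm y"
    if \<phi>: "\<forall>A\<in>\<A>. norm (\<phi> A) \<le> 1" for \<phi> y
  proof -
    define g where
      "g p = (\<Sum>A\<in>\<A>. \<phi> A *\<^sub>C ((case p of (Q, t) \<Rightarrow> \<Sum>B\<in>Q. t B *\<^sub>C E B (E A y)) - s A *\<^sub>C E A y))" for p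
    have "(g \<longlongrightarrow> (\<Sum>A\<in>\<A>. \<phi> A *\<^sub>C (P (E A y) - s A *\<^sub>C E A y))) (tagged_partitions (spectrum X))"
      unfolding g_def by (intro tendsto_intros scaleC_tendsto P_tendsto)
    moreover have "\<forall>\<^sub>F p in tagged_partitions (spectrum X). norm (g p) \<le> \<epsilon> * (4 * K) * norm y"
      using eventually_borel_partition[of "spectrum X"] eventually_cells_split_family[OF \<A>_fin \<A>_sets]
    proof eventually_elim
      case (elim p)
      obtain Q t where p: "p = (Q, t)"
        by (cases p)
      have Q: "borel_partition (spectrum X) Q" and t: "\<And>B. B \<in> Q \<Longrightarrow> t B \<in> B"
        and split: "\<And>A B. A \<in> \<A> \<Longrightarrow> B \<in> Q \<Longrightarrow> B \<subseteq> A \<or> B \<inter> A = {}"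
        using elim by (auto simp: p)
      have Q_fin: "finite Q" and Q_sets: "Q \<subseteq> borel_subsets (spectrum X)" and Q_disj: "disjoint Q"
        using Q by (auto simp: borel_partition_def partition_on_def)
      \<comment> \<open>The value 0 is for disjoint pairs, where nothing controls
        \<open>t B - s A\<close>. The projection of the empty set is 0, so no term changes.\<close>
      define c where "c = (\<lambda>(A, B). if B \<inter> A = {} then 0 else \<phi> A * (t B - s A))"
      have EBA: "E B (E A y) = E (B \<inter> A) y" if "A \<in> \<A>" "B \<in> Q" for A B
        using that \<A>_sets Q_sets by (intro E_E) auto
      have summand: "\<phi> A *\<^sub>C ((\<Sum>B\<in>Q. t B *\<^sub>C E B (E A y)) - s A *\<^sub>C E A y) =
          (\<Sum>B\<in>Q. c (A, B) *\<^sub>C E (B \<inter> A) y)" if A: "A \<in> \<A>" for A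
      proof -
        \<comment> \<open>Resolving the identity over \<open>Q\<close> distributes the tag of
          \<open>A\<close> over the cells of \<open>Q\<close>, so that only differences of tags
          remain.\<close>
        have "E A y = (\<Sum>B\<in>Q. E B (E A y))"
          by (simp add: sum_E_partition[OF borel_subsets_whole Q] E_whole)
        then have "(\<Sum>B\<in>Q. t B *\<^sub>C E B (E A y)) - s A *\<^sub>C E A y =
            (\<Sum>B\<in>Q. t B *\<^sub>C E B (E A y)) - s A *\<^sub>C (\<Sum>B\<in>Q. E B (E A y))"
          by simp
        also have "\<dots> = (\<Sum>B\<in>Q. (t B - s A) *\<^sub>C E B (E A y))"
          by (simp add: scaleC_right.sum scaleC_left.diff sum_subtractf)
        finally show ?thesis
          by (simp add: scaleC_right.sum scaleC_scaleC)
            (intro sum.cong refl, simp add: c_def EBA[OF A] E_empty)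
      qed
      have "g p = (\<Sum>A\<in>\<A>. \<Sum>B\<in>Q. c (A, B) *\<^sub>C E (B \<inter> A) y)"
        unfolding g_def p prod.case by (intro sum.cong refl summand)
      also have "\<dots> = (\<Sum>i\<in>\<A> \<times> Q. c i *\<^sub>C E (snd i \<inter> fst i) y)"
        by (simp add: sum.cartesian_product case_prod_unfold)
      \<comment> \<open>The intersections of cells of both families are pairwise disjoint, so one
        semivariation bound covers the double sum.\<close>
      also have "norm \<dots> \<le> \<epsilon> * (4 * K) * norm y"
      proof (rule semivar_boundD[OF semivar_bound_E _ \<epsilon>])
        fix i assume "i \<in> \<A> \<times> Q"
        then obtain A B where i: "i = (A, B)" "A \<in> \<A>" "B \<in> Q"
          by auto
        show "norm (c i) \<le> \<epsilon>"
        proof (cases "B \<inter> A = {}")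
          case True
          then show ?thesis
            using \<epsilon> by (simp add: c_def i)
        next
          case False
          then have "dist (t B) (s A) \<le> \<epsilon>"
            using split[OF i(2,3)] t[OF i(3)] \<A>_fine[OF i(2)] by blast
          then have "norm (\<phi> A) * norm (t B - s A) \<le> 1 * \<epsilon>"
            using \<phi> i(2) by (intro mult_mono) (auto simp: dist_norm)
          then show ?thesis
            using False by (simp add: c_def i norm_mult)
        qed
      next
        show "finite (\<A> \<times> Q)"
          using \<A>_fin Q_fin by simp
        show "\<And>i. i \<in> \<A> \<times> Q \<Longrightarrow> snd i \<inter> fst i \<in> borel_subsets (spectrum X)"
          using \<A>_sets Q_sets by (intro sets.Int) auto
        show "disjoint_family_on (\<lambda>i. snd i \<inter> fst i) (\<A> \<times> Q)"
        proof (unfold disjoint_family_on_def, intro ballI impI)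
          fix i j assume "i \<in> \<A> \<times> Q" "j \<in> \<A> \<times> Q" "i \<noteq> j"
          then have "fst i \<inter> fst j = {} \<or> snd i \<inter> snd j = {}"
            using disjointD[OF \<A>_disj, of "fst i" "fst j"] disjointD[OF Q_disj, of "snd i" "snd j"]
            by (metis mem_Times_iff prod_eq_iff)
          then show "(snd i \<inter> fst i) \<inter> (snd j \<inter> fst j) = {}"
            by blast
        qed
      qed
      finally show ?case .
    qed
    ultimately show ?thesis
      by (rule Lim_norm_ubound[OF tagged_partitions_not_bot])
  qed
  then show ?thesis
    using \<epsilon> K_nonneg by (simp add: semivar_bound_def)
qed

text \<open>Induction by (X - l)^(n+1) - N^(n+1) = (X - l) ((X - l)^n - N^n) + (P - l) N^n. In the
  first term X - l is bounded by \<open>M + R\<close>; in the second, N^n commutes past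
  \<open>E A\<close> into the argument and leaves the estimate for P minus the tag.\<close>

lemma semivar_bound_shift_power_minus_N_power:
  "\<exists>C\<ge>0. \<forall>\<A> s \<epsilon>. \<epsilon> \<ge> 0 \<longrightarrow> fine_family (spectrum X) \<A> s \<epsilon> \<longrightarrow>
    semivar_bound \<A> (\<lambda>A y. (shift X (s A) ^^ n) (E A y) - (N ^^ n) (E A y)) (\<epsilon> * C)"
proof (induction n)
  case 0
  show ?case
    by (auto simp: semivar_bound_def)
next
  case (Suc n)
  then obtain C where C: "C \<ge> 0"
    "\<And>\<A> s \<epsilon>. \<epsilon> \<ge> 0 \<Longrightarrow> fine_family (spectrum X) \<A> s \<epsilon> \<Longrightarrow>
      semivar_bound \<A> (\<lambda>A y. (shift X (s A) ^^ n) (E A y) - (N ^^ n) (E A y)) (\<epsilon> * C)"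
    by blast
  obtain M where M: "M \<ge> 0" "\<And>x. norm (X x) \<le> M * norm x"
    using bounded_clinear_bound[OF bounded_clinear_X] by blast
  obtain L where L: "L \<ge> 0" "\<And>x. norm ((N ^^ n) x) \<le> L * norm x"
    using bounded_clinear_bound[OF bounded_clinear_funpow[OF bounded_clinear_N]] by blast
  have "semivar_bound \<A> (\<lambda>A y. (shift X (s A) ^^ Suc n) (E A y) - (N ^^ Suc n) (E A y))
      (\<epsilon> * ((M + R) * C + L * (4 * K)))"
    if \<epsilon>: "\<epsilon> \<ge> 0" and \<A>: "fine_family (spectrum X) \<A> s \<epsilon>" for \<A> s \<epsilon>
  proof -
    have "semivar_bound \<A> (\<lambda>A y. shift X (s A) ((shift X (s A) ^^ n) (E A y) - (N ^^ n) (E A y)) +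
        (P (E A ((N ^^ n) y)) - s A *\<^sub>C E A ((N ^^ n) y)))
        ((M + R) * (\<epsilon> * C) + L * (\<epsilon> * (4 * K)))"
      by (intro semivar_bound_add semivar_bound_shift[OF C(2) bounded_clinear_X]
          semivar_bound_precomp[OF semivar_bound_P_minus_tag] \<epsilon> \<A> M L R_nonneg norm_tag_le[OF \<A>])
    moreover have "shift X (s A) ((shift X (s A) ^^ n) (E A y) - (N ^^ n) (E A y)) +
        (P (E A ((N ^^ n) y)) - s A *\<^sub>C E A ((N ^^ n) y)) =
        (shift X (s A) ^^ Suc n) (E A y) - (N ^^ Suc n) (E A y)" if "A \<in> \<A>" for A y
    proof -
      have "A \<in> borel_subsets (spectrum X)"
        using that \<A> by (auto simp: fine_family_def)
      then show ?thesis
        by (simp add: E_N_power bounded_clinear_diff[OF bounded_clinear_shift[OF bounded_clinear_X]])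
          (simp add: shift_def N_def)
    qed
    ultimately have "semivar_bound \<A> (\<lambda>A y. (shift X (s A) ^^ Suc n) (E A y) - (N ^^ Suc n) (E A y))
        ((M + R) * (\<epsilon> * C) + L * (\<epsilon> * (4 * K)))"
      by (rule semivar_bound_cong[THEN iffD1, rotated])
    moreover have "(M + R) * (\<epsilon> * C) + L * (\<epsilon> * (4 * K)) = \<epsilon> * ((M + R) * C + L * (4 * K))"
      by (simp add: algebra_simps)
    ultimately show ?thesis
      by simp
  qed
  moreover have "(M + R) * C + L * (4 * K) \<ge> 0"
    using M(1) L(1) C(1) R_nonneg K_nonneg by simp
  ultimately show ?case
    by blast
qed

text \<open>On partitions of \<open>A0\<close> the Riemann sums of (X - l)^n dE tend to 0 by
  nilpotency, and they come arbitrarily close to N^n E(A0) by the previous estimate.\<close>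

lemma N_power_E_zero:
  assumes A0: "A0 \<in> borel_subsets (spectrum X)" and m: "\<And>l. l \<in> A0 \<Longrightarrow> m l \<le> n"
  shows "(N ^^ n) (E A0 y) = 0"
proof -
  obtain C where C: "C \<ge> 0"
    "\<And>\<A> s \<epsilon>. \<epsilon> \<ge> 0 \<Longrightarrow> fine_family (spectrum X) \<A> s \<epsilon> \<Longrightarrow>
      semivar_bound \<A> (\<lambda>A y. (shift X (s A) ^^ n) (E A y) - (N ^^ n) (E A y)) (\<epsilon> * C)"
    using semivar_bound_shift_power_minus_N_power by blast
  have bdd: "bounded A0"
    using bounded_spectrum borel_subsets_subset[OF A0] by (rule bounded_subset)
  have "norm ((N ^^ n) (E A0 y)) \<le> \<epsilon> * (C * norm y)" if \<epsilon>: "\<epsilon> > 0" for \<epsilon>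
  proof -
    define g where "g = (\<lambda>(Q, t). \<Sum>A\<in>Q. (shift X (t A) ^^ n) (E A y))"
    have "(g \<longlongrightarrow> 0) (tagged_partitions A0)"
      using nilpotent_integral[OF A0 m] by (simp add: has_spectral_integral_def g_def)
    then have "((\<lambda>p. g p - (N ^^ n) (E A0 y)) \<longlongrightarrow> 0 - (N ^^ n) (E A0 y)) (tagged_partitions A0)"
      by (intro tendsto_intros)
    moreover have "\<forall>\<^sub>F p in tagged_partitions A0. norm (g p - (N ^^ n) (E A0 y)) \<le> \<epsilon> * C * norm y"
      using eventually_borel_partition[of A0] eventually_fine_family[OF bdd \<epsilon>]
    proof eventually_elim
      case (elim p)
      obtain Q t where p: "p = (Q, t)"
        by (cases p)
      have Q: "borel_partition A0 Q" and "fine_family A0 Q t \<epsilon>"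
        using elim by (auto simp: p)
      then have fine: "fine_family (spectrum X) Q t \<epsilon>"
        using borel_subsets_trans[OF A0] by (auto simp: fine_family_def)
      have "(N ^^ n) (E A0 y) = (\<Sum>A\<in>Q. (N ^^ n) (E A y))"
        by (simp flip: sum_E_partition[OF A0 Q] bounded_clinear_sum[OF bounded_clinear_funpow[OF bounded_clinear_N]])
      then have "g p - (N ^^ n) (E A0 y) =
          (\<Sum>A\<in>Q. 1 *\<^sub>C ((shift X (t A) ^^ n) (E A y) - (N ^^ n) (E A y)))"
        by (simp add: g_def p sum_subtractf)
      also have "norm \<dots> \<le> 1 * (\<epsilon> * C) * norm y"
        using \<epsilon> by (intro semivar_boundD[OF C(2)[OF _ fine]]) auto
      finally show ?case
        by simp
    qed
    ultimately have "norm (0 - (N ^^ n) (E A0 y)) \<le> \<epsilon> * C * norm y"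
      by (rule Lim_norm_ubound[OF tagged_partitions_not_bot])
    then show ?thesis
      by (simp add: mult.assoc)
  qed
  then have "norm ((N ^^ n) (E A0 y)) \<le> 0"
    using C(1) by (intro nonpos_if_le_all_multiples[where b = "C * norm y"]) auto
  then show ?thesis
    by simp
qed

text \<open>On such cells the comparison term with \<open>N ^^ n\<close> vanishes, and only the part
  linear in the mesh is left.\<close>

lemma semivar_bound_nilpotent:
  "\<exists>C\<ge>0. \<forall>\<A> s \<epsilon>. \<epsilon> \<ge> 0 \<longrightarrow> fine_family (spectrum X) \<A> s \<epsilon> \<longrightarrow> (\<forall>A\<in>\<A>. \<forall>l\<in>A. m l \<le> n) \<longrightarrow>
    semivar_bound \<A> (\<lambda>A y. (shift X (s A) ^^ n) (E A y)) (\<epsilon> * C)"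
proof -
  have "semivar_bound \<A> (\<lambda>A y. (shift X (s A) ^^ n) (E A y)) C"
    if "semivar_bound \<A> (\<lambda>A y. (shift X (s A) ^^ n) (E A y) - (N ^^ n) (E A y)) C"
      "\<A> \<subseteq> borel_subsets (spectrum X)" "\<forall>A\<in>\<A>. \<forall>l\<in>A. m l \<le> n" for \<A> s C
  proof -
    have "(N ^^ n) (E A y) = 0" if "A \<in> \<A>" for A y
      using that \<open>\<A> \<subseteq> _\<close> \<open>\<forall>A\<in>\<A>. \<forall>l\<in>A. m l \<le> n\<close> by (intro N_power_E_zero) auto
    then show ?thesis
      using that(1) by (simp cong: semivar_bound_cong)
  qed
  then show ?thesis
    using semivar_bound_shift_power_minus_N_power[of n] unfolding fine_family_def by meson
qed

text \<open>Supplies the factor that is merely bounded in those error terms whose other factor is a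
  small nilpotent power.\<close>

lemma semivar_bound_shift_power_E:
  "\<exists>C\<ge>0. \<forall>\<A> s \<epsilon>. fine_family (spectrum X) \<A> s \<epsilon> \<longrightarrow>
    semivar_bound \<A> (\<lambda>A y. (shift X (s A) ^^ n) (E A y)) C"
proof -
  obtain M where M: "M \<ge> 0" "\<And>x. norm (X x) \<le> M * norm x"
    using bounded_clinear_bound[OF bounded_clinear_X] by blast
  have "semivar_bound \<A> (\<lambda>A y. (shift X (s A) ^^ n) (E A y)) ((M + R) ^ n * (4 * K))"
    if "fine_family (spectrum X) \<A> s \<epsilon>" for \<A> s \<epsilon>
    by (intro semivar_bound_shift_power semivar_bound_E_family[OF that] bounded_clinear_X M R_nonneg
        norm_tag_le[OF that])
  moreover have "(M + R) ^ n * (4 * K) \<ge> 0"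
    using M(1) R_nonneg K_nonneg by simp
  ultimately show ?thesis
    by blast
qed

end

section \<open>Taylor coefficients of the divided difference\<close>

text \<open>In Leibniz' rule only terms with at most one derivative on the linear factor survive.
  For \<open>n = 0\<close> the truncated \<open>n - 1\<close> is harmless, as its coefficient is
  0.\<close>

lemma higher_deriv_mult_linear:
  fixes h :: "complex \<Rightarrow> complex"
  assumes h: "h holomorphic_on U" and U: "open U" "z \<in> U"
  shows "(deriv ^^ n) (\<lambda>w. (w - c) * h w) z = (z - c) * (deriv ^^ n) h z + of_nat n * (deriv ^^ (n - 1)) h z"
proof -
  have lin: "(deriv ^^ i) (\<lambda>w. w - c) z = (if i = 0 then z - c else if i = 1 then 1 else 0)" for i
    by (subst higher_deriv_diff[where S = UNIV]) (auto intro!: holomorphic_intros)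
  have "(deriv ^^ n) (\<lambda>w. (w - c) * h w) z =
      (\<Sum>i = 0..n. of_nat (n choose i) * (deriv ^^ i) (\<lambda>w. w - c) z * (deriv ^^ (n - i)) h z)"
    by (rule higher_deriv_mult[OF _ h U]) (intro holomorphic_intros)
  also have "\<dots> = (\<Sum>i\<in>{0..n} \<inter> {0, 1}. of_nat (n choose i) * (deriv ^^ i) (\<lambda>w. w - c) z * (deriv ^^ (n - i)) h z)"
    by (rule sum.mono_neutral_right) (auto simp: lin)
  also have "\<dots> = (z - c) * (deriv ^^ n) h z + of_nat n * (deriv ^^ (n - 1)) h z"
  proof (cases n)
    case 0
    then show ?thesis by simp
  next
    case (Suc k)
    then have "{0..n} \<inter> {0, 1} = {0, 1}"
      by auto
    then show ?thesis
      by (simp add: lin)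
  qed
  finally show ?thesis .
qed

text \<open>On the diagonal, division by zero gives \<beta> the value 0, which in general is not the
  continuous extension; the statements about \<beta> therefore keep its arguments apart.\<close>

locale divided_difference =
  fixes f :: "complex \<Rightarrow> complex" and U :: "complex set" and \<beta> :: "complex \<Rightarrow> complex \<Rightarrow> complex"
  assumes holomorphic: "f holomorphic_on U" and open_U: "open U"
    and \<beta>: "\<beta> = (\<lambda>x y. (f x - f y) / (x - y))"
begin

definition taylor1 :: "nat \<Rightarrow> complex \<Rightarrow> complex"
  where "taylor1 q z = (deriv ^^ q) f z / fact q"

definition taylor2 :: "nat \<Rightarrow> nat \<Rightarrow> complex \<Rightarrow> complex \<Rightarrow> complex"
  where "taylor2 q1 q2 x y = mixed_deriv q1 q2 \<beta> x y / (fact q1 * fact q2)"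

text \<open>Differentiate (y - x) \<beta>(x, y) = f(y) - f(x) \<open>q\<close> times in y; the
  constant f(x) survives only for \<open>q = 0\<close>.\<close>

lemma partial_deriv_recursion:
  assumes "x \<in> U" "y \<in> U" "x \<noteq> y"
  shows "(x - y) * (deriv ^^ q) (\<beta> x) y =
    of_nat q * (deriv ^^ (q - 1)) (\<beta> x) y + (if q = 0 then f x else 0) - (deriv ^^ q) f y"
proof -
  have V: "open (U - {x})" "y \<in> U - {x}"
    using assms open_U by (auto intro: open_delete)
  have hol_f: "f holomorphic_on (U - {x})"
    using holomorphic by (rule holomorphic_on_subset) auto
  have hol: "\<beta> x holomorphic_on (U - {x})"
    unfolding \<beta> by (intro holomorphic_intros hol_f) auto
  have "(y - x) * (deriv ^^ q) (\<beta> x) y + of_nat q * (deriv ^^ (q - 1)) (\<beta> x) y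
      = (deriv ^^ q) (\<lambda>w. (w - x) * \<beta> x w) y"
    by (rule higher_deriv_mult_linear[OF hol V, symmetric])
  also have "\<dots> = (deriv ^^ q) (\<lambda>w. f w - f x) y"
    by (rule higher_deriv_transform_within_open[OF _ _ V])
      (auto intro!: holomorphic_intros hol hol_f simp: \<beta> field_simps)
  also have "\<dots> = (deriv ^^ q) f y - (if q = 0 then f x else 0)"
    by (subst higher_deriv_diff[OF hol_f _ V]) (auto intro!: holomorphic_intros)
  finally show ?thesis
    by (simp add: algebra_simps split: if_splits)
qed

text \<open>Solving the recursion for the derivative of order \<open>Suc q\<close> writes it as a
  quotient by \<open>x - y\<close> of terms already known to be holomorphic in \<open>x\<close>. The
  argument thus stays within one complex variable.\<close>

lemma holomorphic_partial_deriv: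
  assumes y: "y \<in> U"
  shows "(\<lambda>x. (deriv ^^ q) (\<beta> x) y) holomorphic_on (U - {y})"
proof (induction q)
  case 0
  show ?case
    unfolding \<beta> by (auto intro!: holomorphic_intros holomorphic_on_subset[OF holomorphic])
next
  case (Suc q)
  have "(\<lambda>x. (of_nat (Suc q) * (deriv ^^ q) (\<beta> x) y - (deriv ^^ Suc q) f y) / (x - y))
      holomorphic_on (U - {y})"
    by (intro holomorphic_intros Suc) auto
  moreover have "(of_nat (Suc q) * (deriv ^^ q) (\<beta> x) y - (deriv ^^ Suc q) f y) / (x - y) =
      (deriv ^^ Suc q) (\<beta> x) y" if "x \<in> U - {y}" for x
    using partial_deriv_recursion[of x y "Suc q"] that y by (auto simp: divide_eq_eq mult.commute)
  ultimately show ?case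
    by (rule holomorphic_transform)
qed

text \<open>The recursion in \<open>y\<close> is an identity of functions of \<open>x\<close> on the
  open set \<open>U - {y}\<close>, so it may be differentiated \<open>q1\<close> times; Leibniz'
  rule adds the term of order \<open>q1 - 1\<close>.\<close>

lemma mixed_deriv_recursion:
  assumes x: "x \<in> U" and y: "y \<in> U" and xy: "x \<noteq> y"
  shows "(x - y) * mixed_deriv q1 q2 \<beta> x y + of_nat q1 * mixed_deriv (q1 - 1) q2 \<beta> x y =
    of_nat q2 * mixed_deriv q1 (q2 - 1) \<beta> x y + (if q2 = 0 then (deriv ^^ q1) f x else 0)
    - (if q1 = 0 then (deriv ^^ q2) f y else 0)"
proof -
  have V: "open (U - {y})" "x \<in> U - {y}"
    using assms open_U by (auto intro: open_delete)
  have hol_f: "f holomorphic_on (U - {y})"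
    using holomorphic by (rule holomorphic_on_subset) auto
  let ?h = "\<lambda>q x. (deriv ^^ q) (\<beta> x) y"
  let ?e = "\<lambda>x. if q2 = 0 then f x else 0"
  have hol_e: "?e holomorphic_on (U - {y})"
    using hol_f by (cases "q2 = 0") auto
  have "(x - y) * (deriv ^^ q1) (?h q2) x + of_nat q1 * (deriv ^^ (q1 - 1)) (?h q2) x =
      (deriv ^^ q1) (\<lambda>w. (w - y) * ?h q2 w) x"
    by (rule higher_deriv_mult_linear[OF holomorphic_partial_deriv[OF y] V, symmetric])
  also have "\<dots> = (deriv ^^ q1) (\<lambda>w. of_nat q2 * ?h (q2 - 1) w + ?e w - (deriv ^^ q2) f y) x"
  proof (rule higher_deriv_transform_within_open[OF _ _ V])
    show "(\<lambda>w. (w - y) * ?h q2 w) holomorphic_on (U - {y})"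
      "(\<lambda>w. of_nat q2 * ?h (q2 - 1) w + ?e w - (deriv ^^ q2) f y) holomorphic_on (U - {y})"
      by (intro holomorphic_intros holomorphic_partial_deriv y hol_e)+
    show "(w - y) * ?h q2 w = of_nat q2 * ?h (q2 - 1) w + ?e w - (deriv ^^ q2) f y"
      if "w \<in> U - {y}" for w
      by (rule partial_deriv_recursion) (use that y in auto)
  qed
  also have "\<dots> = (deriv ^^ q1) (\<lambda>w. of_nat q2 * ?h (q2 - 1) w + ?e w) x
      - (deriv ^^ q1) (\<lambda>_. (deriv ^^ q2) f y) x"
    by (rule higher_deriv_diff[OF _ _ V]) (intro holomorphic_intros holomorphic_partial_deriv y hol_e)+
  also have "(deriv ^^ q1) (\<lambda>w. of_nat q2 * ?h (q2 - 1) w + ?e w) x =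
      (deriv ^^ q1) (\<lambda>w. of_nat q2 * ?h (q2 - 1) w) x + (deriv ^^ q1) ?e x"
    by (rule higher_deriv_add[OF _ _ V]) (intro holomorphic_intros holomorphic_partial_deriv y hol_e)+
  also have "(deriv ^^ q1) (\<lambda>w. of_nat q2 * ?h (q2 - 1) w) x = of_nat q2 * (deriv ^^ q1) (?h (q2 - 1)) x"
    by (rule higher_deriv_cmult[OF holomorphic_partial_deriv[OF y] V(2,1)])
  finally show ?thesis
    by (simp add: mixed_deriv_def)
qed

text \<open>Dividing by the factorials absorbs the factors \<open>q1\<close> and \<open>q2\<close>
  and leaves pure index shifts, which is the form that \<open>sum_telescope\<close> asks for with
  \<open>d = x - y\<close>.\<close>

lemma taylor2_recursion:
  assumes "x \<in> U" "y \<in> U" "x \<noteq> y"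
  shows "(x - y) * taylor2 q1 q2 x y + (if q1 = 0 then 0 else taylor2 (q1 - 1) q2 x y)
      - (if q2 = 0 then 0 else taylor2 q1 (q2 - 1) x y) =
    (if q2 = 0 then taylor1 q1 x else 0) - (if q1 = 0 then taylor1 q2 y else 0)"
proof -
  have 1: "(if q1 = 0 then 0 else taylor2 (q1 - 1) q2 x y) =
      of_nat q1 * mixed_deriv (q1 - 1) q2 \<beta> x y / (fact q1 * fact q2)"
    by (cases q1) (simp_all add: taylor2_def field_simps del: of_nat_Suc)
  have 2: "(if q2 = 0 then 0 else taylor2 q1 (q2 - 1) x y) =
      of_nat q2 * mixed_deriv q1 (q2 - 1) \<beta> x y / (fact q1 * fact q2)"
    by (cases q2) (simp_all add: taylor2_def field_simps del: of_nat_Suc)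
  have 3: "(if q2 = 0 then taylor1 q1 x else 0) - (if q1 = 0 then taylor1 q2 y else 0) =
      ((if q2 = 0 then (deriv ^^ q1) f x else 0) - (if q1 = 0 then (deriv ^^ q2) f y else 0))
        / (fact q1 * fact q2)"
    by (auto simp: taylor1_def diff_divide_distrib)
  have "(x - y) * taylor2 q1 q2 x y + (if q1 = 0 then 0 else taylor2 (q1 - 1) q2 x y)
      - (if q2 = 0 then 0 else taylor2 q1 (q2 - 1) x y) =
      ((x - y) * mixed_deriv q1 q2 \<beta> x y + of_nat q1 * mixed_deriv (q1 - 1) q2 \<beta> x y
        - of_nat q2 * mixed_deriv q1 (q2 - 1) \<beta> x y) / (fact q1 * fact q2)"
    unfolding 1 2 by (simp add: taylor2_def add_divide_distrib diff_divide_distrib)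
  also have "(x - y) * mixed_deriv q1 q2 \<beta> x y + of_nat q1 * mixed_deriv (q1 - 1) q2 \<beta> x y
        - of_nat q2 * mixed_deriv q1 (q2 - 1) \<beta> x y =
      (if q2 = 0 then (deriv ^^ q1) f x else 0) - (if q1 = 0 then (deriv ^^ q2) f y else 0)"
    using mixed_deriv_recursion[OF assms, of q1 q2] by simp
  finally show ?thesis
    unfolding 3 .
qed

text \<open>\<open>f\<close> may be unbounded on \<open>U\<close>, so the bound comes from
  compactness of a closed ball inside \<open>U\<close>.\<close>

lemma taylor1_locally_bounded:
  assumes "cball a r \<subseteq> U"
  shows "\<exists>k\<ge>0. \<forall>z\<in>ball a r. norm (taylor1 q z) \<le> k"
proof -
  have "taylor1 q holomorphic_on U"
    unfolding taylor1_def by (intro holomorphic_intros holomorphic open_U) auto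
  then have "continuous_on (cball a r) (taylor1 q)"
    using assms by (meson continuous_on_subset holomorphic_on_imp_continuous_on)
  then have "bounded (taylor1 q ` cball a r)"
    by (intro compact_imp_bounded compact_continuous_image) auto
  then obtain k where "\<forall>z\<in>cball a r. norm (taylor1 q z) \<le> k"
    by (auto simp: bounded_iff)
  then show ?thesis
    by (intro exI[of _ "max k 0"]) (auto simp: le_max_iff_disj)
qed

text \<open>Solve the recursion for the coefficient: it is a sum of one-variable functions and
  coefficients of lower total order, divided by a - b. The division is where the separation of the
  balls enters.\<close>

lemma multiplier_taylor2:
  assumes A: "A \<subseteq> ball a0 r" "A \<subseteq> U" and B: "B \<subseteq> ball b0 r" "B \<subseteq> U"
    and r: "r > 0" "4 * r \<le> dist a0 b0" and AB: "A \<inter> B = {}"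
    and bdA: "\<And>q. \<exists>k\<ge>0. \<forall>z\<in>A. norm (taylor1 q z) \<le> k"
    and bdB: "\<And>q. \<exists>k\<ge>0. \<forall>z\<in>B. norm (taylor1 q z) \<le> k"
  shows "\<exists>G. multiplier TYPE('a::complex_hilbert_space) A B (taylor2 q1 q2) G"
proof (induction "q1 + q2" arbitrary: q1 q2 rule: less_induct)
  case less
  have zero: "multiplier TYPE('a) A B (\<lambda>_ _. 0) (0 * 1)"
    using multiplier_mult_left[OF multiplier_one, of A "\<lambda>_. 0" 0] by simp
  obtain k1 where "k1 \<ge> 0" "\<And>z. z \<in> A \<Longrightarrow> norm (taylor1 q1 z) \<le> k1"
    using bdA[of q1] by blast
  then have "multiplier TYPE('a) A B (\<lambda>a b. taylor1 q1 a * 1) (k1 * 1)"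
    by (intro multiplier_mult_left multiplier_one) auto
  with zero obtain G1 where G1: "multiplier TYPE('a) A B (\<lambda>a b. if q2 = 0 then taylor1 q1 a else 0) G1"
    by (cases "q2 = 0") auto
  obtain k2 where "k2 \<ge> 0" "\<And>z. z \<in> B \<Longrightarrow> norm (taylor1 q2 z) \<le> k2"
    using bdB[of q2] by blast
  then have "multiplier TYPE('a) A B (\<lambda>a b. taylor1 q2 b * 1) (k2 * 1)"
    by (intro multiplier_mult_right multiplier_one) auto
  with zero obtain G2 where G2: "multiplier TYPE('a) A B (\<lambda>a b. if q1 = 0 then taylor1 q2 b else 0) G2"
    by (cases "q1 = 0") auto
  obtain G3 where G3: "multiplier TYPE('a) A B (\<lambda>a b. if q1 = 0 then 0 else taylor2 (q1 - 1) q2 a b) G3"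
    using zero less[of "q1 - 1" q2] by (cases "q1 = 0") auto
  obtain G4 where G4: "multiplier TYPE('a) A B (\<lambda>a b. if q2 = 0 then 0 else taylor2 q1 (q2 - 1) a b) G4"
    using zero less[of q1 "q2 - 1"] by (cases "q2 = 0") auto
  define g where "g a b = (if q2 = 0 then taylor1 q1 a else 0) - (if q1 = 0 then taylor1 q2 b else 0)
      - (if q1 = 0 then 0 else taylor2 (q1 - 1) q2 a b)
      + (if q2 = 0 then 0 else taylor2 q1 (q2 - 1) a b)" for a b
  have "multiplier TYPE('a) A B g (G1 + G2 + G3 + G4)"
    unfolding g_def by (intro multiplier_add multiplier_diff G1 G2 G3 G4)
  then obtain H where H: "multiplier TYPE('a) A B (\<lambda>a b. g a b / (a - b)) H"
    using multiplier_divide_diff[OF _ A(1) B(1) r] by blast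
  have "g a b / (a - b) = taylor2 q1 q2 a b" if "a \<in> A" "b \<in> B" for a b
  proof -
    have "a \<in> U" "b \<in> U" "a \<noteq> b"
      using that A B AB by auto
    then have "g a b = (a - b) * taylor2 q1 q2 a b"
      unfolding g_def taylor2_recursion[OF \<open>a \<in> U\<close> \<open>b \<in> U\<close> \<open>a \<noteq> b\<close>, of q1 q2, symmetric] by simp
    then show ?thesis
      using \<open>a \<noteq> b\<close> by simp
  qed
  then show ?case
    using H multiplier_cong[of A B "\<lambda>a b. g a b / (a - b)" "taylor2 q1 q2"] by blast
qed

end


section \<open>Telescoping\<close>

lemma sum_scaleC_shift:
  fixes u :: "nat \<Rightarrow> 'a::complex_hilbert_space"
  shows "(\<Sum>q<Suc n. c q *\<^sub>C u (Suc q)) =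
    (\<Sum>q<Suc n. (if q = 0 then 0 else c (q - 1)) *\<^sub>C u q) + c n *\<^sub>C u (Suc n)"
  by (induction n) simp_all

text \<open>Here t i j stands for (X1 - l1)^i E1(A) (X2 - l2)^j E2(B) x. Shifting indices collects
  at t i j the left side of \<open>rec\<close>, which vanishes unless i or j is 0. The shift past
  the top orders leaves the last two sums; with \<open>Suc n\<close> and \<open>Suc p\<close> the
  nilpotency orders, these carry the vanishing powers.\<close>

lemma sum_telescope:
  fixes t :: "nat \<Rightarrow> nat \<Rightarrow> 'a::complex_hilbert_space"
  assumes rec: "\<And>i j. d * b i j + (if i = 0 then 0 else b (i - 1) j) - (if j = 0 then 0 else b i (j - 1)) =
      (if j = 0 then F i else 0) - (if i = 0 then H j else 0)"
  shows "(\<Sum>i<Suc n. \<Sum>j<Suc p. b i j *\<^sub>C (t (Suc i) j - t i (Suc j) + d *\<^sub>C t i j)) =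
    (\<Sum>i<Suc n. F i *\<^sub>C t i 0) - (\<Sum>j<Suc p. H j *\<^sub>C t 0 j)
    + (\<Sum>j<Suc p. b n j *\<^sub>C t (Suc n) j) - (\<Sum>i<Suc n. b i p *\<^sub>C t i (Suc p))"
proof -
  let ?I = "{..<Suc n}" and ?J = "{..<Suc p}"
  have 1: "(\<Sum>i\<in>?I. \<Sum>j\<in>?J. b i j *\<^sub>C t (Suc i) j) =
      (\<Sum>i\<in>?I. \<Sum>j\<in>?J. (if i = 0 then 0 else b (i - 1) j) *\<^sub>C t i j) + (\<Sum>j\<in>?J. b n j *\<^sub>C t (Suc n) j)"
    unfolding sum.swap[of _ ?J ?I] sum.distrib[symmetric]
    by (intro sum.cong refl sum_scaleC_shift[where c = "\<lambda>i. b i _" and u = "\<lambda>i. t i _"])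
  have 2: "(\<Sum>i\<in>?I. \<Sum>j\<in>?J. b i j *\<^sub>C t i (Suc j)) =
      (\<Sum>i\<in>?I. \<Sum>j\<in>?J. (if j = 0 then 0 else b i (j - 1)) *\<^sub>C t i j) + (\<Sum>i\<in>?I. b i p *\<^sub>C t i (Suc p))"
    unfolding sum.distrib[symmetric]
    by (intro sum.cong refl sum_scaleC_shift[where c = "b _" and u = "t _"])
  have "(\<Sum>i\<in>?I. \<Sum>j\<in>?J. b i j *\<^sub>C (t (Suc i) j - t i (Suc j) + d *\<^sub>C t i j)) =
      (\<Sum>i\<in>?I. \<Sum>j\<in>?J. b i j *\<^sub>C t (Suc i) j) - (\<Sum>i\<in>?I. \<Sum>j\<in>?J. b i j *\<^sub>C t i (Suc j))
      + (\<Sum>i\<in>?I. \<Sum>j\<in>?J. (d * b i j) *\<^sub>C t i j)"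
    by (simp only: scaleC_add_right scaleC_right.diff scaleC_scaleC sum.distrib sum_subtractf mult.commute)
  also have "\<dots> = (\<Sum>i\<in>?I. \<Sum>j\<in>?J. (d * b i j + (if i = 0 then 0 else b (i - 1) j)
        - (if j = 0 then 0 else b i (j - 1))) *\<^sub>C t i j)
      + (\<Sum>j\<in>?J. b n j *\<^sub>C t (Suc n) j) - (\<Sum>i\<in>?I. b i p *\<^sub>C t i (Suc p))"
    unfolding 1 2 scaleC_left.diff scaleC_add_left sum.distrib sum_subtractf by simp
  also have "(\<Sum>i\<in>?I. \<Sum>j\<in>?J. (d * b i j + (if i = 0 then 0 else b (i - 1) j)
        - (if j = 0 then 0 else b i (j - 1))) *\<^sub>C t i j) =
      (\<Sum>i\<in>?I. \<Sum>j\<in>?J. (if j = 0 then F i *\<^sub>C t i j else 0)) - (\<Sum>i\<in>?I. \<Sum>j\<in>?J. (if i = 0 then H j *\<^sub>C t i j else 0))"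
    unfolding rec sum_subtractf[symmetric] by (intro sum.cong refl) (simp add: scaleC_left.diff)
  also have "(\<Sum>i\<in>?I. \<Sum>j\<in>?J. (if j = 0 then F i *\<^sub>C t i j else 0)) = (\<Sum>i\<in>?I. F i *\<^sub>C t i 0)"
    by (simp only: sum.delta finite_lessThan) simp
  also have "(\<Sum>i\<in>?I. \<Sum>j\<in>?J. (if i = 0 then H j *\<^sub>C t i j else 0)) = (\<Sum>j\<in>?J. H j *\<^sub>C t 0 j)"
    unfolding sum.swap[of _ ?J ?I] by (simp only: sum.delta finite_lessThan) simp
  finally show ?thesis .
qed

section \<open>Comparison of the Riemann sums\<close>

locale decomposition_pair =
  D1: decomposition X1 E1 m1 R + D2: decomposition X2 E2 m2 R + divided_difference f "ball 0 R" \<beta>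
  for X1 X2 :: "'a::complex_hilbert_space \<Rightarrow> 'a" and E1 E2 m1 m2 R f \<beta> +
  assumes spectra_disjoint: "spectrum X1 \<inter> spectrum X2 = {}"
    and spectra_subset: "spectrum X1 \<subseteq> ball 0 R" "spectrum X2 \<subseteq> ball 0 R"
begin

definition defect ::
  "complex \<Rightarrow> complex \<Rightarrow> ('a \<Rightarrow> 'a) \<Rightarrow> ('a \<Rightarrow> 'a) \<Rightarrow> 'a \<Rightarrow> 'a"
  where "defect l1 l2 dE1 dE2 x =
    gdoi_integrand \<beta> X1 m1 Whole X2 m2 Whole (X1 - X2) l1 l2 dE1 dE2 x
    - gdoi_integrand \<beta> X1 m1 ProjPart X2 m2 ProjPart (D1.P - D2.P) l1 l2 dE1 dE2 x
    - gdoi_integrand (\<lambda>x1 x2. f x1) X1 m1 NilPart X2 m2 ProjPart id l1 l2 dE1 dE2 x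
    + gdoi_integrand (\<lambda>x1 x2. f x2) X1 m1 ProjPart X2 m2 NilPart id l1 l2 dE1 dE2 x"

text \<open>
  Modulo the factors \<open>P - l\<close>, which are small on fine partitions, and the powers
  \<open>(X - l)^m\<close>, whose integrals vanish, the four integrands cancel.
\<close>

lemma defect_eq:
  assumes A: "A \<in> borel_subsets (spectrum X1)" and B: "B \<in> borel_subsets (spectrum X2)"
    and l: "l1 \<in> spectrum X1" "l2 \<in> spectrum X2" and m: "m1 l1 = Suc n" "m2 l2 = Suc p"
  shows "defect l1 l2 (E1 A) (E2 B) x =
    - (taylor2 0 0 l1 l2 *\<^sub>C (D1.P (E1 A (E2 B x)) - l1 *\<^sub>C E1 A (E2 B x)))
    + taylor2 0 0 l1 l2 *\<^sub>C E1 A (D2.P (E2 B x) - l2 *\<^sub>C E2 B x)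
    + (\<Sum>j<Suc p. taylor2 n j l1 l2 *\<^sub>C (shift X1 l1 ^^ Suc n) (E1 A ((shift X2 l2 ^^ j) (E2 B x))))
    - (\<Sum>i<Suc n. taylor2 i p l1 l2 *\<^sub>C (shift X1 l1 ^^ i) (E1 A ((shift X2 l2 ^^ Suc p) (E2 B x))))"
proof -
  define t where "t i j = (shift X1 l1 ^^ i) (E1 A ((shift X2 l2 ^^ j) (E2 B x)))" for i j
  have l12: "l1 \<in> ball 0 R" "l2 \<in> ball 0 R" "l1 \<noteq> l2"
    using l spectra_disjoint spectra_subset by auto
  note E1A = bounded_clinear_diff[OF D1.bounded_clinear_E[OF A]]
    bounded_clinear_add[OF D1.bounded_clinear_E[OF A]]
    bounded_clinear_scaleC[OF D1.bounded_clinear_E[OF A]]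
  note bounded_clinear_pow = bounded_clinear_funpow[OF bounded_clinear_shift[OF D1.bounded_clinear_X]]
  have inner: "(shift X1 l1 ^^ i) (E1 A ((X1 - X2) ((shift X2 l2 ^^ j) (E2 B x)))) =
      t (Suc i) j - t i (Suc j) + (l1 - l2) *\<^sub>C t i j" for i j
  proof -
    define w where "w = (shift X2 l2 ^^ j) (E2 B x)"
    have "E1 A ((X1 - X2) w) = shift X1 l1 (E1 A w) - E1 A (shift X2 l2 w) + (l1 - l2) *\<^sub>C E1 A w"
      by (simp add: shift_def E1A D1.E_X[OF A] scaleC_left.diff)
    then have "(shift X1 l1 ^^ i) (E1 A ((X1 - X2) w)) =
        (shift X1 l1 ^^ i) (shift X1 l1 (E1 A w)) - (shift X1 l1 ^^ i) (E1 A (shift X2 l2 w))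
        + (l1 - l2) *\<^sub>C (shift X1 l1 ^^ i) (E1 A w)"
      by (simp add: bounded_clinear_diff[OF bounded_clinear_pow] bounded_clinear_add[OF bounded_clinear_pow]
          bounded_clinear_scaleC[OF bounded_clinear_pow])
    then show ?thesis
      by (simp add: w_def t_def funpow_swap1)
  qed
  have "gdoi_integrand \<beta> X1 m1 Whole X2 m2 Whole (X1 - X2) l1 l2 (E1 A) (E2 B) x =
      (\<Sum>i<Suc n. \<Sum>j<Suc p. taylor2 i j l1 l2 *\<^sub>C (t (Suc i) j - t i (Suc j) + (l1 - l2) *\<^sub>C t i j))"
    unfolding gdoi_integrand_def orders.simps m inner taylor2_def atLeast0LessThan ..
  also have "\<dots> = (\<Sum>i<Suc n. taylor1 i l1 *\<^sub>C t i 0) - (\<Sum>j<Suc p. taylor1 j l2 *\<^sub>C t 0 j)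
    + (\<Sum>j<Suc p. taylor2 n j l1 l2 *\<^sub>C t (Suc n) j) - (\<Sum>i<Suc n. taylor2 i p l1 l2 *\<^sub>C t i (Suc p))"
    by (rule sum_telescope[where b = "\<lambda>i j. taylor2 i j l1 l2", OF taylor2_recursion[OF l12]])
  finally have whole: "gdoi_integrand \<beta> X1 m1 Whole X2 m2 Whole (X1 - X2) l1 l2 (E1 A) (E2 B) x = \<dots>" .
  \<comment> \<open>\<open>NilPart\<close> starts at order 1, so the terms of order 0 are split off;
    they have to be matched with the projection integrand.\<close>
  have split: "{..<Suc k} = insert 0 {1..<Suc k}" for k
    by auto
  have np: "(\<Sum>i<Suc n. taylor1 i l1 *\<^sub>C t i 0) = taylor1 0 l1 *\<^sub>C t 0 0 +
      gdoi_integrand (\<lambda>x1 x2. f x1) X1 m1 NilPart X2 m2 ProjPart id l1 l2 (E1 A) (E2 B) x"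
    unfolding gdoi_integrand_def orders.simps m split
    by (simp add: mixed_deriv_def taylor1_def t_def)
  have pn: "(\<Sum>j<Suc p. taylor1 j l2 *\<^sub>C t 0 j) = taylor1 0 l2 *\<^sub>C t 0 0 +
      gdoi_integrand (\<lambda>x1 x2. f x2) X1 m1 ProjPart X2 m2 NilPart id l1 l2 (E1 A) (E2 B) x"
    unfolding gdoi_integrand_def orders.simps m split
    by (simp add: mixed_deriv_def taylor1_def t_def)
  have pp: "gdoi_integrand \<beta> X1 m1 ProjPart X2 m2 ProjPart (D1.P - D2.P) l1 l2 (E1 A) (E2 B) x =
      taylor2 0 0 l1 l2 *\<^sub>C (D1.P (E1 A (E2 B x)) - E1 A (D2.P (E2 B x)))"
    by (simp add: gdoi_integrand_def taylor2_def E1A D1.E_P[OF A])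
  \<comment> \<open>The terms of order 0 amount to \<beta>(l1, l2) (l1 - l2). Replacing l1 and l2 by
    the projection parts costs exactly the two error terms with P - l.\<close>
  have "taylor1 0 l1 - taylor1 0 l2 = taylor2 0 0 l1 l2 * (l1 - l2)"
    using taylor2_recursion[OF l12, of 0 0] by (simp add: mult.commute)
  then have "taylor1 0 l1 *\<^sub>C t 0 0 - taylor1 0 l2 *\<^sub>C t 0 0 =
      taylor2 0 0 l1 l2 *\<^sub>C (l1 *\<^sub>C E1 A (E2 B x) - l2 *\<^sub>C E1 A (E2 B x))"
    by (simp add: t_def scaleC_scaleC flip: scaleC_left.diff)
  then have "taylor1 0 l1 *\<^sub>C t 0 0 - taylor1 0 l2 *\<^sub>C t 0 0
      - taylor2 0 0 l1 l2 *\<^sub>C (D1.P (E1 A (E2 B x)) - E1 A (D2.P (E2 B x))) =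
      - (taylor2 0 0 l1 l2 *\<^sub>C (D1.P (E1 A (E2 B x)) - l1 *\<^sub>C E1 A (E2 B x)))
      + taylor2 0 0 l1 l2 *\<^sub>C E1 A (D2.P (E2 B x) - l2 *\<^sub>C E2 B x)"
    by (simp add: E1A scaleC_right.diff)
  then show ?thesis
    unfolding defect_def whole np pn pp by (simp add: t_def algebra_simps)
qed

text \<open>The bound is linear in the mesh with \<open>C\<close> independent of cells and tags, so
  such sums tend to 0. Tags are arguments of \<open>Z\<close> apart from the cells so that scalar
  coefficients can be treated as multipliers on \<open>A0\<close> and \<open>B0\<close>.\<close>

definition small_bound ::
  "complex set \<Rightarrow> complex set \<Rightarrow> (complex \<Rightarrow> complex \<Rightarrow> complex set \<Rightarrow> complex set \<Rightarrow> 'a \<Rightarrow> 'a) \<Rightarrow> real \<Rightarrow> bool"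
  where "small_bound A0 B0 Z C \<longleftrightarrow> C \<ge> 0 \<and> (\<forall>\<epsilon> \<A> s \<B> t x. \<epsilon> \<ge> 0 \<longrightarrow>
    fine_family (spectrum X1) \<A> s \<epsilon> \<longrightarrow> \<Union>\<A> \<subseteq> A0 \<longrightarrow> fine_family (spectrum X2) \<B> t \<epsilon> \<longrightarrow> \<Union>\<B> \<subseteq> B0 \<longrightarrow>
    norm (\<Sum>A\<in>\<A>. \<Sum>B\<in>\<B>. Z (s A) (t B) A B x) \<le> \<epsilon> * C * norm x)"

definition small_on ::
  "complex set \<Rightarrow> complex set \<Rightarrow> (complex \<Rightarrow> complex \<Rightarrow> complex set \<Rightarrow> complex set \<Rightarrow> 'a \<Rightarrow> 'a) \<Rightarrow> bool"
  where "small_on A0 B0 Z \<longleftrightarrow> (\<exists>C. small_bound A0 B0 Z C)"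

lemma small_boundI:
  assumes "C \<ge> 0"
    and "\<And>\<epsilon> \<A> s \<B> t x. \<epsilon> \<ge> 0 \<Longrightarrow>
      fine_family (spectrum X1) \<A> s \<epsilon> \<Longrightarrow> \<Union>\<A> \<subseteq> A0 \<Longrightarrow> fine_family (spectrum X2) \<B> t \<epsilon> \<Longrightarrow> \<Union>\<B> \<subseteq> B0 \<Longrightarrow>
      norm (\<Sum>A\<in>\<A>. \<Sum>B\<in>\<B>. Z (s A) (t B) A B x) \<le> \<epsilon> * C * norm x"
  shows "small_bound A0 B0 Z C"
  unfolding small_bound_def by (intro conjI allI impI assms)

lemma small_bound_nonneg: "small_bound A0 B0 Z C \<Longrightarrow> C \<ge> 0"
  by (simp add: small_bound_def)

lemma small_boundD:
  assumes "small_bound A0 B0 Z C" "\<epsilon> \<ge> 0" "fine_family (spectrum X1) \<A> s \<epsilon>" "\<Union>\<A> \<subseteq> A0"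
    "fine_family (spectrum X2) \<B> t \<epsilon>" "\<Union>\<B> \<subseteq> B0"
  shows "norm (\<Sum>A\<in>\<A>. \<Sum>B\<in>\<B>. Z (s A) (t B) A B x) \<le> \<epsilon> * C * norm x"
  by (rule assms(1)[unfolded small_bound_def, THEN conjunct2, rule_format, OF assms(2-)])

lemma small_on_add:
  assumes "small_on A0 B0 Z" "small_on A0 B0 Z'"
  shows "small_on A0 B0 (\<lambda>a b A B x. Z a b A B x + Z' a b A B x)"
proof -
  obtain C D where C: "small_bound A0 B0 Z C" and D: "small_bound A0 B0 Z' D"
    using assms by (auto simp: small_on_def)
  have "small_bound A0 B0 (\<lambda>a b A B x. Z a b A B x + Z' a b A B x) (C + D)"
  proof (rule small_boundI)
    show "C + D \<ge> 0"
      using C D by (simp add: small_bound_nonneg)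
    fix \<epsilon> \<A> s \<B> t x
    assume "\<epsilon> \<ge> 0" "fine_family (spectrum X1) \<A> s \<epsilon>" "\<Union>\<A> \<subseteq> A0"
      "fine_family (spectrum X2) \<B> t \<epsilon>" "\<Union>\<B> \<subseteq> B0"
    from norm_triangle_mono[OF small_boundD[OF C this, of x] small_boundD[OF D this, of x]]
    show "norm (\<Sum>A\<in>\<A>. \<Sum>B\<in>\<B>. Z (s A) (t B) A B x + Z' (s A) (t B) A B x) \<le> \<epsilon> * (C + D) * norm x"
      by (simp add: sum.distrib ring_distribs)
  qed
  then show ?thesis
    by (auto simp: small_on_def)
qed

lemma small_on_zero: "small_on A0 B0 (\<lambda>a b A B x. 0)"
  unfolding small_on_def by (intro exI[of _ 0] small_boundI) auto

lemma small_on_sum: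
  "finite I \<Longrightarrow> (\<And>i. i \<in> I \<Longrightarrow> small_on A0 B0 (Z i)) \<Longrightarrow> small_on A0 B0 (\<lambda>a b A B x. \<Sum>i\<in>I. Z i a b A B x)"
  by (induction I rule: finite_induct) (auto intro: small_on_add small_on_zero)

lemma small_on_minus: "small_on A0 B0 Z \<Longrightarrow> small_on A0 B0 (\<lambda>a b A B x. - Z a b A B x)"
  by (simp add: small_on_def small_bound_def sum_negf)

lemma small_on_cong:
  assumes "small_on A0 B0 Z" and "A0 \<subseteq> spectrum X1" "B0 \<subseteq> spectrum X2"
    and "\<And>a b A B x. a \<in> A0 \<Longrightarrow> b \<in> B0 \<Longrightarrow> A \<in> borel_subsets (spectrum X1) \<Longrightarrow>
      B \<in> borel_subsets (spectrum X2) \<Longrightarrow> Z a b A B x = Z' a b A B x"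
  shows "small_on A0 B0 Z'"
proof -
  obtain C where C: "small_bound A0 B0 Z C"
    using assms(1) by (auto simp: small_on_def)
  have "small_bound A0 B0 Z' C"
  proof (rule small_boundI[OF small_bound_nonneg[OF C]])
    fix \<epsilon> \<A> s \<B> t x
    assume *: "\<epsilon> \<ge> 0" "fine_family (spectrum X1) \<A> s \<epsilon>" "\<Union>\<A> \<subseteq> A0"
      "fine_family (spectrum X2) \<B> t \<epsilon>" "\<Union>\<B> \<subseteq> B0"
    have "(\<Sum>A\<in>\<A>. \<Sum>B\<in>\<B>. Z (s A) (t B) A B x) = (\<Sum>A\<in>\<A>. \<Sum>B\<in>\<B>. Z' (s A) (t B) A B x)"
    proof (intro sum.cong refl assms(4))
      show "s A \<in> A0" "A \<in> borel_subsets (spectrum X1)" if "A \<in> \<A>" for A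
        by (rule fine_family_tag[OF *(2) that *(3)], rule fine_family_sets[OF *(2) that])
      show "t B \<in> B0" "B \<in> borel_subsets (spectrum X2)" if "B \<in> \<B>" for B
        by (rule fine_family_tag[OF *(4) that *(5)], rule fine_family_sets[OF *(4) that])
    qed
    then show "norm (\<Sum>A\<in>\<A>. \<Sum>B\<in>\<B>. Z' (s A) (t B) A B x) \<le> \<epsilon> * C * norm x"
      using small_boundD[OF C *, of x] by simp
  qed
  then show ?thesis
    by (auto simp: small_on_def)
qed

text \<open>Only the product of the two semivariation bounds is prescribed, so the factor \<epsilon>
  may come from either side and one lemma serves left and right errors.\<close>

lemma small_on_multiplier:
  fixes u v :: "complex \<Rightarrow> complex set \<Rightarrow> 'a \<Rightarrow> 'a"
  assumes g: "multiplier TYPE('a) A0 B0 g G"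
    and u: "\<And>a A. A \<in> borel_subsets (spectrum X1) \<Longrightarrow> bounded_clinear (u a A)"
    and CD: "C \<ge> 0" "D \<ge> 0"
    and est: "\<And>\<epsilon> \<A> s \<B> t. \<epsilon> \<ge> 0 \<Longrightarrow>
      fine_family (spectrum X1) \<A> s \<epsilon> \<Longrightarrow> \<Union>\<A> \<subseteq> A0 \<Longrightarrow> fine_family (spectrum X2) \<B> t \<epsilon> \<Longrightarrow> \<Union>\<B> \<subseteq> B0 \<Longrightarrow>
      \<exists>c d. c * d = \<epsilon> * (C * D) \<and> semivar_bound \<A> (\<lambda>A. u (s A) A) c \<and> semivar_bound \<B> (\<lambda>B. v (t B) B) d"
  shows "small_on A0 B0 (\<lambda>a b A B x. g a b *\<^sub>C u a A (v b B x))"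
  unfolding small_on_def
proof (intro exI[of _ "G * (C * D)"] small_boundI)
  show "G * (C * D) \<ge> 0"
    using multiplier_nonneg[OF g] CD by simp
  fix \<epsilon> \<A> s \<B> t x
  assume *: "\<epsilon> \<ge> 0" "fine_family (spectrum X1) \<A> s \<epsilon>" "\<Union>\<A> \<subseteq> A0"
    "fine_family (spectrum X2) \<B> t \<epsilon>" "\<Union>\<B> \<subseteq> B0"
  from est[OF this] obtain c d where cd: "c * d = \<epsilon> * (C * D)"
    "semivar_bound \<A> (\<lambda>A. u (s A) A) c" "semivar_bound \<B> (\<lambda>B. v (t B) B) d"
    by blast
  have "norm (\<Sum>A\<in>\<A>. \<Sum>B\<in>\<B>. g (s A) (t B) *\<^sub>C u (s A) A (v (t B) B x)) \<le> G * c * d * norm x"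
  proof (rule multiplierD[OF g _ _ _ cd(2,3)])
    show "s ` \<A> \<subseteq> A0" "t ` \<B> \<subseteq> B0"
      by (auto intro: fine_family_tag[OF *(2) _ *(3)] fine_family_tag[OF *(4) _ *(5)])
    show "bounded_clinear (u (s A) A)" if "A \<in> \<A>" for A
      by (rule u[OF fine_family_sets[OF *(2) that]])
  qed
  also have "G * c * d = \<epsilon> * (G * (C * D))"
    using cd(1) by (simp add: mult_ac)
  finally show "norm (\<Sum>A\<in>\<A>. \<Sum>B\<in>\<B>. g (s A) (t B) *\<^sub>C u (s A) A (v (t B) B x)) \<le> \<epsilon> * (G * (C * D)) * norm x" .
qed

text \<open>Each of the four terms of \<open>defect_eq\<close> has one small factor: P minus the tag
  in \<open>s1\<close> and \<open>s2\<close>, a power equal to the nilpotency order in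
  \<open>s3\<close> and \<open>s4\<close>. Constant orders fix the ranges of summation and let one
  multiplier bound per coefficient suffice.\<close>

lemma small_on_defect:
  assumes A0: "A0 \<in> borel_subsets (spectrum X1)" and B0: "B0 \<in> borel_subsets (spectrum X2)"
    and m: "\<And>a. a \<in> A0 \<Longrightarrow> m1 a = n" "\<And>b. b \<in> B0 \<Longrightarrow> m2 b = p"
    and mult: "\<And>i j. \<exists>G. multiplier TYPE('a) A0 B0 (taylor2 i j) G"
  shows "small_on A0 B0 (\<lambda>a b A B x. defect a b (E1 A) (E2 B) x)"
\<comment> \<open>That \<open>n\<close> and \<open>p\<close> are positive is read off from points of
  \<open>A0\<close> and \<open>B0\<close>; if one of these is empty, there are no tags to
  consider.\<close>
proof (cases "A0 = {} \<or> B0 = {}")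
  case True
  show ?thesis
    by (rule small_on_cong[OF small_on_zero borel_subsets_subset[OF A0] borel_subsets_subset[OF B0]])
      (use True in auto)
next
  case False
  then obtain a0 b0 where "a0 \<in> A0" "b0 \<in> B0"
    by auto
  then have "n \<ge> 1" "p \<ge> 1"
    using m D1.m_ge_1 D2.m_ge_1 borel_subsets_subset[OF A0] borel_subsets_subset[OF B0] by blast+
  then obtain n' p' where np: "n = Suc n'" "p = Suc p'"
    by (metis Suc_le_D One_nat_def)
  obtain G where G: "\<And>i j. multiplier TYPE('a) A0 B0 (taylor2 i j) (G i j)"
    using mult by metis
  note E1_bcl = D1.bounded_clinear_E
  note pow_bcl = bounded_clinear_compose[OF bounded_clinear_funpow[OF bounded_clinear_shift[OF D1.bounded_clinear_X]] E1_bcl]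
  obtain C1 where C1: "\<And>i. C1 i \<ge> 0" "\<And>i \<A> s \<epsilon>. fine_family (spectrum X1) \<A> s \<epsilon> \<Longrightarrow>
      semivar_bound \<A> (\<lambda>A y. (shift X1 (s A) ^^ i) (E1 A y)) (C1 i)"
    using D1.semivar_bound_shift_power_E by metis
  obtain C2 where C2: "\<And>i. C2 i \<ge> 0" "\<And>i \<A> s \<epsilon>. fine_family (spectrum X2) \<A> s \<epsilon> \<Longrightarrow>
      semivar_bound \<A> (\<lambda>A y. (shift X2 (s A) ^^ i) (E2 A y)) (C2 i)"
    using D2.semivar_bound_shift_power_E by metis
  obtain C3 where C3: "C3 \<ge> 0" "\<And>\<A> s \<epsilon>. \<epsilon> \<ge> 0 \<Longrightarrow> fine_family (spectrum X1) \<A> s \<epsilon> \<Longrightarrow>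
      \<forall>A\<in>\<A>. \<forall>l\<in>A. m1 l \<le> n \<Longrightarrow> semivar_bound \<A> (\<lambda>A y. (shift X1 (s A) ^^ n) (E1 A y)) (\<epsilon> * C3)"
    using D1.semivar_bound_nilpotent[of n] by blast
  obtain C4 where C4: "C4 \<ge> 0" "\<And>\<A> s \<epsilon>. \<epsilon> \<ge> 0 \<Longrightarrow> fine_family (spectrum X2) \<A> s \<epsilon> \<Longrightarrow>
      \<forall>A\<in>\<A>. \<forall>l\<in>A. m2 l \<le> p \<Longrightarrow> semivar_bound \<A> (\<lambda>A y. (shift X2 (s A) ^^ p) (E2 A y)) (\<epsilon> * C4)"
    using D2.semivar_bound_nilpotent[of p] by blast
  have s1: "small_on A0 B0 (\<lambda>a b A B x. taylor2 0 0 a b *\<^sub>C (D1.P (E1 A (E2 B x)) - a *\<^sub>C E1 A (E2 B x)))"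
  proof (rule small_on_multiplier[OF G, where u = "\<lambda>a A y. D1.P (E1 A y) - a *\<^sub>C E1 A y" and v = "\<lambda>b B y. E2 B y"
        and C = "4 * D1.K" and D = "4 * D2.K"])
    show "bounded_clinear (\<lambda>y. D1.P (E1 A y) - a *\<^sub>C E1 A y)" if "A \<in> borel_subsets (spectrum X1)" for a A
      by (intro bounded_clinear_diff_op bounded_clinear_compose[OF D1.bounded_clinear_P]
          bounded_clinear_compose[OF bounded_clinear_scaleC_op] E1_bcl that)
    show "\<exists>c d. c * d = \<epsilon> * (4 * D1.K * (4 * D2.K)) \<and>
        semivar_bound \<A> (\<lambda>A y. D1.P (E1 A y) - s A *\<^sub>C E1 A y) c \<and> semivar_bound \<B> (\<lambda>B y. E2 B y) d"
      if "\<epsilon> \<ge> 0" "fine_family (spectrum X1) \<A> s \<epsilon>" "fine_family (spectrum X2) \<B> t \<epsilon>" for \<epsilon> \<A> s \<B> t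
      using D1.semivar_bound_P_minus_tag[OF that(2,1)] D2.semivar_bound_E_family[OF that(3)]
      by (intro exI[of _ "\<epsilon> * (4 * D1.K)"] exI[of _ "4 * D2.K"]) simp
  qed (use D1.K_nonneg D2.K_nonneg in auto)
  have s2: "small_on A0 B0 (\<lambda>a b A B x. taylor2 0 0 a b *\<^sub>C E1 A (D2.P (E2 B x) - b *\<^sub>C E2 B x))"
  proof (rule small_on_multiplier[OF G, where u = "\<lambda>a A y. E1 A y" and v = "\<lambda>b B y. D2.P (E2 B y) - b *\<^sub>C E2 B y"
        and C = "4 * D1.K" and D = "4 * D2.K"])
    show "\<exists>c d. c * d = \<epsilon> * (4 * D1.K * (4 * D2.K)) \<and>
        semivar_bound \<A> (\<lambda>A y. E1 A y) c \<and> semivar_bound \<B> (\<lambda>B y. D2.P (E2 B y) - t B *\<^sub>C E2 B y) d"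
      if "\<epsilon> \<ge> 0" "fine_family (spectrum X1) \<A> s \<epsilon>" "fine_family (spectrum X2) \<B> t \<epsilon>" for \<epsilon> \<A> s \<B> t
      using D2.semivar_bound_P_minus_tag[OF that(3,1)] D1.semivar_bound_E_family[OF that(2)]
      by (intro exI[of _ "\<epsilon> * (4 * D2.K)"] exI[of _ "4 * D1.K"]) simp
  qed (use D1.K_nonneg D2.K_nonneg E1_bcl in auto)
  have s3: "small_on A0 B0 (\<lambda>a b A B x. taylor2 n' j a b *\<^sub>C (shift X1 a ^^ n) (E1 A ((shift X2 b ^^ j) (E2 B x))))" for j
  proof (rule small_on_multiplier[OF G, where u = "\<lambda>a A y. (shift X1 a ^^ n) (E1 A y)"
        and v = "\<lambda>b B y. (shift X2 b ^^ j) (E2 B y)" and C = C3 and D = "C2 j"])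
    show "\<exists>c d. c * d = \<epsilon> * (C3 * C2 j) \<and>
        semivar_bound \<A> (\<lambda>A y. (shift X1 (s A) ^^ n) (E1 A y)) c \<and>
        semivar_bound \<B> (\<lambda>B y. (shift X2 (t B) ^^ j) (E2 B y)) d"
      if "\<epsilon> \<ge> 0" "fine_family (spectrum X1) \<A> s \<epsilon>" "\<Union>\<A> \<subseteq> A0" "fine_family (spectrum X2) \<B> t \<epsilon>" for \<epsilon> \<A> s \<B> t
    proof -
      have "\<forall>A\<in>\<A>. \<forall>l\<in>A. m1 l \<le> n"
        using that(3) m(1) by auto
      then show ?thesis
        using C3(2)[OF that(1,2)] C2(2)[OF that(4)]
        by (intro exI[of _ "\<epsilon> * C3"] exI[of _ "C2 j"]) simp
    qed
  qed (use C2 C3 pow_bcl in auto)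
  have s4: "small_on A0 B0 (\<lambda>a b A B x. taylor2 i p' a b *\<^sub>C (shift X1 a ^^ i) (E1 A ((shift X2 b ^^ p) (E2 B x))))" for i
  proof (rule small_on_multiplier[OF G, where u = "\<lambda>a A y. (shift X1 a ^^ i) (E1 A y)"
        and v = "\<lambda>b B y. (shift X2 b ^^ p) (E2 B y)" and C = "C1 i" and D = C4])
    show "\<exists>c d. c * d = \<epsilon> * (C1 i * C4) \<and>
        semivar_bound \<A> (\<lambda>A y. (shift X1 (s A) ^^ i) (E1 A y)) c \<and>
        semivar_bound \<B> (\<lambda>B y. (shift X2 (t B) ^^ p) (E2 B y)) d"
      if "\<epsilon> \<ge> 0" "fine_family (spectrum X1) \<A> s \<epsilon>" "fine_family (spectrum X2) \<B> t \<epsilon>" "\<Union>\<B> \<subseteq> B0" for \<epsilon> \<A> s \<B> t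
    proof -
      have "\<forall>A\<in>\<B>. \<forall>l\<in>A. m2 l \<le> p"
        using that(4) m(2) by auto
      then show ?thesis
        using C4(2)[OF that(1,3)] C1(2)[OF that(2)]
        by (intro exI[of _ "C1 i"] exI[of _ "\<epsilon> * C4"]) simp
    qed
  qed (use C1 C4 pow_bcl in auto)
  have "small_on A0 B0 (\<lambda>a b A B x.
    - (taylor2 0 0 a b *\<^sub>C (D1.P (E1 A (E2 B x)) - a *\<^sub>C E1 A (E2 B x)))
    + taylor2 0 0 a b *\<^sub>C E1 A (D2.P (E2 B x) - b *\<^sub>C E2 B x)
    + (\<Sum>j<Suc p'. taylor2 n' j a b *\<^sub>C (shift X1 a ^^ n) (E1 A ((shift X2 b ^^ j) (E2 B x))))
    + - (\<Sum>i<Suc n'. taylor2 i p' a b *\<^sub>C (shift X1 a ^^ i) (E1 A ((shift X2 b ^^ p) (E2 B x)))))"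
    by (intro small_on_add small_on_minus small_on_sum s1 s2 s3 s4 finite_lessThan)
  then show ?thesis
  proof (rule small_on_cong[OF _ borel_subsets_subset[OF A0] borel_subsets_subset[OF B0]], goal_cases)
    case (1 a b A B x)
    have "a \<in> spectrum X1" "b \<in> spectrum X2"
      using 1 borel_subsets_subset[OF A0] borel_subsets_subset[OF B0] by auto
    from defect_eq[OF 1(3,4) this] m(1)[OF 1(1)] m(2)[OF 1(2)] show ?case
      unfolding np by simp
  qed
qed

end


section \<open>Localization\<close>

context decomposition_pair
begin

text \<open>\<open>E1 A0\<close> commutes with powers of \<open>shift X1 l1\<close> and meets
  \<open>E1 A\<close>, giving \<open>E1 A\<close> or 0; on the right \<open>E2 B\<close> meets
  \<open>E2 B0\<close> in the same way. \<open>Y 0 = 0\<close> kills the cells \<open>B\<close>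
  outside \<open>B0\<close>.\<close>

lemma gdoi_integrand_localize:
  assumes A: "A \<in> borel_subsets (spectrum X1)" "A0 \<in> borel_subsets (spectrum X1)" "A \<subseteq> A0 \<or> A \<inter> A0 = {}"
    and B: "B \<in> borel_subsets (spectrum X2)" "B0 \<in> borel_subsets (spectrum X2)" "B \<subseteq> B0 \<or> B \<inter> B0 = {}"
    and Y: "Y 0 = 0"
  shows "E1 A0 (gdoi_integrand b X1 m1 p1 X2 m2 p2 Y l1 l2 (E1 A) (E2 B) (E2 B0 x)) =
    (if A \<subseteq> A0 \<and> B \<subseteq> B0 then gdoi_integrand b X1 m1 p1 X2 m2 p2 Y l1 l2 (E1 A) (E2 B) x else 0)"
proof -
  have zero: "(shift X1 l ^^ q) 0 = 0" "(shift X2 l ^^ q) 0 = 0" for l q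
    by (simp_all add: bounded_clinear_zero bounded_clinear_funpow bounded_clinear_shift
        D1.bounded_clinear_X D2.bounded_clinear_X)
  have 1: "E2 B (E2 B0 x) = (if B \<subseteq> B0 then E2 B x else 0)"
    using B by (auto simp: D2.E_E Int_absorb2 D2.E_empty)
  have 2: "E1 A0 ((shift X1 l1 ^^ q) (E1 A y)) = (if A \<subseteq> A0 then (shift X1 l1 ^^ q) (E1 A y) else 0)" for q y
  proof -
    have "E1 A0 (E1 A y) = (if A \<subseteq> A0 then E1 A y else 0)"
    proof (cases "A \<subseteq> A0")
      case True
      then show ?thesis
        using A by (simp add: D1.E_E Int_absorb1)
    next
      case False
      then have "A0 \<inter> A = {}"
        using A(3) by blast
      then show ?thesis
        using A False by (simp add: D1.E_E D1.E_empty)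
    qed
    then show ?thesis
      by (simp add: D1.E_shift_power[OF A(2)] zero)
  qed
  have 3: "(shift X1 l1 ^^ q1) (E1 A (Y ((shift X2 l2 ^^ q2) 0))) = 0" for q1 q2
    by (simp add: zero Y bounded_clinear_zero[OF D1.bounded_clinear_E[OF A(1)]])
  show ?thesis
    by (simp add: gdoi_integrand_def bounded_clinear_sum[OF D1.bounded_clinear_E[OF A(2)]]
        bounded_clinear_scaleC[OF D1.bounded_clinear_E[OF A(2)]] 1 2 3 cong: if_cong)
qed

lemma defect_localize:
  assumes A: "A \<in> borel_subsets (spectrum X1)" "A0 \<in> borel_subsets (spectrum X1)" "A \<subseteq> A0 \<or> A \<inter> A0 = {}"
    and B: "B \<in> borel_subsets (spectrum X2)" "B0 \<in> borel_subsets (spectrum X2)" "B \<subseteq> B0 \<or> B \<inter> B0 = {}"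
  shows "E1 A0 (defect l1 l2 (E1 A) (E2 B) (E2 B0 x)) =
    (if A \<subseteq> A0 \<and> B \<subseteq> B0 then defect l1 l2 (E1 A) (E2 B) x else 0)"
proof -
  have "(X1 - X2) 0 = 0" "(D1.P - D2.P) 0 = 0" "id (0 :: 'a) = 0"
    by (simp_all add: bounded_clinear_zero D1.bounded_clinear_X D2.bounded_clinear_X
        D1.bounded_clinear_P D2.bounded_clinear_P)
  note loc = gdoi_integrand_localize[OF A B, where Y = "X1 - X2", OF this(1)]
    gdoi_integrand_localize[OF A B, where Y = "D1.P - D2.P", OF this(2)]
    gdoi_integrand_localize[OF A B, where Y = id, OF this(3)]
  show ?thesis
    unfolding defect_def bounded_clinear_add[OF D1.bounded_clinear_E[OF A(2)]]
      bounded_clinear_diff[OF D1.bounded_clinear_E[OF A(2)]] loc by simp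
qed

definition defect_sum ::
  "(complex set set \<times> (complex set \<Rightarrow> complex)) \<times> (complex set set \<times> (complex set \<Rightarrow> complex)) \<Rightarrow> 'a \<Rightarrow> 'a"
  where "defect_sum = (\<lambda>((P, s), (Q, t)) x. \<Sum>A\<in>P. \<Sum>B\<in>Q. defect (s A) (t B) (E1 A) (E2 B) x)"

text \<open>The projections discard all cells outside \<open>A0\<close> and \<open>B0\<close>, which
  turns a sum over full partitions into one over fine families where the local bound
  applies.\<close>

lemma norm_localized_defect_sum_le:
  assumes C: "small_bound A0 B0 (\<lambda>a b A B x. defect a b (E1 A) (E2 B) x) C" and \<epsilon>: "\<epsilon> \<ge> 0"
    and A0: "A0 \<in> borel_subsets (spectrum X1)" and B0: "B0 \<in> borel_subsets (spectrum X2)"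
    and P: "fine_family (spectrum X1) P s \<epsilon>" "\<forall>A\<in>P. A \<subseteq> A0 \<or> A \<inter> A0 = {}"
    and Q: "fine_family (spectrum X2) Q t \<epsilon>" "\<forall>B\<in>Q. B \<subseteq> B0 \<or> B \<inter> B0 = {}"
  shows "norm (E1 A0 (defect_sum ((P, s), (Q, t)) (E2 B0 x))) \<le> \<epsilon> * C * norm x"
proof -
  let ?P = "{A\<in>P. A \<subseteq> A0}" and ?Q = "{B\<in>Q. B \<subseteq> B0}"
  have fin: "finite P" "finite Q"
    using P(1) Q(1) by (simp_all add: fine_family_def)
  have "E1 A0 (defect_sum ((P, s), (Q, t)) (E2 B0 x)) =
      (\<Sum>A\<in>P. \<Sum>B\<in>Q. E1 A0 (defect (s A) (t B) (E1 A) (E2 B) (E2 B0 x)))"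
    by (simp add: defect_sum_def bounded_clinear_sum[OF D1.bounded_clinear_E[OF A0]])
  also have "\<dots> = (\<Sum>A\<in>P. \<Sum>B\<in>Q.
      if A \<subseteq> A0 \<and> B \<subseteq> B0 then defect (s A) (t B) (E1 A) (E2 B) x else 0)"
    using P(2) Q(2)
    by (intro sum.cong refl defect_localize fine_family_sets[OF P(1)] fine_family_sets[OF Q(1)] A0 B0)
      simp_all
  also have "\<dots> = (\<Sum>A\<in>P. if A \<subseteq> A0 then \<Sum>B\<in>Q. if B \<subseteq> B0 then defect (s A) (t B) (E1 A) (E2 B) x else 0 else 0)"
    by (intro sum.cong refl) simp
  also have "\<dots> = (\<Sum>A\<in>?P. \<Sum>B\<in>?Q. defect (s A) (t B) (E1 A) (E2 B) x)"
    by (simp only: sum.inter_filter[OF fin(1)] sum.inter_filter[OF fin(2)])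
  also have "norm \<dots> \<le> \<epsilon> * C * norm x"
    by (rule small_boundD[OF C \<epsilon> fine_family_subset[OF P(1)] _ fine_family_subset[OF Q(1)]]) auto
  finally show ?thesis .
qed

text \<open>The strong limit is taken at the vector \<open>E2 B0 x\<close> and \<open>E1 A0\<close>
  is continuous, so the limit obeys the local bound for every mesh.\<close>

lemma localized_limit_zero:
  assumes lim: "\<And>x. ((\<lambda>p. defect_sum p x) \<longlongrightarrow> T x)
      (tagged_partitions (spectrum X1) \<times>\<^sub>F tagged_partitions (spectrum X2))"
    and A0: "A0 \<in> borel_subsets (spectrum X1)" and B0: "B0 \<in> borel_subsets (spectrum X2)"
    and small: "small_on A0 B0 (\<lambda>a b A B x. defect a b (E1 A) (E2 B) x)"
  shows "E1 A0 (T (E2 B0 x)) = 0"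
proof -
  obtain C where C: "small_bound A0 B0 (\<lambda>a b A B x. defect a b (E1 A) (E2 B) x) C"
    using small by (auto simp: small_on_def)
  let ?F = "tagged_partitions (spectrum X1) \<times>\<^sub>F tagged_partitions (spectrum X2)"
  have not_bot: "?F \<noteq> bot"
    by (simp add: prod_filter_eq_bot tagged_partitions_not_bot)
  have "norm (E1 A0 (T (E2 B0 x))) \<le> \<epsilon> * (C * norm x)" if \<epsilon>: "\<epsilon> > 0" for \<epsilon>
  proof (rule Lim_norm_ubound[OF not_bot bounded_clinear_tendsto[OF D1.bounded_clinear_E[OF A0] lim]])
    have "\<forall>\<^sub>F (Q, t) in tagged_partitions (spectrum X1).
        fine_family (spectrum X1) Q t \<epsilon> \<and> (\<forall>A\<in>Q. A \<subseteq> A0 \<or> A \<inter> A0 = {})"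
      using eventually_fine_family[OF D1.bounded_spectrum \<epsilon>] eventually_cells_split[OF A0]
      by eventually_elim (simp add: case_prod_unfold)
    moreover have "\<forall>\<^sub>F (Q, t) in tagged_partitions (spectrum X2).
        fine_family (spectrum X2) Q t \<epsilon> \<and> (\<forall>B\<in>Q. B \<subseteq> B0 \<or> B \<inter> B0 = {})"
      using eventually_fine_family[OF D2.bounded_spectrum \<epsilon>] eventually_cells_split[OF B0]
      by eventually_elim (simp add: case_prod_unfold)
    ultimately have "\<forall>\<^sub>F p in ?F.
        (case fst p of (Q, t) \<Rightarrow> fine_family (spectrum X1) Q t \<epsilon> \<and> (\<forall>A\<in>Q. A \<subseteq> A0 \<or> A \<inter> A0 = {})) \<and>
        (case snd p of (Q, t) \<Rightarrow> fine_family (spectrum X2) Q t \<epsilon> \<and> (\<forall>B\<in>Q. B \<subseteq> B0 \<or> B \<inter> B0 = {}))"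
      by (rule eventually_prodI)
    then show "\<forall>\<^sub>F p in ?F. norm (E1 A0 (defect_sum p (E2 B0 x))) \<le> \<epsilon> * (C * norm x)"
    proof eventually_elim
      case (elim p)
      obtain P s Q t where p: "p = ((P, s), (Q, t))"
        by (metis prod.exhaust)
      show ?case
        using norm_localized_defect_sum_le[OF C less_imp_le[OF \<epsilon>] A0 B0, of P s Q t x] elim
        by (simp add: p mult.assoc)
    qed
  qed
  then have "norm (E1 A0 (T (E2 B0 x))) \<le> 0"
    using small_bound_nonneg[OF C] by (intro nonpos_if_le_all_multiples[where b = "C * norm x"]) auto
  then show ?thesis
    by simp
qed

text \<open>Local vanishing is used twice: for the first measure acting on \<open>T x\<close>, and
  inside it for the second measure with \<open>A\<close> fixed. The radius around \<open>a\<close>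
  must be chosen before \<open>b\<close> is known, so it depends only on the distance from
  \<open>a\<close> to the second spectrum.\<close>

lemma limit_zero:
  assumes T: "bounded_clinear T" and lim: "\<And>x. ((\<lambda>p. defect_sum p x) \<longlongrightarrow> T x)
      (tagged_partitions (spectrum X1) \<times>\<^sub>F tagged_partitions (spectrum X2))"
  shows "T x = 0"
proof -
  have "E1 (spectrum X1) (T x) = 0"
  proof (rule vector_measure_local_zero[OF D1.vector_measure_E D1.measurable_m])
    fix a assume a: "a \<in> spectrum X1"
    then have "a \<notin> spectrum X2"
      using spectra_disjoint by auto
    then obtain r2 where r2: "r2 > 0" "\<And>b. b \<in> spectrum X2 \<Longrightarrow> dist a b \<ge> r2"
      using not_in_spectrum_nhd[OF D2.bounded_clinear_X] by metis
    obtain r1 where r1: "r1 > 0" "cball a r1 \<subseteq> ball 0 R"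
      using a spectra_subset open_contains_cball[of "ball 0 R :: complex set"] by blast
    \<comment> \<open>The quarter yields \<open>4 * r \<le> dist a b\<close> for every
      \<open>b\<close> in the second spectrum, as the geometric series demands.\<close>
    define r where "r = min r1 (r2 / 4)"
    have r: "r > 0" "4 * r \<le> r2" "cball a r \<subseteq> ball 0 R"
      using r1 r2(1) by (auto simp: r_def)
    have "E1 A (T x) = 0" if A: "A \<in> borel_subsets (spectrum X1)" "A \<subseteq> ball a r" "\<forall>l\<in>A. m1 l = n" for n A
    proof -
      have "bounded_linear (\<lambda>y. E1 A (T y))"
        by (intro bounded_clinear_bounded_linear bounded_clinear_compose[OF D1.bounded_clinear_E[OF A(1)] T])
      from vector_measure_bounded_linear[OF D2.vector_measure_E this]
      have "E1 A (T (E2 (spectrum X2) x)) = 0"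
      proof (rule vector_measure_local_zero[OF _ D2.measurable_m])
        fix b assume b: "b \<in> spectrum X2"
        obtain r3 where r3: "r3 > 0" "cball b r3 \<subseteq> ball 0 R"
          using b spectra_subset open_contains_cball[of "ball 0 R :: complex set"] by blast
        \<comment> \<open>Of the two radii, \<open>r\<close> serves the multiplier bound and
          \<open>r3\<close> the bound on the Taylor coefficients of \<open>f\<close> over
          \<open>B\<close>.\<close>
        have "E1 A (T (E2 B x)) = 0"
          if B: "B \<in> borel_subsets (spectrum X2)" "B \<subseteq> ball b (min r r3)" "\<forall>l\<in>B. m2 l = p" for p B
        proof (rule localized_limit_zero[OF lim A(1) B(1)], rule small_on_defect[OF A(1) B(1)])
          fix i j
          have AS: "A \<subseteq> spectrum X1" "B \<subseteq> spectrum X2"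
            using A(1) B(1) by (simp_all add: borel_subsets_subset)
          show "\<exists>G. multiplier TYPE('a) A B (taylor2 i j) G"
          proof (rule multiplier_taylor2[OF A(2) _ _ _ r(1)])
            show "A \<subseteq> ball 0 R" "B \<subseteq> ball 0 R" "A \<inter> B = {}"
              using AS spectra_subset spectra_disjoint by auto
            show "B \<subseteq> ball b r"
              using B(2) by auto
            show "4 * r \<le> dist a b"
              using r(2) r2(2)[OF b] by simp
            show "\<exists>k\<ge>0. \<forall>z\<in>A. norm (taylor1 q z) \<le> k" for q
              using taylor1_locally_bounded[OF r(3), of q] A(2) by (meson subsetD)
            show "\<exists>k\<ge>0. \<forall>z\<in>B. norm (taylor1 q z) \<le> k" for q
              using taylor1_locally_bounded[OF r3(2), of q] B(2) by (auto simp: subset_iff)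
          qed
        qed (use A B in auto)
        then show "\<exists>r>0. \<forall>n. \<forall>B\<in>borel_subsets (spectrum X2). B \<subseteq> ball b r \<longrightarrow>
            (\<forall>l\<in>B. m2 l = n) \<longrightarrow> E1 A (T (E2 B x)) = 0"
          using r(1) r3(1) by (intro exI[of _ "min r r3"]) auto
      qed
      then show ?thesis
        by (simp add: D2.E_whole)
    qed
    then show "\<exists>r>0. \<forall>n. \<forall>A\<in>borel_subsets (spectrum X1). A \<subseteq> ball a r \<longrightarrow>
        (\<forall>l\<in>A. m1 l = n) \<longrightarrow> E1 A (T x) = 0"
      using r(1) by blast
  qed
  then show ?thesis
    by (simp add: D1.E_whole)
qed

end

section \<open>Passage from Riemann sums to the four operator integrals\<close>

lemma gdoi_tendsto:
  assumes "gdoi_exists \<beta> X1 E1 m1 p1 X2 E2 m2 p2 Y"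
  shows "bounded_clinear (gdoi \<beta> X1 E1 m1 p1 X2 E2 m2 p2 Y)"
    and "((\<lambda>((P, s), (Q, t)). \<Sum>A\<in>P. \<Sum>B\<in>Q.
        gdoi_integrand \<beta> X1 m1 p1 X2 m2 p2 Y (s A) (t B) (E1 A) (E2 B) x)
      \<longlongrightarrow> gdoi \<beta> X1 E1 m1 p1 X2 E2 m2 p2 Y x)
      (tagged_partitions (spectrum X1) \<times>\<^sub>F tagged_partitions (spectrum X2))"
proof -
  obtain T where T: "has_double_spectral_integral (spectrum X1) E1 (spectrum X2) E2
      (gdoi_integrand \<beta> X1 m1 p1 X2 m2 p2 Y) T"
    using assms by (auto simp: gdoi_exists_def)
  then have "gdoi \<beta> X1 E1 m1 p1 X2 E2 m2 p2 Y = T"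
    unfolding gdoi_def by (rule double_spectral_integral_unique)
  then show "bounded_clinear (gdoi \<beta> X1 E1 m1 p1 X2 E2 m2 p2 Y)"
    and "((\<lambda>((P, s), (Q, t)). \<Sum>A\<in>P. \<Sum>B\<in>Q.
        gdoi_integrand \<beta> X1 m1 p1 X2 m2 p2 Y (s A) (t B) (E1 A) (E2 B) x)
      \<longlongrightarrow> gdoi \<beta> X1 E1 m1 p1 X2 E2 m2 p2 Y x)
      (tagged_partitions (spectrum X1) \<times>\<^sub>F tagged_partitions (spectrum X2))"
    using T by (auto simp: has_double_spectral_integral_def)
qed

theorem theorem5:
  fixes R :: real
    and f :: "complex \<Rightarrow> complex"
    and \<beta> :: "complex \<Rightarrow> complex \<Rightarrow> complex"
    and X1 X2 :: "'a::complex_hilbert_space \<Rightarrow> 'a"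
    and E1 E2 :: "complex set \<Rightarrow> 'a \<Rightarrow> 'a"
    and m1 m2 :: "complex \<Rightarrow> nat"
  assumes "R > 0"
    and "f analytic_on {z. norm z < R}"
    and "spectral_decomposition X1 E1 m1"
    and "spectral_decomposition X2 E2 m2"
    and "\<forall>l1\<in>spectrum X1. norm l1 < R"
    and "\<forall>l2\<in>spectrum X2. norm l2 < R"
    and "\<forall>l1\<in>spectrum X1. \<forall>l2\<in>spectrum X2. l1 \<noteq> l2"
    and "\<beta> = (\<lambda>x1 x2. (f x1 - f x2) / (x1 - x2))"
    and "gdoi_exists \<beta> X1 E1 m1 Whole X2 E2 m2 Whole (X1 - X2)"
    and "gdoi_exists \<beta> X1 E1 m1 ProjPart X2 E2 m2 ProjPart (proj_part X1 E1 - proj_part X2 E2)"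
    and "gdoi_exists (\<lambda>x1 x2. f x1) X1 E1 m1 NilPart X2 E2 m2 ProjPart id"
    and "gdoi_exists (\<lambda>x1 x2. f x2) X1 E1 m1 ProjPart X2 E2 m2 NilPart id"
  shows "gdoi \<beta> X1 E1 m1 Whole X2 E2 m2 Whole (X1 - X2) =
    gdoi \<beta> X1 E1 m1 ProjPart X2 E2 m2 ProjPart (proj_part X1 E1 - proj_part X2 E2) +
    (gdoi (\<lambda>x1 x2. f x1) X1 E1 m1 NilPart X2 E2 m2 ProjPart id -
     gdoi (\<lambda>x1 x2. f x2) X1 E1 m1 ProjPart X2 E2 m2 NilPart id)"
proof -
  have ball: "{z. norm z < R} = ball (0::complex) R"
    by auto
  interpret decomposition_pair X1 X2 E1 E2 m1 m2 R f \<beta>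
    using assms(1,3-8) analytic_imp_holomorphic[OF assms(2)[unfolded ball]]
    by unfold_locales (auto intro: less_imp_le)
  let ?F = "tagged_partitions (spectrum X1) \<times>\<^sub>F tagged_partitions (spectrum X2)"
  let ?W = "gdoi \<beta> X1 E1 m1 Whole X2 E2 m2 Whole (X1 - X2)"
    and ?PP = "gdoi \<beta> X1 E1 m1 ProjPart X2 E2 m2 ProjPart (D1.P - D2.P)"
    and ?NP = "gdoi (\<lambda>x1 x2. f x1) X1 E1 m1 NilPart X2 E2 m2 ProjPart id"
    and ?PN = "gdoi (\<lambda>x1 x2. f x2) X1 E1 m1 ProjPart X2 E2 m2 NilPart id"
  note ex = assms(9) assms(10)[folded D1.P_def D2.P_def] assms(11,12)
  \<comment> \<open>All four integrals are limits along the same product filter, so their Riemann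
    sums may be combined before passing to the limit.\<close>
  have "((\<lambda>p. defect_sum p x) \<longlongrightarrow> ?W x - ?PP x - ?NP x + ?PN x) ?F" for x
  proof -
    have "defect_sum p x =
      ((\<lambda>((P, s), (Q, t)). \<Sum>A\<in>P. \<Sum>B\<in>Q.
        gdoi_integrand \<beta> X1 m1 Whole X2 m2 Whole (X1 - X2) (s A) (t B) (E1 A) (E2 B) x) p)
      - ((\<lambda>((P, s), (Q, t)). \<Sum>A\<in>P. \<Sum>B\<in>Q.
        gdoi_integrand \<beta> X1 m1 ProjPart X2 m2 ProjPart (D1.P - D2.P) (s A) (t B) (E1 A) (E2 B) x) p)
      - ((\<lambda>((P, s), (Q, t)). \<Sum>A\<in>P. \<Sum>B\<in>Q.
        gdoi_integrand (\<lambda>x1 x2. f x1) X1 m1 NilPart X2 m2 ProjPart id (s A) (t B) (E1 A) (E2 B) x) p)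
      + ((\<lambda>((P, s), (Q, t)). \<Sum>A\<in>P. \<Sum>B\<in>Q.
        gdoi_integrand (\<lambda>x1 x2. f x2) X1 m1 ProjPart X2 m2 NilPart id (s A) (t B) (E1 A) (E2 B) x) p)" for p
      by (cases p) (auto simp: defect_sum_def defect_def sum.distrib sum_subtractf)
    then show ?thesis
      by (simp only:) (intro tendsto_add tendsto_diff gdoi_tendsto(2) ex)
  qed
  then have "?W x - ?PP x - ?NP x + ?PN x = 0" for x
    by (rule limit_zero[rotated])
      (intro bounded_clinear_add_op bounded_clinear_diff_op gdoi_tendsto(1) ex)
  then have "?W x = ?PP x + (?NP x - ?PN x)" for x
    by (simp add: algebra_simps)
  then have "?W = ?PP + (?NP - ?PN)"
    by (simp add: fun_eq_iff)
  then show ?thesis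
    unfolding D1.P_def D2.P_def .
qed

end
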